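(* The van Geemen-Sarti-Nikulin duality acts on the moduli space $\mathscr{M}_{P'}$ of $P'_{14}$-polarized K3 surfaces, $P'_{14}=H\oplus D_8(-1)\oplus D_4(-1)$, as the involution $\imath'_{\mathrm{vgsn}}:\mathscr{M}_{P'}\to\mathscr{M}_{P'}$ given by $$\begin{aligned} \mathcal{J}_2&\mapsto-\mathcal{J}_2,\\ \mathcal{J}_6&\mapsto \mathcal{J}_6+\tfrac1{10}\mathcal{J}_2^3,\\ \mathcal{J}_8&\mapsto \mathcal{J}_8-\tfrac12\mathcal{J}_6\mathcal{J}_2-\tfrac1{40}\mathcal{J}_2^4,\\ \mathcal{J}_{10}&\mapsto-\mathcal{J}_{10}-\tfrac1{20}\mathcal{J}_6\mathcal{J}_2^2-\tfrac1{400}\mathcal{J}_2^5,\\ \mathcal{J}_{12}&\mapsto-\mathcal{J}_{12}+\tfrac12\mathcal{J}_{10}\mathcal{J}_2-\tfrac3{20}\mathcal{J}_8\mathcal{J}_2^2+\tfrac14\mathcal{J}_6^2+\tfrac3{40}\mathcal{J}_6\mathcal{J}_2^3+\tfrac1{400}\mathcal{J}_2^6,\\ \mathcal{J}_{16}&\mapsto\mathcal{J}_{16}+\tfrac1{10}\mathcal{J}_{12}\mathcal{J}_2^2-\tfrac12\mathcal{J}_{10}\mathcal{J}_6-\tfrac1{20}\mathcal{J}_{10}\mathcal{J}_2^3+\tfrac3{400}\mathcal{J}_8\mathcal{J}_2^4-\tfrac1{40}\mathcal{J}_6^2\mathcal{J}_2^2-\tfrac3{800}\mathcal{J}_6\mathcal{J}_2^5-\tfrac3{32000}\mathcal{J}_2^8,\\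 \mathcal{J}_{20}&\mapsto-\mathcal{J}_{20}-\tfrac1{20}\mathcal{J}_{16}\mathcal{J}_2^2-\tfrac1{400}\mathcal{J}_{12}\mathcal{J}_2^4+\tfrac14\mathcal{J}_{10}^2+\tfrac1{40}\mathcal{J}_{10}\mathcal{J}_6\mathcal{J}_2^2+\tfrac1{800}\mathcal{J}_{10}\mathcal{J}_2^5\\ &\qquad-\tfrac1{8000}\mathcal{J}_8\mathcal{J}_2^6+\tfrac1{1600}\mathcal{J}_6^2\mathcal{J}_2^4+\tfrac1{16000}\mathcal{J}_6\mathcal{J}_2^7+\tfrac1{800000}\mathcal{J}_2^{10}. \end{aligned}$$
   Context: $\mathscr{M}_{P'}$ is the set of points $[\mathcal{J}_2:\mathcal{J}_6:\mathcal{J}_8:\mathcal{J}_{10}:\mathcal{J}_{12}:\mathcal{J}_{16}:\mathcal{J}_{20}]$ of the weighted projective space $\mathbb{WP}_{(2,6,8,10,12,16,20)}$ for which there are no $r,s\in\mathbb{C}$ with $(\mathcal{J}_2,\mathcal{J}_6,\mathcal{J}_8,\mathcal{J}_{10},\mathcal{J}_{12},\mathcal{J}_{16},\mathcal{J}_{20})=(s^2,2rs^2,-10r^2,r^2s^2,-20r^3,-15r^4,-4r^5)$. The point corresponds to the $P'_{14}$-polarized K3 surface $\mathcal{X}'$ which is the minimal resolution of the Weierstrass model $$y^2z=x^3+v^2C(u,v)x^2z+v^3D(u,v)xz^2$$ over $\mathbb{P}^1=\mathbb{P}(u,v)$ with $C=\mathcal{J}_2u^2+\mathcal{J}_6uv+\mathcal{J}_{10}v^2$,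 $D=u^5+\mathcal{J}_8u^3v^2+\mathcal{J}_{12}u^2v^3+\mathcal{J}_{16}uv^4+\mathcal{J}_{20}v^5$. This elliptic fibration (the alternate fibration, unique up to isomorphism on a $P'_{14}$-polarized K3 surface) has section $[0:1:0]$ and 2-torsion section $[0:0:1]$; fiberwise translation by the latter is a symplectic involution $\jmath_{\mathcal{X}'}$. The van Geemen-Sarti-Nikulin duality sends $\mathcal{X}'$ to the K3 surface $\mathcal{Y}'$ obtained as the minimal resolution of $\mathcal{X}'/\langle\jmath_{\mathcal{X}'}\rangle$, which carries the induced fibration $y^2z=x^3-2v^2C\,x^2z+v^3(vC^2-4D)\,xz^2$ and is again $P'_{14}$-polarized. Here $H$ is the hyperbolic plane lattice and $D_n(-1)$ the negative definite root lattice. *)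

theory Defs
  imports Complex_Main "HOL-Library.FuncSet"
begin

section \<open>The weighted projective space and the moduli space\<close>

text \<open>Homogeneous coordinates \<open>(J2, J6, J8, J10, J12, J16, J20)\<close>, the indices being the weights.\<close>

type_synonym coords =
  "complex \<times> complex \<times> complex \<times> complex \<times> complex \<times> complex \<times> complex"

fun scale :: "complex \<Rightarrow> coords \<Rightarrow> coords" where
  "scale l (j2, j6, j8, j10, j12, j16, j20) =
     (l^2 * j2, l^6 * j6, l^8 * j8, l^10 * j10, l^12 * j12, l^16 * j16, l^20 * j20)"

definition wpoint :: "coords \<Rightarrow> coords set" where
  "wpoint J = {scale l J | l. l \<noteq> 0}"

definition WP :: "coords set set" where
  "WP = {wpoint J | J. J \<noteq> (0, 0, 0, 0, 0, 0, 0)}"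

text \<open>The excluded family below is stable under \<^const>\<open>scale\<close> (replace \<open>(r, s)\<close> by
  \<open>(l^4 * r, l * s)\<close>), so it does not matter which representative is tested.\<close>

definition moduli :: "coords set set" where
  "moduli = {P \<in> WP. \<forall>J\<in>P. \<nexists>r s :: complex.
     J = (s^2, 2*r*s^2, -10*r^2, r^2*s^2, -20*r^3, -15*r^4, -4*r^5)}"


section \<open>The alternate fibration\<close>

fun C_form :: "coords \<Rightarrow> complex \<Rightarrow> complex \<Rightarrow> complex" where
  "C_form (j2, j6, j8, j10, j12, j16, j20) u v = j2 * u^2 + j6 * u * v + j10 * v^2"

fun D_form :: "coords \<Rightarrow> complex \<Rightarrow> complex \<Rightarrow> complex" where
  "D_form (j2, j6, j8, j10, j12, j16, j20) u v =
     u^5 + j8 * u^3 * v^2 + j12 * u^2 * v^3 + j16 * u * v^4 + j20 * v^5"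

definition weierstrass ::
  "coords \<Rightarrow> complex \<Rightarrow> complex \<Rightarrow> complex \<Rightarrow> complex \<Rightarrow> complex \<Rightarrow> bool" where
  "weierstrass J u v x y z \<longleftrightarrow>
     y^2 * z = x^3 + v^2 * C_form J u v * x^2 * z + v^3 * D_form J u v * x * z^2"

text \<open>A relatively minimal elliptic surface with section over the projective line is determined,
  as a fibration with section, by its restriction to any nonempty Zariski open subset of the base;
  for K3 surfaces the minimal resolutions in question are therefore determined by such
  restrictions. We work over the complement of a finite set \<open>F\<close> in the chart \<open>v = 1\<close>,
  \<open>t = u / v\<close>, where all fibres are smooth: \<open>x^3 + C x^2 + D x\<close> has distinct roots.\<close>

definition good_base :: "coords \<Rightarrow> complex set \<Rightarrow> bool" where
  "good_base J F \<longleftrightarrow> finite F \<and>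
     (\<forall>t. t \<notin> F \<longrightarrow> D_form J t 1 \<noteq> 0 \<and> (C_form J t 1)^2 \<noteq> 4 * D_form J t 1)"

text \<open>\<open>z = 1\<close> is the complement of the section \<open>[0:1:0]\<close>. In addition \<open>fib_punct\<close> omits the
  2-torsion section \<open>[0:0:1]\<close>, which is the only point with \<open>x = 0\<close> of each affine fibre.\<close>

definition fib_aff :: "coords \<Rightarrow> complex set \<Rightarrow> (complex \<times> complex \<times> complex) set" where
  "fib_aff J F = {(t, x, y). t \<notin> F \<and> weierstrass J t 1 x y 1}"

definition fib_punct :: "coords \<Rightarrow> complex set \<Rightarrow> (complex \<times> complex \<times> complex) set" where
  "fib_punct J F = {(t, x, y). t \<notin> F \<and> x \<noteq> 0 \<and> weierstrass J t 1 x y 1}"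

inductive_set generated_algebra :: "('a \<Rightarrow> complex) set \<Rightarrow> ('a \<Rightarrow> complex) set"
  for G :: "('a \<Rightarrow> complex) set" where
  const: "(\<lambda>_. c) \<in> generated_algebra G"
| gen: "g \<in> G \<Longrightarrow> g \<in> generated_algebra G"
| add: "f \<in> generated_algebra G \<Longrightarrow> g \<in> generated_algebra G \<Longrightarrow> (\<lambda>p. f p + g p) \<in> generated_algebra G"
| mult: "f \<in> generated_algebra G \<Longrightarrow> g \<in> generated_algebra G \<Longrightarrow> (\<lambda>p. f p * g p) \<in> generated_algebra G"

text \<open>Both \<^const>\<open>fib_aff\<close> and \<^const>\<open>fib_punct\<close> are affine varieties; restricting the functions
  below to them gives their coordinate rings.\<close>

definition fun_aff :: "complex set \<Rightarrow> (complex \<times> complex \<times> complex \<Rightarrow> complex) set" where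
  "fun_aff F = generated_algebra
     ({\<lambda>(t, x, y). t, \<lambda>(t, x, y). x, \<lambda>(t, x, y). y} \<union> {\<lambda>(t, x, y). 1 / (t - c) | c. c \<in> F})"

definition fun_punct :: "complex set \<Rightarrow> (complex \<times> complex \<times> complex \<Rightarrow> complex) set" where
  "fun_punct F = generated_algebra
     ({\<lambda>(t, x, y). t, \<lambda>(t, x, y). x, \<lambda>(t, x, y). y, \<lambda>(t, x, y). 1 / x}
       \<union> {\<lambda>(t, x, y). 1 / (t - c) | c. c \<in> F})"


section \<open>Translation by the 2-torsion section\<close>

text \<open>Chord addition of two affine points with different \<open>x\<close>-coordinates on the elliptic curve
  \<open>y^2 = x^3 + a * x^2 + b * x\<close> with origin \<open>[0:1:0]\<close>.\<close>

fun chord_add :: "complex \<Rightarrow> complex \<times> complex \<Rightarrow> complex \<times> complex \<Rightarrow> complex \<times> complex" where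
  "chord_add a (x1, y1) (x2, y2) =
     (let m = (y2 - y1) / (x2 - x1); x3 = m^2 - a - x1 - x2
      in (x3, - (y1 + m * (x3 - x1))))"

text \<open>Only used on \<^const>\<open>fib_punct\<close>, where the two points added have different
  \<open>x\<close>-coordinates.\<close>

fun torsion_translation ::
  "coords \<Rightarrow> complex \<times> complex \<times> complex \<Rightarrow> complex \<times> complex \<times> complex" where
  "torsion_translation J (t, x, y) = (t, chord_add (C_form J t 1) (x, y) (0, 0))"

lemma torsion_translation_explicit:
  assumes "weierstrass J t 1 x y 1" "x \<noteq> 0"
  shows "torsion_translation J (t, x, y) = (t, D_form J t 1 / x, - D_form J t 1 * y / x^2)"
proof -
  have eq: "y^2 = x^3 + C_form J t 1 * x^2 + D_form J t 1 * x"
    using assms(1) by (simp add: weierstrass_def)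
  have "(y / x)^2 = x + C_form J t 1 + D_form J t 1 / x"
    unfolding power_divide eq using assms(2)
    by (simp add: field_simps power2_eq_square power3_eq_cube)
  then have x3: "(y / x)^2 - C_form J t 1 - x = D_form J t 1 / x" by simp
  have y3: "- (y + y / x * (D_form J t 1 / x - x)) = - D_form J t 1 * y / x^2"
    using assms(2) by (simp add: field_simps power2_eq_square)
  have "torsion_translation J (t, x, y) =
      (t, (y / x)^2 - C_form J t 1 - x, - (y + y / x * ((y / x)^2 - C_form J t 1 - x - x)))"
    by (simp add: Let_def)
  then show ?thesis unfolding x3 y3 .
qed


section \<open>The van Geemen-Sarti-Nikulin duality\<close>

text \<open>Quotient of an affine variety \<open>S\<close> with coordinate ring \<open>R\<close> by an involution \<open>j\<close>: the
  fibres of \<open>\<phi>\<close> are the orbits, and pullback along \<open>\<phi>\<close> identifies the coordinate ring of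
  \<open>S'\<close> with the ring of invariants.\<close>

definition quotient_by_involution ::
  "'a set \<Rightarrow> ('a \<Rightarrow> complex) set \<Rightarrow> ('a \<Rightarrow> 'a) \<Rightarrow> 'b set \<Rightarrow> ('b \<Rightarrow> complex) set \<Rightarrow> ('a \<Rightarrow> 'b) \<Rightarrow> bool" where
  "quotient_by_involution S R j S' R' \<phi> \<longleftrightarrow>
     \<phi> ` S = S' \<and>
     (\<forall>p\<in>S. \<forall>q\<in>S. \<phi> p = \<phi> q \<longleftrightarrow> q = p \<or> q = j p) \<and>
     {restrict (f \<circ> \<phi>) S | f. f \<in> R'} = {restrict f S | f. f \<in> R \<and> (\<forall>p\<in>S. f (j p) = f p)}"

text \<open>\<open>vgsn_related J K\<close>: the fibration induced on the quotient of the surface of \<open>J\<close> by the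
  translation is isomorphic, as an elliptic fibration with section, to the alternate fibration
  of \<open>K\<close>. The isomorphism covers an automorphism \<open>t \<mapsto> (a t + b) / (c t + d)\<close> of the base; it
  respects the zero sections because the preimage of the zero section under the 2-isogeny
  consists of the two sections omitted from \<open>fib_punct J F\<close>.
  By uniqueness of the alternate fibration this expresses that the van Geemen-Sarti-Nikulin
  dual of the polarized K3 surface of \<open>J\<close> is the polarized K3 surface of \<open>K\<close>.\<close>

definition vgsn_related :: "coords \<Rightarrow> coords \<Rightarrow> bool" where
  "vgsn_related J K \<longleftrightarrow>
     (\<exists>F F' a b c d \<phi>.
        good_base J F \<and> good_base K F' \<and>
        a * d - b * c \<noteq> 0 \<and> (\<forall>t. t \<notin> F \<longrightarrow> c * t + d \<noteq> 0) \<and>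
        quotient_by_involution (fib_punct J F) (fun_punct F) (torsion_translation J)
          (fib_aff K F') (fun_aff F') \<phi> \<and>
        (\<forall>(t, x, y)\<in>fib_punct J F. fst (\<phi> (t, x, y)) = (a * t + b) / (c * t + d)))"

definition is_vgsn_dual :: "coords set \<Rightarrow> coords set \<Rightarrow> bool" where
  "is_vgsn_dual P Q \<longleftrightarrow> Q \<in> moduli \<and> (\<exists>J\<in>P. \<exists>K\<in>Q. vgsn_related J K)"

definition vgsn :: "coords set \<Rightarrow> coords set" where
  "vgsn P = (THE Q. is_vgsn_dual P Q)"

end

theory Submission
  imports Defs "HOL-Computational_Algebra.Fundamental_Theorem_Algebra"
begin

text \<open>The 2-isogenous fibration \<open>y^2 = x^3 - 2 C x^2 + (C^2 - 4 D) x\<close> becomes, after rescaling and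
  the base change \<open>t \<mapsto> J2^2 / 20 - t\<close>, which removes the \<open>t^4\<close>-term, the alternate fibration with
  \<open>C' = - C\<close> and \<open>D' = C^2 / 4 - D\<close>; these are the stated formulas. In this shape the involution
  property is immediate.

  For uniqueness, two fibrations that are both quotients of the same surface are isomorphic over
  a Moebius transformation. On each fibre the isomorphism is affine, \<open>x \<mapsto> \<alpha> x + \<beta>\<close>,
  \<open>y \<mapsto> \<gamma> y\<close>, by comparing pole orders, and \<open>\<alpha>\<close>, \<open>\<beta>\<close>, \<open>\<gamma>\<close> are rational in \<open>t\<close>.
  Here \<open>\<beta> = 0\<close> because \<open>C^2 - 4 D\<close> has odd degree, so that there is only one 2-torsion section,
  and the scaling factor \<open>\<gamma> / \<alpha>\<close> is determined up to a constant because points of the moduli space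
  are exactly those whose Weierstrass model is minimal. What remains is a rescaling of the
  coordinates, even if the two surfaces have a second fibre of type III* that is exchanged with
  the one at infinity.\<close>

section \<open>Normal forms and their rescaling\<close>

text \<open>The relation \<open>vgsn_related\<close> speaks only of point sets and rings of
  functions, so nothing says in advance that a map between two quotients is given by formulas
  rational in t. Everything is extracted from the fact that both rings pull back onto the same ring
  of invariants. On one fibre this forces the affine shape, but the resulting coefficients are
  chosen fibre by fibre, and their dependence on t has to be recovered from single global functions.
  The other obstacle is that the omitted finite sets are arbitrary and that the Moebius
  transformation need not fix infinity. What happens at omitted fibres is recovered from polynomial
  identities valid for all but finitely many t. With U / V the transformation, the polynomials V^2
  C(U,V) and V^3 D(U,V) are homogeneous of degrees 4 and 8 in U and V; in these terms the scaling
  factor can be tested at every finite place, including the pole of the transformation.\<close>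

fun dual_coords :: "coords \<Rightarrow> coords" where
  "dual_coords (J2, J6, J8, J10, J12, J16, J20) =
       (- J2,
        J6 + 1/10 * J2^3,
        J8 - 1/2 * J6 * J2 - 1/40 * J2^4,
        - J10 - 1/20 * J6 * J2^2 - 1/400 * J2^5,
        - J12 + 1/2 * J10 * J2 - 3/20 * J8 * J2^2 + 1/4 * J6^2 + 3/40 * J6 * J2^3
          + 1/400 * J2^6,
        J16 + 1/10 * J12 * J2^2 - 1/2 * J10 * J6 - 1/20 * J10 * J2^3 + 3/400 * J8 * J2^4
          - 1/40 * J6^2 * J2^2 - 3/800 * J6 * J2^5 - 3/32000 * J2^8,
        - J20 - 1/20 * J16 * J2^2 - 1/400 * J12 * J2^4 + 1/4 * J10^2
          + 1/40 * J10 * J6 * J2^2 + 1/800 * J10 * J2^5 - 1/8000 * J8 * J2^6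
          + 1/1600 * J6^2 * J2^4 + 1/16000 * J6 * J2^7 + 1/800000 * J2^10)"

text \<open>C^2 / 4 - D starts with - t^5 + (J2^2 / 4) t^4. Substituting s - t for t makes it monic,
  with t^4-coefficient J2^2 / 4 - 5 s; this vanishes for s = J2^2 / 20.\<close>

definition shift :: "coords \<Rightarrow> complex" where
  "shift J = fst J ^ 2 / 20"

definition C_poly :: "coords \<Rightarrow> complex poly" where
  "C_poly J = (case J of (j2, j6, j8, j10, j12, j16, j20) \<Rightarrow> [:j10, j6, j2:])"

definition D_poly :: "coords \<Rightarrow> complex poly" where
  "D_poly J = (case J of (j2, j6, j8, j10, j12, j16, j20) \<Rightarrow> [:j20, j16, j12, j8, 0, 1:])"

lemma poly_C_poly: "poly (C_poly J) t = C_form J t 1"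
  by (cases J) (simp add: C_poly_def algebra_simps power2_eq_square)

lemma poly_D_poly: "poly (D_poly J) t = D_form J t 1"
  by (cases J) (simp add: D_poly_def algebra_simps eval_nat_numeral)

lemma degree_C_poly: "degree (C_poly J) \<le> 2"
  by (cases J) (simp add: C_poly_def)

lemma degree_D_poly: "degree (D_poly J) = 5"
  by (cases J) (simp add: D_poly_def)

lemma poly_eq_cofinite:
  fixes p q :: "complex poly"
  assumes "\<forall>\<^sub>F t in cofinite. poly p t = poly q t"
  shows "p = q"
proof (rule ccontr)
  assume "p \<noteq> q"
  then have "finite {t. poly (p - q) t = 0}" by (intro poly_roots_finite) simp
  then have "\<forall>\<^sub>F t in cofinite. poly p t \<noteq> poly q t"
    by (simp add: eventually_cofinite)
  with assms have "\<forall>\<^sub>F t :: complex in cofinite. False" by eventually_elim simp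
  then show False by (simp add: eventually_cofinite infinite_UNIV_char_0)
qed

lemma eventually_poly_nonzero:
  fixes p :: "complex poly"
  shows "p \<noteq> 0 \<Longrightarrow> \<forall>\<^sub>F t in cofinite. poly p t \<noteq> 0"
  by (simp add: eventually_cofinite poly_roots_finite)

text \<open>The coordinates are exactly the coefficients of C and D that are not normalized.
  Identities between long coordinate vectors thus reduce to identities between values of two
  functions.\<close>

lemma coords_eqI:
  assumes "\<forall>\<^sub>F t in cofinite. C_form J t 1 = C_form K t 1"
    and "\<forall>\<^sub>F t in cofinite. D_form J t 1 = D_form K t 1"
  shows "J = K"
proof -
  have "C_poly J = C_poly K" "D_poly J = D_poly K"
    using assms by (auto intro!: poly_eq_cofinite simp: poly_C_poly poly_D_poly)
  then show ?thesis by (cases J; cases K) (simp add: C_poly_def D_poly_def)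
qed

section \<open>Weighted rescaling as a rescaling of the fibration, with t of weight 4\<close>

lemma C_form_scale: "C_form (scale l J) (l^4 * t) 1 = l^10 * C_form J t 1"
  by (cases J) (simp add: algebra_simps flip: power_add power_mult)

lemma D_form_scale: "D_form (scale l J) (l^4 * t) 1 = l^20 * D_form J t 1"
  by (cases J) (simp add: algebra_simps power_mult_distrib flip: power_add power_mult)

lemma scale_eqI:
  assumes "l \<noteq> 0" "\<And>t. C_form K (l^4 * t) 1 = l^10 * C_form J t 1"
    "\<And>t. D_form K (l^4 * t) 1 = l^20 * D_form J t 1"
  shows "K = scale l J"
proof (rule coords_eqI)
  have t: "l^4 * (t / l^4) = t" for t using assms(1) by simp
  show "\<forall>\<^sub>F t in cofinite. C_form K t 1 = C_form (scale l J) t 1"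
    using assms(2)[of "t / l^4" for t] C_form_scale[of l J "t / l^4" for t]
    by (intro eventuallyI) (simp add: t del: times_divide_eq_right)
  show "\<forall>\<^sub>F t in cofinite. D_form K t 1 = D_form (scale l J) t 1"
    using assms(3)[of "t / l^4" for t] D_form_scale[of l J "t / l^4" for t]
    by (intro eventuallyI) (simp add: t del: times_divide_eq_right)
qed

text \<open>A rescaling of fibrations shows only w = l^4 and \<rho> = l^2. Either square root of
  \<rho> may serve as l, since all weights are even.\<close>

lemma mem_wpointI:
  assumes "w \<noteq> 0" "\<rho>^2 = w" "\<And>t. C_form K (w * t) 1 = \<rho> * w^2 * C_form J t 1"
    "\<And>t. D_form K (w * t) 1 = w^5 * D_form J t 1"
  shows "K \<in> wpoint J"
proof -
  define l where "l = csqrt \<rho>"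
  have l2: "l^2 = \<rho>" by (simp add: l_def)
  have "l^4 = (l^2)^2" by (simp flip: power_mult)
  then have l4: "l^4 = w" by (simp only: l2 assms(2))
  have "l^10 = l^2 * (l^4)^2" by (simp flip: power_mult power_add)
  then have "l^10 = \<rho> * w^2" by (simp only: l2 l4)
  moreover have "l^20 = (l^4)^5" by (simp flip: power_mult)
  then have "l^20 = w^5" by (simp only: l4)
  moreover have "l \<noteq> 0" using l4 assms(1) by auto
  ultimately have "K = scale l J"
    by (intro scale_eqI) (simp_all only: l4 assms(3,4) not_False_eq_True)
  with \<open>l \<noteq> 0\<close> show ?thesis unfolding wpoint_def by blast
qed

lemma scale_scale: "scale k (scale l J) = scale (k * l) J"
  by (cases J) (simp add: power_mult_distrib)

lemma scale_1 [simp]: "scale 1 J = J"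
  by (cases J) simp

lemma wpoint_eq:
  assumes "K \<in> wpoint J"
  shows "wpoint K = wpoint J"
proof -
  obtain l where l: "l \<noteq> 0" "K = scale l J" using assms unfolding wpoint_def by auto
  show ?thesis
  proof (intro equalityI subsetI)
    fix M assume "M \<in> wpoint K"
    then obtain k where "k \<noteq> 0" "M = scale (k * l) J"
      unfolding wpoint_def l by (auto simp: scale_scale)
    then show "M \<in> wpoint J" using l unfolding wpoint_def by fastforce
  next
    fix M assume "M \<in> wpoint J"
    then obtain k where "k \<noteq> 0" "M = scale (k / l) K"
      using l unfolding wpoint_def by (auto simp: scale_scale)
    then show "M \<in> wpoint K" using l unfolding wpoint_def by fastforce
  qed
qed

lemma self_in_wpoint: "J \<in> wpoint J"
  unfolding wpoint_def by (auto intro!: exI[of _ 1])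

section \<open>The duality on normal forms\<close>

lemma C_form_dual: "C_form (dual_coords J) (shift J - t) 1 = - C_form J t 1"
proof -
  obtain j2 j6 j8 j10 j12 j16 j20 where J: "J = (j2, j6, j8, j10, j12, j16, j20)"
    by (cases J)
  \<comment> \<open>With j2 = 20 a all coefficients become integers, and the claim is a polynomial
    identity within reach of \<open>algebra\<close>.\<close>
  define a where "a = j2 / 20"
  then have *: "j2 = 20 * a" by auto
  show ?thesis
    unfolding J * shift_def by (simp add: power_mult_distrib) algebra
qed

lemma D_form_dual:
  "D_form (dual_coords J) (shift J - t) 1 = (C_form J t 1)^2 / 4 - D_form J t 1"
proof -
  obtain j2 j6 j8 j10 j12 j16 j20 where J: "J = (j2, j6, j8, j10, j12, j16, j20)"
    by (cases J)
  \<comment> \<open>Halving j6 and j10 as well turns C^2 / 4 into the square of a form with integer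
    coefficients.\<close>
  define a b d where "a = j2 / 20" and "b = j6 / 2" and "d = j10 / 2"
  then have *: "j2 = 20 * a" "j6 = 2 * b" "j10 = 2 * d" by auto
  show ?thesis
    unfolding J * shift_def by (simp add: power_mult_distrib) algebra
qed

lemma shift_dual: "shift (dual_coords J) = shift J"
  by (cases J) (simp add: shift_def)

text \<open>On forms the map is (C, D) to (- C, C^2 / 4 - D), whose square is visibly the identity.
  The base change t to s - t is its own inverse, and s is unchanged because it depends only on
  J2^2.\<close>

lemma dual_dual: "dual_coords (dual_coords J) = J"
proof (rule coords_eqI)
  note C = C_form_dual[of "dual_coords J", unfolded shift_dual]
    and D = D_form_dual[of "dual_coords J", unfolded shift_dual]
  show "\<forall>\<^sub>F t in cofinite. C_form (dual_coords (dual_coords J)) t 1 = C_form J t 1"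
    using C[of "shift J - t" for t] C_form_dual[of J] by (intro eventuallyI) simp
  show "\<forall>\<^sub>F t in cofinite. D_form (dual_coords (dual_coords J)) t 1 = D_form J t 1"
    using D[of "shift J - t" for t] C_form_dual[of J] D_form_dual[of J]
    by (intro eventuallyI) simp
qed

lemma shift_scale: "shift (scale l J) = l^4 * shift J"
  by (cases J) (simp add: shift_def power_mult_distrib flip: power_mult)

lemma dual_scale:
  assumes "l \<noteq> 0"
  shows "dual_coords (scale l J) = scale l (dual_coords J)"
proof (rule scale_eqI[OF assms])
  fix t
  define u where "u = shift J - t"
  have t: "t = shift J - u" by (simp add: u_def)
  have l: "l^4 * t = shift (scale l J) - l^4 * u"
    by (simp add: t shift_scale algebra_simps)
  have l20: "l^20 = (l^10)^2" by (simp flip: power_mult)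
  have C: "C_form (dual_coords J) t 1 = - C_form J u 1"
    and D: "D_form (dual_coords J) t 1 = (C_form J u 1)^2 / 4 - D_form J u 1"
    by (simp_all only: t C_form_dual D_form_dual)
  show "C_form (dual_coords (scale l J)) (l^4 * t) 1 = l^10 * C_form (dual_coords J) t 1"
    unfolding l C_form_dual C_form_scale C by simp
  show "D_form (dual_coords (scale l J)) (l^4 * t) 1 = l^20 * D_form (dual_coords J) t 1"
    unfolding l D_form_dual C_form_scale D_form_scale D l20
    by (simp add: power_mult_distrib algebra_simps)
qed

section \<open>Nonminimal fibrations and membership in the moduli space\<close>

definition excluded :: "coords \<Rightarrow> bool" where
  "excluded J \<longleftrightarrow> (\<exists>r s :: complex.
     J = (s^2, 2* r* s^2, -10* r^2, r^2* s^2, -20* r^3, -15* r^4, -4* r^5))"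

text \<open>The excluded family consists of the fibrations that are not minimal in a finite fibre.\<close>

lemma excludedI:
  assumes "\<forall>\<^sub>F t in cofinite. C_form J t 1 = k * (t - e)^2"
    and "\<forall>\<^sub>F t in cofinite. D_form J t 1 = (t - e)^4 * (h * t + g)"
  shows "excluded J"
proof -
  have "D_poly J = [:-e, 1:]^4 * [:g, h:]"
    using assms(2) by (intro poly_eq_cofinite) (simp add: poly_D_poly algebra_simps)
  \<comment> \<open>D is monic and has no t^4-term, which fixes the linear cofactor
    completely.\<close>
  then have g: "h = 1" "g = 4 * e"
    by (cases J; simp add: D_poly_def eval_nat_numeral; fail)+
  define s where "s = csqrt k"
  have k: "k = s^2" by (simp add: s_def)
  have "J = (s^2, 2 * (-e)* s^2, -10*(-e)^2, (-e)^2* s^2, -20*(-e)^3, -15*(-e)^4, -4*(-e)^5)"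
  proof (rule coords_eqI)
    show "\<forall>\<^sub>F t in cofinite. C_form J t 1 =
      C_form (s^2, 2 * (-e)* s^2, -10*(-e)^2, (-e)^2* s^2, -20*(-e)^3, -15*(-e)^4, -4*(-e)^5) t 1"
      using assms(1) by eventually_elim (simp add: k power2_eq_square algebra_simps)
    show "\<forall>\<^sub>F t in cofinite. D_form J t 1 =
      D_form (s^2, 2 * (-e)* s^2, -10*(-e)^2, (-e)^2* s^2, -20*(-e)^3, -15*(-e)^4, -4*(-e)^5) t 1"
      using assms(2) by eventually_elim (simp add: g eval_nat_numeral algebra_simps)
  qed
  then show ?thesis unfolding excluded_def by blast
qed

lemma excluded_scale: "excluded J \<Longrightarrow> excluded (scale l J)"
  unfolding excluded_def
proof (elim exE)
  fix r s assume J: "J = (s^2, 2* r* s^2, -10* r^2, r^2* s^2, -20* r^3, -15* r^4, -4* r^5)"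
  have "scale l J = ((l * s)^2, 2 * (l^4* r)* (l * s)^2, -10*(l^4* r)^2, (l^4* r)^2 * (l * s)^2,
      -20*(l^4* r)^3, -15*(l^4* r)^4, -4*(l^4* r)^5)"
    unfolding J by (simp add: power_mult_distrib flip: power_mult power_add)
  then show "\<exists>r s. scale l J =
      (s^2, 2* r* s^2, -10* r^2, r^2* s^2, -20* r^3, -15* r^4, -4* r^5)" by blast
qed

text \<open>If (t + r)^2 divides C and (t + r)^4 divides D, the same holds for - C and C^2 / 4 - D.
  The witnesses are the double root - r carried to s + r by the base change t to s - t with s =
  \<open>shift J\<close>, and the linear cofactor left after removing the fourth power.\<close>

lemma excluded_dual:
  assumes "excluded J"
  shows "excluded (dual_coords J)"
proof -
  obtain r s where J: "J = (s^2, 2* r* s^2, -10* r^2, r^2* s^2, -20* r^3, -15* r^4, -4* r^5)"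
    using assms unfolding excluded_def by blast
  have CJ: "C_form J t 1 = s^2 * (t + r)^2" for t
    unfolding J by (simp add: power2_eq_square algebra_simps)
  have DJ: "D_form J t 1 = (t + r)^4 * (t - 4 * r)" for t
    unfolding J by (simp add: eval_nat_numeral algebra_simps)
  show ?thesis
  proof (rule excludedI[where k = "- (s^2)" and e = "shift J + r"
        and h = 1 and g = "s^4 / 4 - shift J + 4 * r"]; intro eventuallyI)
    fix t
    have "C_form (dual_coords J) t 1 = - C_form J (shift J - t) 1"
      using C_form_dual[of J "shift J - t"] by simp
    then show "C_form (dual_coords J) t 1 = - (s^2) * (t - (shift J + r))^2"
      unfolding CJ by (simp add: power2_eq_square algebra_simps)
    have "D_form (dual_coords J) t 1 =
        (C_form J (shift J - t) 1)^2 / 4 - D_form J (shift J - t) 1"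
      using D_form_dual[of J "shift J - t"] by simp
    also have "\<dots> = (shift J - t + r)^4 * (s^4 / 4 - (shift J - t) + 4 * r)"
      unfolding CJ DJ by (simp add: power_mult_distrib algebra_simps flip: power_mult)
    also have "(shift J - t + r)^4 = (t - (shift J + r))^4"
      by (simp add: eval_nat_numeral algebra_simps)
    finally show "D_form (dual_coords J) t 1 =
        (t - (shift J + r))^4 * (1 * t + (s^4 / 4 - shift J + 4 * r))" by simp
  qed
qed

lemma wpoint_in_moduli:
  "wpoint J \<in> moduli \<longleftrightarrow> J \<noteq> (0, 0, 0, 0, 0, 0, 0) \<and> \<not> excluded J"
proof -
  have "wpoint J \<in> WP \<longleftrightarrow> J \<noteq> (0, 0, 0, 0, 0, 0, 0)"
  proof
    assume "wpoint J \<in> WP"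
    then obtain K where K: "wpoint J = wpoint K" "K \<noteq> (0, 0, 0, 0, 0, 0, 0)"
      unfolding WP_def by auto
    then obtain l where "K = scale l J" using self_in_wpoint[of K] unfolding wpoint_def by auto
    with K(2) show "J \<noteq> (0, 0, 0, 0, 0, 0, 0)" by auto
  next
    assume "J \<noteq> (0, 0, 0, 0, 0, 0, 0)"
    then show "wpoint J \<in> WP" unfolding WP_def by blast
  qed
  moreover have "(\<forall>K\<in>wpoint J. \<not> excluded K) \<longleftrightarrow> \<not> excluded J"
  proof
    assume "\<not> excluded J"
    show "\<forall>K\<in>wpoint J. \<not> excluded K"
    proof
      fix K assume "K \<in> wpoint J"
      then obtain l where "J = scale l K"
        using wpoint_eq[of K J] self_in_wpoint[of J] unfolding wpoint_def by auto
      with \<open>\<not> excluded J\<close> show "\<not> excluded K" using excluded_scale by blast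
    qed
  qed (use self_in_wpoint in blast)
  ultimately show ?thesis unfolding moduli_def excluded_def by blast
qed

lemma dual_in_moduli:
  assumes "wpoint J \<in> moduli"
  shows "wpoint (dual_coords J) \<in> moduli"
proof -
  have "dual_coords J \<noteq> (0, 0, 0, 0, 0, 0, 0)"
  proof
    assume "dual_coords J = (0, 0, 0, 0, 0, 0, 0)"
    then have "J = dual_coords (0, 0, 0, 0, 0, 0, 0)" using dual_dual[of J] by metis
    with assms show False by (simp add: wpoint_in_moduli)
  qed
  moreover have "\<not> excluded (dual_coords J)"
    using assms excluded_dual[of "dual_coords J"] by (auto simp: wpoint_in_moduli dual_dual)
  ultimately show ?thesis by (simp add: wpoint_in_moduli)
qed

section \<open>Isomorphisms of affine elliptic curves\<close>

text \<open>Along a path on the curve with \<open>x = s^2\<close>, a regular function grows like \<open>s\<close> to the power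
  of its pole order at the origin of the group law.\<close>

definition growth :: "(real \<Rightarrow> complex) \<Rightarrow> nat \<Rightarrow> bool" where
  "growth f n \<longleftrightarrow> (\<exists>c. c \<noteq> 0 \<and> ((\<lambda>s. f s / of_real s ^ n) \<longlongrightarrow> c) at_top)"

lemma tendsto_inverse_power:
  assumes "m > 0"
  shows "((\<lambda>s. inverse (complex_of_real s ^ m)) \<longlongrightarrow> 0) at_top"
proof -
  have "((\<lambda>s::real. inverse (s ^ m)) \<longlongrightarrow> 0) at_top"
    using assms by (intro tendsto_inverse_0_at_top filterlim_pow_at_top filterlim_ident) auto
  then have "((\<lambda>s. complex_of_real (inverse (s ^ m))) \<longlongrightarrow> of_real 0) at_top"
    by (rule tendsto_of_real)
  then show ?thesis by simp
qed

lemma growth_less: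
  assumes "((\<lambda>s. f s / complex_of_real s ^ n) \<longlongrightarrow> c) at_top" "n < m"
  shows "((\<lambda>s. f s / complex_of_real s ^ m) \<longlongrightarrow> 0) at_top"
proof -
  have "((\<lambda>s. f s / complex_of_real s ^ n * inverse (of_real s ^ (m - n))) \<longlongrightarrow> c * 0) at_top"
    using assms by (intro tendsto_mult tendsto_inverse_power) auto
  moreover have "f s / complex_of_real s ^ n * inverse (of_real s ^ (m - n)) = f s / of_real s ^ m"
    for s using assms(2) by (simp add: divide_inverse mult.assoc flip: power_add nonzero_inverse_mult_distrib)
     (metis inverse_mult_distrib less_or_eq_imp_le le_add_diff_inverse power_add)
  ultimately show ?thesis by simp
qed

lemma growth_unique:
  assumes "growth f n" "growth f m"
  shows "n = m"
proof -
  have False if "growth f n" "growth f m" "n < m" for n m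
  proof -
    obtain c where c: "c \<noteq> 0" "((\<lambda>s. f s / of_real s ^ m) \<longlongrightarrow> c) at_top"
      using \<open>growth f m\<close> unfolding growth_def by blast
    obtain d where d: "((\<lambda>s. f s / of_real s ^ n) \<longlongrightarrow> d) at_top"
      using \<open>growth f n\<close> unfolding growth_def by blast
    have "c = 0"
      using tendsto_unique[OF _ c(2) growth_less[OF d \<open>n < m\<close>]] by simp
    with c(1) show False ..
  qed
  then show ?thesis using assms by (metis nat_neq_iff)
qed

lemma growth_nonzero: "\<not> growth (\<lambda>_. 0) n"
proof
  assume "growth (\<lambda>_. 0) n"
  then obtain c where c: "c \<noteq> 0" "((\<lambda>s::real. 0 / complex_of_real s ^ n) \<longlongrightarrow> c) at_top"
    unfolding growth_def by blast
  have "((\<lambda>s::real. 0 / complex_of_real s ^ n) \<longlongrightarrow> 0) at_top" by simp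
  from tendsto_unique[OF _ c(2) this] c(1) show False by simp
qed

lemma growth_const: "c \<noteq> 0 \<Longrightarrow> growth (\<lambda>_. c) 0"
  unfolding growth_def by auto

lemma growth_mult:
  assumes "growth f n" "growth g m"
  shows "growth (\<lambda>s. f s * g s) (n + m)"
proof -
  obtain c where c: "c \<noteq> 0" "((\<lambda>s. f s / of_real s ^ n) \<longlongrightarrow> c) at_top"
    using assms(1) unfolding growth_def by blast
  obtain d where d: "d \<noteq> 0" "((\<lambda>s. g s / of_real s ^ m) \<longlongrightarrow> d) at_top"
    using assms(2) unfolding growth_def by blast
  have "((\<lambda>s. f s / of_real s ^ n * (g s / of_real s ^ m)) \<longlongrightarrow> c * d) at_top"
    by (intro tendsto_mult c d)
  with c(1) d(1) show ?thesis
    unfolding growth_def by (intro exI[of _ "c * d"]) (simp add: power_add)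
qed

lemma growth_add:
  assumes "growth f n" "growth g m" "m < n"
  shows "growth (\<lambda>s. f s + g s) n" "growth (\<lambda>s. g s + f s) n"
proof -
  obtain c where c: "c \<noteq> 0" "((\<lambda>s. f s / of_real s ^ n) \<longlongrightarrow> c) at_top"
    using assms(1) unfolding growth_def by blast
  obtain d where d: "((\<lambda>s. g s / of_real s ^ m) \<longlongrightarrow> d) at_top"
    using assms(2) unfolding growth_def by blast
  have "((\<lambda>s. f s / of_real s ^ n + g s / of_real s ^ n) \<longlongrightarrow> c + 0) at_top"
    by (intro tendsto_add c growth_less[OF d assms(3)])
  with c(1) show "growth (\<lambda>s. f s + g s) n"
    unfolding growth_def by (intro exI[of _ c]) (simp add: add_divide_distrib)
  then show "growth (\<lambda>s. g s + f s) n" by (simp add: add.commute)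
qed

lemma growth_poly:
  assumes "growth f n" "n > 0" "P \<noteq> 0"
  shows "growth (\<lambda>s. poly P (f s)) (n * degree P)"
  using assms(3)
proof (induction P)
  case 0
  then show ?case by simp
next
  case (pCons a P)
  show ?case
  proof (cases "P = 0")
    case True
    with pCons show ?thesis using growth_const[of a] by simp
  next
    case False
    have *: "growth (\<lambda>s. f s * poly P (f s)) (n * degree (pCons a P))"
      using growth_mult[OF assms(1) pCons.IH[OF False]] False by (simp add: algebra_simps)
    show ?thesis
    proof (cases "a = 0")
      case True
      with * show ?thesis by simp
    next
      case a: False
      show ?thesis
        using growth_add(2)[OF * growth_const[OF a]] assms(2) False by simp
    qed
  qed
qed

text \<open>The two summands have exponents k times an even and k times an odd number, so their
  leading terms cannot cancel. The factor k allows an application to functions whose growth is so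
  far known only to be in the ratio 2 : 3.\<close>

lemma growth_combination:
  assumes "growth f (2 * k)" "growth g (3 * k)" "k > 0"
    and "P \<noteq> 0 \<or> Q \<noteq> 0"
  shows "(growth (\<lambda>s. poly P (f s) + g s * poly Q (f s)) (k * (2 * degree P)) \<and>
            (Q = 0 \<or> 3 + 2 * degree Q < 2 * degree P)) \<or>
         (growth (\<lambda>s. poly P (f s) + g s * poly Q (f s)) (k * (3 + 2 * degree Q)) \<and>
            Q \<noteq> 0 \<and> (P = 0 \<or> 2 * degree P < 3 + 2 * degree Q))"
proof -
  have 1: "growth (\<lambda>s. poly P (f s)) (k * (2 * degree P))" if "P \<noteq> 0"
    using growth_poly[OF assms(1) _ that] assms(3) by (simp add: algebra_simps)
  have 2: "growth (\<lambda>s. g s * poly Q (f s)) (k * (3 + 2 * degree Q))" if "Q \<noteq> 0"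
    using growth_mult[OF assms(2) growth_poly[OF assms(1) _ that]] assms(3)
    by (simp add: algebra_simps)
  have "2 * degree P \<noteq> 3 + 2 * degree Q" by presburger
  then consider "Q = 0" | "P = 0" "Q \<noteq> 0" | "P \<noteq> 0" "Q \<noteq> 0" "3 + 2 * degree Q < 2 * degree P"
    | "P \<noteq> 0" "Q \<noteq> 0" "2 * degree P < 3 + 2 * degree Q" by linarith
  then show ?thesis
  proof cases
    case 1
    with \<open>P \<noteq> 0 \<Longrightarrow> _\<close> assms(4) show ?thesis by simp
  next
    case 2
    with \<open>Q \<noteq> 0 \<Longrightarrow> _\<close> show ?thesis by simp
  next
    case 3
    then have "k * (3 + 2 * degree Q) < k * (2 * degree P)" using assms(3) by simp
    from growth_add(1)[OF 1[OF 3(1)] 2[OF 3(2)] this] 3 show ?thesis by blast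
  next
    case 4
    then have "k * (2 * degree P) < k * (3 + 2 * degree Q)"
      using assms(3) by (metis mult_less_cancel1)
    from growth_add(2)[OF 2[OF 4(2)] 1[OF 4(1)] this] 4 show ?thesis by blast
  qed
qed

text \<open>The principal root has nonnegative real part, so \<open>csqrt z + 1\<close> has norm at
  least 1, while (csqrt z - 1)(csqrt z + 1) = z - 1. This gives the continuity of the root at 1
  needed for the path below.\<close>

lemma norm_csqrt_minus_1_le: "norm (csqrt z - 1) \<le> norm (z - 1)"
proof -
  have "Re (csqrt z) \<ge> 0" using csqrt_principal[of z] by linarith
  moreover have "Re (csqrt z) + 1 \<le> norm (csqrt z + 1)"
    using complex_Re_le_cmod[of "csqrt z + 1"] by (simp del: csqrt.sel)
  ultimately have "1 \<le> norm (csqrt z + 1)" by linarith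
  then have "norm (csqrt z - 1) * 1 \<le> norm (csqrt z - 1) * norm (csqrt z + 1)"
    by (intro mult_left_mono) auto
  also have "\<dots> = norm ((csqrt z)^2 - 1)"
    by (simp add: norm_mult[symmetric] algebra_simps power2_eq_square del: power2_csqrt)
  finally show ?thesis by simp
qed

lemma curve_path:
  fixes A B :: complex
  obtains x y :: "real \<Rightarrow> complex"
  where "\<And>s. y s ^ 2 = x s ^ 3 + A * x s ^ 2 + B * x s" "growth x 2" "growth y 3"
proof -
  define x where "x s = complex_of_real s ^ 2" for s
  \<comment> \<open>For s nonzero this is (x^3 + A x^2 + B x) / s^6, which tends to 1; extracting
    s^3 from the root avoids any choice of branch for large s. At s = 0 the path sits at the point
    (0, 0).\<close>
  define c where "c s = 1 + A * inverse (complex_of_real s ^ 2) + B * inverse (of_real s ^ 4)" for s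
  define y where "y s = complex_of_real s ^ 3 * csqrt (c s)" for s
  have "y s ^ 2 = x s ^ 3 + A * x s ^ 2 + B * x s" for s
  proof (cases "s = 0")
    case False
    have "y s ^ 2 = complex_of_real s ^ 6 * c s"
      by (simp add: y_def power_mult_distrib flip: power_mult)
    also have "\<dots> = x s ^ 3 + A * x s ^ 2 + B * x s"
      using False unfolding c_def x_def by (simp add: field_simps flip: power_mult power_add)
    finally show ?thesis .
  qed (simp add: x_def y_def)
  moreover have "eventually (\<lambda>s. 1 = x s / complex_of_real s ^ 2) at_top"
    using eventually_gt_at_top[of 0] by eventually_elim (simp add: x_def)
  then have "growth x 2"
    unfolding growth_def by (intro exI[of _ 1]) (auto intro: Lim_transform_eventually)
  moreover have "growth y 3"
  proof -
    have "(c \<longlongrightarrow> 1 + A * 0 + B * 0) at_top"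
      unfolding c_def by (intro tendsto_intros tendsto_inverse_power) auto
    then have "((\<lambda>s. c s - 1) \<longlongrightarrow> 0) at_top" by (simp add: LIM_zero)
    then have "((\<lambda>s. csqrt (c s) - 1) \<longlongrightarrow> 0) at_top"
      by (rule tendsto_0_le[where K = 1]) (simp add: norm_csqrt_minus_1_le)
    then have "((\<lambda>s. csqrt (c s)) \<longlongrightarrow> 1) at_top" by (rule LIM_zero_cancel)
    moreover have "eventually (\<lambda>s. csqrt (c s) = y s / complex_of_real s ^ 3) at_top"
      using eventually_gt_at_top[of 0] by eventually_elim (simp add: y_def)
    ultimately have "((\<lambda>s. y s / complex_of_real s ^ 3) \<longlongrightarrow> 1) at_top"
      by (rule Lim_transform_eventually)
    then show ?thesis unfolding growth_def by (intro exI[of _ 1]) simp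
  qed
  ultimately show ?thesis using that by blast
qed

lemma degree_le_1_eq: "degree p \<le> 1 \<Longrightarrow> p = [:coeff p 0, coeff p 1:]"
  by (intro poly_eqI) (auto simp: coeff_pCons coeff_eq_0 split: nat.split)

text \<open>The equation of the target makes the growth exponents of X and Y equal to 2k and 3k. As
  x and y are polynomials in X and Y, their exponents 2 and 3 are multiples of k, so k = 1. Then X
  is linear in x, and Y is linear in x and y.\<close>

lemma curve_isomorphism_affine:
  fixes A B A' B' :: complex and X Y :: "complex \<Rightarrow> complex \<Rightarrow> complex"
  assumes X: "\<And>x y. y^2 = x^3 + A * x^2 + B * x \<Longrightarrow> X x y = poly P1 x + y * poly Q1 x"
    and Y: "\<And>x y. y^2 = x^3 + A * x^2 + B * x \<Longrightarrow> Y x y = poly P2 x + y * poly Q2 x"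
    and XY: "\<And>x y. y^2 = x^3 + A * x^2 + B * x \<Longrightarrow>
      Y x y ^ 2 = X x y ^ 3 + A' * X x y ^ 2 + B' * X x y"
    and x: "\<And>x y. y^2 = x^3 + A * x^2 + B * x \<Longrightarrow> x = poly G1 (X x y) + Y x y * poly G2 (X x y)"
    and y: "\<And>x y. y^2 = x^3 + A * x^2 + B * x \<Longrightarrow> y = poly H1 (X x y) + Y x y * poly H2 (X x y)"
  obtains \<alpha> \<beta> \<gamma> where "\<alpha> \<noteq> 0"
    "\<And>x y. y^2 = x^3 + A * x^2 + B * x \<Longrightarrow> X x y = \<alpha> * x + \<beta>"
    "\<And>x y. y^2 = x^3 + A * x^2 + B * x \<Longrightarrow> Y x y = \<gamma> * y"
    "\<gamma>^2 = \<alpha>^3" "\<gamma>^2 * A = 3 * \<alpha>^2 * \<beta> + A' * \<alpha>^2"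
    "\<gamma>^2 * B = 3 * \<alpha> * \<beta>^2 + 2 * A' * \<alpha> * \<beta> + B' * \<alpha>"
    "\<beta>^3 + A' * \<beta>^2 + B' * \<beta> = 0"
proof -
  obtain xs ys where on: "\<And>s. ys s ^ 2 = xs s ^ 3 + A * xs s ^ 2 + B * xs s"
    and gx: "growth xs 2" and gy: "growth ys 3"
    by (rule curve_path[of A B]) blast
  define Xs where "Xs s = X (xs s) (ys s)" for s
  define Ys where "Ys s = Y (xs s) (ys s)" for s
  have Xs: "Xs = (\<lambda>s. poly P1 (xs s) + ys s * poly Q1 (xs s))"
    and Ys: "Ys = (\<lambda>s. poly P2 (xs s) + ys s * poly Q2 (xs s))"
    using X[OF on] Y[OF on] by (auto simp: Xs_def Ys_def)
  have XYs: "Ys s * Ys s = poly [:0, B', A', 1:] (Xs s)" for s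
    using XY[OF on[of s]] by (simp add: Xs_def Ys_def eval_nat_numeral algebra_simps)
  have xs: "xs = (\<lambda>s. poly G1 (Xs s) + Ys s * poly G2 (Xs s))"
    and ys: "ys = (\<lambda>s. poly H1 (Xs s) + Ys s * poly H2 (Xs s))"
    using x[OF on] y[OF on] by (auto simp: Xs_def Ys_def)
  \<comment> \<open>If X were constant, so would be Y^2 and hence (x - G1(\<xi>))^2, which grows
    with exponent 4.\<close>
  have nonconst: False if const: "\<And>s. Xs s = \<xi>" for \<xi>
  proof -
    have eq: "poly ([:- poly G1 \<xi>, 1:]^2) (xs s) = poly [:0, B', A', 1:] \<xi> * (poly G2 \<xi>)^2" for s
    proof -
      have "xs s - poly G1 \<xi> = Ys s * poly G2 \<xi>"
        using fun_cong[OF xs, of s] by (simp add: const)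
      then have "(xs s - poly G1 \<xi>)^2 = (Ys s * Ys s) * (poly G2 \<xi>)^2"
        by (simp add: power2_eq_square)
      also have "\<dots> = poly [:0, B', A', 1:] \<xi> * (poly G2 \<xi>)^2" by (simp only: XYs const)
      finally show ?thesis by (simp only: poly_power) simp
    qed
    define \<kappa> where "\<kappa> = poly [:0, B', A', 1:] \<xi> * (poly G2 \<xi>)^2"
    have "growth (\<lambda>s. poly ([:- poly G1 \<xi>, 1:]^2) (xs s)) (2 * degree ([:- poly G1 \<xi>, 1:]^2))"
      using gx by (intro growth_poly) auto
    then have 4: "growth (\<lambda>_. \<kappa>) 4"
      unfolding eq \<kappa>_def[symmetric] by (simp add: degree_power_eq)
    then have "\<kappa> \<noteq> 0" using growth_nonzero by metis
    from growth_unique[OF 4 growth_const[OF this]] show False by simp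
  qed
  have P1Q1: "P1 \<noteq> 0 \<or> Q1 \<noteq> 0" using nonconst[of 0] Xs by auto
  have Xcomb: "growth Xs (2 * degree P1) \<and> (Q1 = 0 \<or> 3 + 2 * degree Q1 < 2 * degree P1) \<or>
      growth Xs (3 + 2 * degree Q1) \<and> Q1 \<noteq> 0 \<and> (P1 = 0 \<or> 2 * degree P1 < 3 + 2 * degree Q1)"
    using growth_combination[of xs 1 ys P1 Q1] gx gy P1Q1 unfolding Xs by simp
  obtain n where n: "growth Xs n" "n > 0"
  proof -
    have "\<exists>n>0. growth Xs n"
    proof (cases "degree P1 = 0 \<and> Q1 = 0")
      case True
      then obtain p where "P1 = [:p:]" by (metis degree_eq_zeroE)
      then show ?thesis using True nonconst[of p] Xs by auto
    next
      case False
      with Xcomb show ?thesis by (metis add_gr_0 gr0I mult_eq_0_iff not_less_zero zero_less_numeral)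
    qed
    with that show ?thesis by blast
  qed
  have P3: "[:0, B', A', 1:] \<noteq> 0" "degree [:0, B', A', 1:] = 3" by simp_all
  have YY: "growth (\<lambda>s. Ys s * Ys s) (n * 3)"
    using growth_poly[OF n P3(1)] unfolding P3(2) XYs .
  have P2Q2: "P2 \<noteq> 0 \<or> Q2 \<noteq> 0"
    using YY Ys growth_nonzero by (cases "P2 = 0 \<and> Q2 = 0") auto
  have Ycomb: "growth Ys (2 * degree P2) \<and> (Q2 = 0 \<or> 3 + 2 * degree Q2 < 2 * degree P2) \<or>
      growth Ys (3 + 2 * degree Q2) \<and> Q2 \<noteq> 0 \<and> (P2 = 0 \<or> 2 * degree P2 < 3 + 2 * degree Q2)"
    using growth_combination[of xs 1 ys P2 Q2] gx gy P2Q2 unfolding Ys by simp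
  obtain m where m: "growth Ys m" using Ycomb by blast
  have "2 * m = 3 * n" using growth_unique[OF growth_mult[OF m m] YY] by simp
  then have "\<exists>k. n = 2 * k \<and> m = 3 * k" by presburger
  then obtain k where k: "n = 2 * k" "m = 3 * k" by blast
  have "k > 0" using n(2) k by simp
  note gX = n(1)[unfolded k] and gY = m[unfolded k]
  \<comment> \<open>Both alternatives of \<open>growth_combination\<close> produce a multiple of k,
    whatever polynomials in X and Y are taken.\<close>
  have dvd: "k dvd e" if "growth f e" "f = (\<lambda>s. poly G (Xs s) + Ys s * poly H (Xs s))" for f e G H
  proof -
    have "G \<noteq> 0 \<or> H \<noteq> 0" using that growth_nonzero by (cases "G = 0 \<and> H = 0") auto
    from growth_combination[OF gX gY \<open>k > 0\<close> this, folded that(2)]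
    show ?thesis using growth_unique[OF that(1)] by (metis dvd_triv_left)
  qed
  have "k dvd 2" "k dvd 3" using dvd[OF gx xs] dvd[OF gy ys] by auto
  then have "k dvd 3 - 2" by (rule dvd_diff_nat[rotated])
  then have "k = 1" by simp
  have g2: "growth Xs 2" and g3: "growth Ys 3" using gX gY \<open>k = 1\<close> by auto
  have "2 \<noteq> 3 + 2 * degree Q1" by presburger
  then have "\<not> growth Xs (3 + 2 * degree Q1)" using growth_unique[OF g2] by blast
  with Xcomb have *: "growth Xs (2 * degree P1)" "Q1 = 0 \<or> 3 + 2 * degree Q1 < 2 * degree P1"
    by blast+
  then have P1: "degree P1 = 1" and Q1: "Q1 = 0" using growth_unique[OF g2 *(1)] by auto
  have "3 \<noteq> 2 * degree P2" by presburger
  then have "\<not> growth Ys (2 * degree P2)" using growth_unique[OF g3] by blast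
  with Ycomb have *: "growth Ys (3 + 2 * degree Q2)" "Q2 \<noteq> 0"
      "P2 = 0 \<or> 2 * degree P2 < 3 + 2 * degree Q2"
    by blast+
  then have "Q2 \<noteq> 0" "degree Q2 = 0" "P2 = 0 \<or> 2 * degree P2 < 3"
    using growth_unique[OF g3 *(1)] by auto
  then have Q2: "Q2 \<noteq> 0" "degree Q2 = 0" "degree P2 \<le> 1" by auto
  obtain \<beta> \<alpha> where \<alpha>: "P1 = [:\<beta>, \<alpha>:]"
    using P1 degree_le_1_eq[of P1] by (metis order_refl)
  have "\<alpha> \<noteq> 0" using P1 \<alpha> by auto
  obtain \<gamma> where \<gamma>: "Q2 = [:\<gamma>:]" using Q2 by (metis degree_eq_zeroE)
  have "\<gamma> \<noteq> 0" using Q2 \<gamma> by auto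
  obtain \<epsilon> \<delta> where \<delta>: "P2 = [:\<epsilon>, \<delta>:]"
    using degree_le_1_eq[OF Q2(3)] by metis
  have X': "X x y = \<alpha> * x + \<beta>" if "y^2 = x^3 + A * x^2 + B * x" for x y
    using X[OF that] by (simp add: \<alpha> Q1)
  have Y': "Y x y = \<delta> * x + \<epsilon> + \<gamma> * y" if "y^2 = x^3 + A * x^2 + B * x" for x y
    using Y[OF that] by (simp add: \<gamma> \<delta>)
  \<comment> \<open>X agrees at (x, y) and (x, -y), hence so does Y^2, and the cross term 4 \<gamma>
    y (\<delta> x + \<epsilon>) vanishes. A further factor y turns this into a polynomial identity
    in x.\<close>
  have "(x^3 + A * x^2 + B * x) * (\<delta> * x + \<epsilon>) = 0" for x
  proof -
    define y where "y = csqrt (x^3 + A * x^2 + B * x)"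
    have y: "y^2 = x^3 + A * x^2 + B * x" by (simp add: y_def)
    then have y': "(-y)^2 = x^3 + A * x^2 + B * x" by simp
    have "(\<delta> * x + \<epsilon> + \<gamma> * y)^2 = (\<delta> * x + \<epsilon> + \<gamma> * (-y))^2"
      using XY[OF y] XY[OF y'] by (simp add: X'[OF y] X'[OF y'] Y'[OF y] Y'[OF y'])
    then have "4 * \<gamma> * (y * (\<delta> * x + \<epsilon>)) = 0" by (simp add: power2_eq_square algebra_simps)
    with \<open>\<gamma> \<noteq> 0\<close> have "y * (\<delta> * x + \<epsilon>) = 0" by simp
    then have "y^2 * (\<delta> * x + \<epsilon>) = 0" by (simp add: power2_eq_square)
    then show ?thesis by (simp add: y)
  qed
  then have "poly ([:0, B, A, 1:] * [:\<epsilon>, \<delta>:]) = poly 0"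
    by (intro ext) (simp add: algebra_simps eval_nat_numeral)
  then have "[:0, B, A, 1:] * [:\<epsilon>, \<delta>:] = 0" by (simp only: poly_eq_poly_eq_iff)
  then have "[:\<epsilon>, \<delta>:] = 0" unfolding mult_eq_0_iff by simp
  then have \<delta>\<epsilon>: "\<delta> = 0" "\<epsilon> = 0" by auto
  have "\<gamma>^2 * (x^3 + A * x^2 + B * x) =
      (\<alpha> * x + \<beta>)^3 + A' * (\<alpha> * x + \<beta>)^2 + B' * (\<alpha> * x + \<beta>)" for x
  proof -
    define y where "y = csqrt (x^3 + A * x^2 + B * x)"
    have y: "y^2 = x^3 + A * x^2 + B * x" by (simp add: y_def)
    then show ?thesis
      using XY[OF y] by (simp add: X'[OF y] Y'[OF y] \<delta>\<epsilon> power_mult_distrib)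
  qed
  then have "poly [:0, \<gamma>^2 * B, \<gamma>^2 * A, \<gamma>^2:] =
      poly [:\<beta>^3 + A' * \<beta>^2 + B' * \<beta>, 3 * \<alpha> * \<beta>^2 + 2 * A' * \<alpha> * \<beta> + B' * \<alpha>,
        3 * \<alpha>^2 * \<beta> + A' * \<alpha>^2, \<alpha>^3:]"
    by (intro ext) (simp add: algebra_simps eval_nat_numeral)
  then have "[:0, \<gamma>^2 * B, \<gamma>^2 * A, \<gamma>^2:] =
      [:\<beta>^3 + A' * \<beta>^2 + B' * \<beta>, 3 * \<alpha> * \<beta>^2 + 2 * A' * \<alpha> * \<beta> + B' * \<alpha>,
        3 * \<alpha>^2 * \<beta> + A' * \<alpha>^2, \<alpha>^3:]"
    by (simp only: poly_eq_poly_eq_iff)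
  then show ?thesis
    using X' Y' \<open>\<alpha> \<noteq> 0\<close> by (intro that[of \<alpha> \<beta> \<gamma>]) (auto simp: \<delta>\<epsilon>)
qed

section \<open>Coordinate rings and rational functions\<close>

lemma generated_algebra_power:
  assumes "f \<in> generated_algebra G"
  shows "(\<lambda>p. f p ^ n) \<in> generated_algebra G"
  by (induction n) (auto intro!: generated_algebra.mult assms generated_algebra.const)

lemma generated_algebra_cmult:
  "f \<in> generated_algebra G \<Longrightarrow> (\<lambda>p. c * f p) \<in> generated_algebra G"
  by (intro generated_algebra.mult generated_algebra.const)

lemma generated_algebra_uminus:
  "f \<in> generated_algebra G \<Longrightarrow> (\<lambda>p. - f p) \<in> generated_algebra G"
  using generated_algebra_cmult[of f G "-1"] by simp

lemma generated_algebra_diff: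
  "f \<in> generated_algebra G \<Longrightarrow> g \<in> generated_algebra G \<Longrightarrow> (\<lambda>p. f p - g p) \<in> generated_algebra G"
  using generated_algebra.add[OF _ generated_algebra_uminus, of f G g] by simp

lemma generated_algebra_poly:
  assumes "f \<in> generated_algebra G"
  shows "(\<lambda>p. poly P (f p)) \<in> generated_algebra G"
proof (induction P)
  case 0
  show ?case by (simp add: generated_algebra.const)
next
  case (pCons a P)
  then have "(\<lambda>p. a + f p * poly P (f p)) \<in> generated_algebra G"
    by (intro generated_algebra.add generated_algebra.mult generated_algebra.const assms)
  then show ?case by simp
qed

lemma generated_algebra_compose:
  assumes "f \<in> generated_algebra G" "\<And>g. g \<in> G \<Longrightarrow> (\<lambda>p. g (h p)) \<in> generated_algebra H"
  shows "(\<lambda>p. f (h p)) \<in> generated_algebra H"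
  using assms by (induction rule: generated_algebra.induct) (auto intro: generated_algebra.intros)

lemma fun_aff_gens:
  "(\<lambda>p. fst p) \<in> fun_aff F" "(\<lambda>p. fst (snd p)) \<in> fun_aff F" "(\<lambda>p. snd (snd p)) \<in> fun_aff F"
  "c \<in> F \<Longrightarrow> (\<lambda>p. 1 / (fst p - c)) \<in> fun_aff F"
  unfolding fun_aff_def
  by (auto simp: case_prod_beta' intro!: generated_algebra.gen)

lemma fun_punct_gens:
  "(\<lambda>p. fst p) \<in> fun_punct F" "(\<lambda>p. fst (snd p)) \<in> fun_punct F"
  "(\<lambda>p. snd (snd p)) \<in> fun_punct F" "(\<lambda>p. 1 / fst (snd p)) \<in> fun_punct F"
  "c \<in> F \<Longrightarrow> (\<lambda>p. 1 / (fst p - c)) \<in> fun_punct F"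
  unfolding fun_punct_def
  by (auto simp: case_prod_beta' intro!: generated_algebra.gen)

lemma fun_aff_closed:
  "(\<lambda>_. c) \<in> fun_aff F"
  "f \<in> fun_aff F \<Longrightarrow> g \<in> fun_aff F \<Longrightarrow> (\<lambda>p. f p + g p) \<in> fun_aff F"
  "f \<in> fun_aff F \<Longrightarrow> g \<in> fun_aff F \<Longrightarrow> (\<lambda>p. f p - g p) \<in> fun_aff F"
  "f \<in> fun_aff F \<Longrightarrow> g \<in> fun_aff F \<Longrightarrow> (\<lambda>p. f p * g p) \<in> fun_aff F"
  "f \<in> fun_aff F \<Longrightarrow> (\<lambda>p. f p ^ n) \<in> fun_aff F"
  "f \<in> fun_aff F \<Longrightarrow> (\<lambda>p. poly P (f p)) \<in> fun_aff F"
  unfolding fun_aff_def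
  by (simp_all add: generated_algebra.intros generated_algebra_diff generated_algebra_power
      generated_algebra_poly)

lemma fun_punct_closed:
  "(\<lambda>_. c) \<in> fun_punct F"
  "f \<in> fun_punct F \<Longrightarrow> g \<in> fun_punct F \<Longrightarrow> (\<lambda>p. f p + g p) \<in> fun_punct F"
  "f \<in> fun_punct F \<Longrightarrow> g \<in> fun_punct F \<Longrightarrow> (\<lambda>p. f p - g p) \<in> fun_punct F"
  "f \<in> fun_punct F \<Longrightarrow> g \<in> fun_punct F \<Longrightarrow> (\<lambda>p. f p * g p) \<in> fun_punct F"
  "f \<in> fun_punct F \<Longrightarrow> (\<lambda>p. f p ^ n) \<in> fun_punct F"
  "f \<in> fun_punct F \<Longrightarrow> (\<lambda>p. poly P (f p)) \<in> fun_punct F"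
  unfolding fun_punct_def
  by (simp_all add: generated_algebra.intros generated_algebra_diff generated_algebra_power
      generated_algebra_poly)

lemma weierstrass_affine:
  "weierstrass J t 1 x y 1 \<longleftrightarrow> y^2 = x^3 + C_form J t 1 * x^2 + D_form J t 1 * x"
  by (simp add: weierstrass_def)

text \<open>Equality is required only off a finite set, so poles and arbitrary values at omitted
  base points are harmless.\<close>

definition rational_fun :: "(complex \<Rightarrow> complex) \<Rightarrow> bool" where
  "rational_fun f \<longleftrightarrow> (\<exists>p q. q \<noteq> 0 \<and> (\<forall>\<^sub>F t in cofinite. poly q t * f t = poly p t))"

lemma rational_fun_poly: "rational_fun (poly p)"
  unfolding rational_fun_def by (intro exI[of _ p] exI[of _ 1]) simp

lemma rational_fun_const: "rational_fun (\<lambda>_. c)"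
  unfolding rational_fun_def by (intro exI[of _ "[:c:]"] exI[of _ 1]) simp

lemma rational_fun_ident: "rational_fun (\<lambda>t. t)"
  unfolding rational_fun_def by (intro exI[of _ "[:0, 1:]"] exI[of _ 1]) simp

lemma rational_fun_add:
  assumes "rational_fun f" "rational_fun g"
  shows "rational_fun (\<lambda>t. f t + g t)"
proof -
  obtain p q where f: "q \<noteq> 0" "\<forall>\<^sub>F t in cofinite. poly q t * f t = poly p t"
    using assms(1) unfolding rational_fun_def by blast
  obtain r s where g: "s \<noteq> 0" "\<forall>\<^sub>F t in cofinite. poly s t * g t = poly r t"
    using assms(2) unfolding rational_fun_def by blast
  have "\<forall>\<^sub>F t in cofinite. poly (q * s) t * (f t + g t) = poly (p * s + q * r) t"
    using f(2) g(2)
  proof eventually_elim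
    case (elim t)
    have "poly (q * s) t * (f t + g t) =
        (poly q t * f t) * poly s t + poly q t * (poly s t * g t)"
      by (simp add: algebra_simps)
    also have "\<dots> = poly (p * s + q * r) t" by (simp add: elim)
    finally show ?case .
  qed
  moreover have "q * s \<noteq> 0" using f(1) g(1) by simp
  ultimately show ?thesis unfolding rational_fun_def by blast
qed

lemma rational_fun_mult:
  assumes "rational_fun f" "rational_fun g"
  shows "rational_fun (\<lambda>t. f t * g t)"
proof -
  obtain p q where f: "q \<noteq> 0" "\<forall>\<^sub>F t in cofinite. poly q t * f t = poly p t"
    using assms(1) unfolding rational_fun_def by blast
  obtain r s where g: "s \<noteq> 0" "\<forall>\<^sub>F t in cofinite. poly s t * g t = poly r t"
    using assms(2) unfolding rational_fun_def by blast
  have "\<forall>\<^sub>F t in cofinite. poly (q * s) t * (f t * g t) = poly (p * r) t"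
    using f(2) g(2) by eventually_elim (simp add: algebra_simps flip: mult.assoc)
  moreover have "q * s \<noteq> 0" using f(1) g(1) by simp
  ultimately show ?thesis unfolding rational_fun_def by blast
qed

lemma rational_fun_diff:
  "rational_fun f \<Longrightarrow> rational_fun g \<Longrightarrow> rational_fun (\<lambda>t. f t - g t)"
  using rational_fun_add[OF _ rational_fun_mult[OF rational_fun_const[of "-1"]], of f g] by simp

lemma rational_fun_inverse:
  assumes "rational_fun f"
  shows "rational_fun (\<lambda>t. inverse (f t))"
proof -
  obtain p q where f: "q \<noteq> 0" "\<forall>\<^sub>F t in cofinite. poly q t * f t = poly p t"
    using assms unfolding rational_fun_def by blast
  show ?thesis
  proof (cases "p = 0")
    case True
    have "\<forall>\<^sub>F t in cofinite. poly 1 t * inverse (f t) = poly 0 t"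
      using f(2) eventually_poly_nonzero[OF f(1)] by eventually_elim (simp add: True)
    then show ?thesis unfolding rational_fun_def by (metis one_neq_zero)
  next
    case False
    have "\<forall>\<^sub>F t in cofinite. poly p t * inverse (f t) = poly q t"
      using f(2) eventually_poly_nonzero[OF False]
    proof eventually_elim
      case (elim t)
      then have "f t \<noteq> 0" by auto
      then show ?case by (simp add: elim(1)[symmetric] field_simps)
    qed
    with False show ?thesis unfolding rational_fun_def by blast
  qed
qed

lemma rational_fun_divide:
  "rational_fun f \<Longrightarrow> rational_fun g \<Longrightarrow> rational_fun (\<lambda>t. f t / g t)"
  unfolding divide_inverse by (intro rational_fun_mult rational_fun_inverse)

text \<open>Fixing x and letting t vary is complementary to restriction to a fibre: it shows how
  fibrewise coefficients depend on t. Powers of y reduce by y^2 = w(t).\<close>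

lemma fun_aff_slice:
  assumes "f \<in> fun_aff F" "rational_fun w"
  obtains p q where "rational_fun p" "rational_fun q"
    "\<And>t y. y^2 = w t \<Longrightarrow> f (t, x, y) = p t + y * q t"
proof -
  have "\<exists>p q. rational_fun p \<and> rational_fun q \<and> (\<forall>t y. y^2 = w t \<longrightarrow> f (t, x, y) = p t + y * q t)"
    using assms(1) unfolding fun_aff_def
  proof (induction rule: generated_algebra.induct)
    case (const c)
    show ?case
      using rational_fun_const[of c] rational_fun_const[of 0]
      by (intro exI[of _ "\<lambda>_. c"] exI[of _ "\<lambda>_. 0"]) simp
  next
    case (gen g)
    consider "g = (\<lambda>(t, x, y). t)" | "g = (\<lambda>(t, x, y). x)" | "g = (\<lambda>(t, x, y). y)"
      | c where "g = (\<lambda>(t, x, y). 1 / (t - c))" using gen by blast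
    then show ?case
    proof cases
      case 1
      then show ?thesis using rational_fun_ident rational_fun_const[of 0]
        by (intro exI[of _ "\<lambda>t. t"] exI[of _ "\<lambda>_. 0"]) simp
    next
      case 2
      then show ?thesis using rational_fun_const[of x] rational_fun_const[of 0]
        by (intro exI[of _ "\<lambda>_. x"] exI[of _ "\<lambda>_. 0"]) simp
    next
      case 3
      then show ?thesis using rational_fun_const[of 1] rational_fun_const[of 0]
        by (intro exI[of _ "\<lambda>_. 0"] exI[of _ "\<lambda>_. 1"]) simp
    next
      case (4 c)
      have "rational_fun (\<lambda>t. 1 / (t - c))"
        by (intro rational_fun_divide rational_fun_diff rational_fun_const rational_fun_ident)
      then show ?thesis using rational_fun_const[of 0] 4
        by (intro exI[of _ "\<lambda>t. 1 / (t - c)"] exI[of _ "\<lambda>_. 0"]) simp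
    qed
  next
    case (add f g)
    then obtain p q r s where "rational_fun p" "rational_fun q" "rational_fun r" "rational_fun s"
      "\<forall>t y. y^2 = w t \<longrightarrow> f (t, x, y) = p t + y * q t"
      "\<forall>t y. y^2 = w t \<longrightarrow> g (t, x, y) = r t + y * s t" by blast
    then show ?case
      by (intro exI[of _ "\<lambda>t. p t + r t"] exI[of _ "\<lambda>t. q t + s t"])
        (simp add: rational_fun_add algebra_simps)
  next
    case (mult f g)
    then obtain p q r s where rat: "rational_fun p" "rational_fun q" "rational_fun r" "rational_fun s"
      and eq: "\<forall>t y. y^2 = w t \<longrightarrow> f (t, x, y) = p t + y * q t"
      "\<forall>t y. y^2 = w t \<longrightarrow> g (t, x, y) = r t + y * s t" by blast
    have "(p t + y * q t) * (r t + y * s t) =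
        (p t * r t + w t * (q t * s t)) + y * (p t * s t + q t * r t)" if "y^2 = w t" for t y
      unfolding that[symmetric] by (simp add: power2_eq_square algebra_simps)
    then show ?case
      using rat eq assms(2)
      by (intro exI[of _ "\<lambda>t. p t * r t + w t * (q t * s t)"] exI[of _ "\<lambda>t. p t * s t + q t * r t"])
        (simp add: rational_fun_add rational_fun_mult)
  qed
  with that show ?thesis by blast
qed

lemma fun_aff_fibre:
  assumes "f \<in> fun_aff F"
  obtains P Q where
    "\<And>x y. y^2 = x^3 + A * x^2 + B * x \<Longrightarrow> f (t, x, y) = poly P x + y * poly Q x"
proof -
  have "\<exists>P Q. \<forall>x y. y^2 = x^3 + A * x^2 + B * x \<longrightarrow> f (t, x, y) = poly P x + y * poly Q x"
    using assms unfolding fun_aff_def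
  proof (induction rule: generated_algebra.induct)
    case (const c)
    show ?case by (intro exI[of _ "[:c:]"] exI[of _ 0]) simp
  next
    case (gen g)
    then consider "g = (\<lambda>(t, x, y). t)" | "g = (\<lambda>(t, x, y). x)" | "g = (\<lambda>(t, x, y). y)"
      | c where "g = (\<lambda>(t, x, y). 1 / (t - c))" by blast
    then show ?case
    proof cases
      case 1
      then show ?thesis by (intro exI[of _ "[:t:]"] exI[of _ 0]) simp
    next
      case 2
      then show ?thesis by (intro exI[of _ "[:0, 1:]"] exI[of _ 0]) simp
    next
      case 3
      then show ?thesis by (intro exI[of _ 0] exI[of _ 1]) simp
    next
      case (4 c)
      then show ?thesis by (intro exI[of _ "[:1 / (t - c):]"] exI[of _ 0]) simp
    qed
  next
    case (add f g)
    then obtain P Q R S where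
      "\<forall>x y. y^2 = x^3 + A * x^2 + B * x \<longrightarrow> f (t, x, y) = poly P x + y * poly Q x"
      "\<forall>x y. y^2 = x^3 + A * x^2 + B * x \<longrightarrow> g (t, x, y) = poly R x + y * poly S x" by blast
    then show ?case
      by (intro exI[of _ "P + R"] exI[of _ "Q + S"]) (simp add: algebra_simps)
  next
    case (mult f g)
    then obtain P Q R S where eq:
      "\<forall>x y. y^2 = x^3 + A * x^2 + B * x \<longrightarrow> f (t, x, y) = poly P x + y * poly Q x"
      "\<forall>x y. y^2 = x^3 + A * x^2 + B * x \<longrightarrow> g (t, x, y) = poly R x + y * poly S x" by blast
    have "(poly P x + y * poly Q x) * (poly R x + y * poly S x) =
        poly (P * R + [:0, B, A, 1:] * (Q * S)) x + y * poly (P * S + Q * R) x"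
      if "y^2 = x^3 + A * x^2 + B * x" for x y
    proof -
      have *: "poly [:0, B, A, 1:] x = y^2" unfolding that by (simp add: eval_nat_numeral algebra_simps)
      show ?thesis
        by (simp only: poly_add poly_mult *) (simp add: power2_eq_square algebra_simps)
    qed
    with eq show ?case
      by (intro exI[of _ "P * R + [:0, B, A, 1:] * (Q * S)"] exI[of _ "P * S + Q * R"])
        (simp del: poly_add poly_mult)
  qed
  with that show ?thesis by blast
qed

section \<open>The 2-isogeny as quotient by the translation\<close>

text \<open>A polynomial with all zeros in F is a constant times linear factors t - c with c in F,
  and each of these has its inverse among the generators.\<close>

lemma fun_aff_inverse_poly:
  assumes "P \<noteq> 0" "\<And>t. poly P t = 0 \<Longrightarrow> t \<in> F"
  shows "\<exists>g\<in>fun_aff F. \<forall>p. fst p \<notin> F \<longrightarrow> g p = 1 / poly P (fst p)"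
  using assms
proof (induction "degree P" arbitrary: P)
  case 0
  then obtain c where "P = [:c:]" by (metis degree_eq_zeroE)
  then show ?case by (intro bexI[of _ "\<lambda>_. 1 / c"]) (auto intro: fun_aff_closed)
next
  case (Suc n)
  have "\<not> constant (poly P)" using Suc.hyps(2) by (simp add: constant_degree)
  then obtain r where r: "poly P r = 0" using fundamental_theorem_of_algebra by blast
  then obtain Q where Q: "P = [:-r, 1:] * Q" by (meson dvdE poly_eq_0_iff_dvd)
  have "Q \<noteq> 0" using Suc.prems(1) Q by auto
  then have "degree P = Suc (degree Q)" unfolding Q by (subst degree_mult_eq) auto
  then have "n = degree Q" using Suc.hyps(2) by simp
  moreover have "t \<in> F" if "poly Q t = 0" for t using that Suc.prems(2)[of t] by (simp add: Q)
  ultimately obtain g where g: "g \<in> fun_aff F" "\<forall>p. fst p \<notin> F \<longrightarrow> g p = 1 / poly Q (fst p)"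
    using Suc.hyps(1) \<open>Q \<noteq> 0\<close> by blast
  have "(\<lambda>p. 1 / (fst p - r) * g p) \<in> fun_aff F"
    using Suc.prems(2)[OF r] by (intro fun_aff_closed fun_aff_gens g)
  moreover have "poly P t = (t - r) * poly Q t" for t by (simp add: Q algebra_simps)
  then have "\<forall>p. fst p \<notin> F \<longrightarrow> 1 / (fst p - r) * g p = 1 / poly P (fst p)"
    using g(2) by simp
  ultimately show ?case by (intro bexI[of _ "\<lambda>p. 1 / (fst p - r) * g p"])
qed

definition sqrt2 :: complex where "sqrt2 = csqrt 2"

lemma sqrt2: "sqrt2 \<noteq> 0" "sqrt2^2 = 2"
proof -
  show "sqrt2^2 = 2" unfolding sqrt2_def by (rule power2_csqrt)
  then show "sqrt2 \<noteq> 0" by auto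
qed

text \<open>The 2-isogeny with kernel \<open>[0:1:0], [0:0:1]\<close> in terms of the slope \<open>y / x\<close>, which is
  anti-invariant under the translation, as is \<open>x - D / x\<close>.\<close>

definition isogeny ::
  "coords \<Rightarrow> complex \<times> complex \<times> complex \<Rightarrow> complex \<times> complex \<times> complex" where
  "isogeny J p = (shift J - fst p, (snd (snd p) / fst (snd p))^2 / 2,
     snd (snd p) / fst (snd p) *
       (fst (snd p) - D_form J (fst p) 1 / fst (snd p)) / (2 * sqrt2))"

text \<open>In terms of the slope u = y / x the fibre becomes u^2 = x + C + D / x. The translation
  exchanges x with D / x and negates u, so invariance can be read off directly.\<close>

lemma fib_punct_iff:
  "(t, x, u * x) \<in> fib_punct J F \<longleftrightarrow>
     t \<notin> F \<and> x \<noteq> 0 \<and> u^2 = x + C_form J t 1 + D_form J t 1 / x"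
proof (cases "x = 0")
  case False
  have "x^3 + C_form J t 1 * x^2 + D_form J t 1 * x =
      (x + C_form J t 1 + D_form J t 1 / x) * x^2"
    using False by (simp add: field_simps power2_eq_square power3_eq_cube)
  then show ?thesis
    using False by (simp add: fib_punct_def weierstrass_affine power_mult_distrib)
qed (simp add: fib_punct_def)

lemma fib_punct_cases:
  assumes "p \<in> fib_punct J F"
  obtains t x u where "p = (t, x, u * x)" "t \<notin> F" "x \<noteq> 0"
    "u^2 = x + C_form J t 1 + D_form J t 1 / x"
proof -
  obtain t x y where p: "p = (t, x, y)" by (cases p)
  have "x \<noteq> 0" using assms p by (simp add: fib_punct_def)
  then have "p = (t, x, y / x * x)" using p by simp
  with assms have "(t, x, y / x * x) \<in> fib_punct J F" by simp
  then show ?thesis using that[OF \<open>p = (t, x, y / x * x)\<close>] unfolding fib_punct_iff by blast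
qed

lemma isogeny_slope:
  "x \<noteq> 0 \<Longrightarrow> isogeny J (t, x, u * x) =
     (shift J - t, u^2 / 2, u * (x - D_form J t 1 / x) / (2 * sqrt2))"
  by (simp add: isogeny_def)

lemma torsion_translation_slope:
  assumes "(t, x, u * x) \<in> fib_punct J F"
  shows "torsion_translation J (t, x, u * x) =
     (t, D_form J t 1 / x, - u * (D_form J t 1 / x))"
  using torsion_translation_explicit[of J t x "u * x"] assms
  by (simp add: fib_punct_def power2_eq_square)

text \<open>Equal images share t and u^2, hence the sum x + D / x, and the product of the two
  summands is D. This leaves x and D / x as candidates; the third coordinate correlates the choice
  with the sign of the slope.\<close>

lemma isogeny_eq_iff:
  assumes "good_base J F" "p \<in> fib_punct J F" "q \<in> fib_punct J F"
  shows "isogeny J p = isogeny J q \<longleftrightarrow> q = p \<or> q = torsion_translation J p"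
proof -
  obtain t x u where p: "p = (t, x, u * x)" "t \<notin> F" "x \<noteq> 0"
    and u: "u^2 = x + C_form J t 1 + D_form J t 1 / x" by (rule fib_punct_cases[OF assms(2)])
  obtain s w v where q: "q = (s, w, v * w)" "s \<notin> F" "w \<noteq> 0"
    and v: "v^2 = w + C_form J s 1 + D_form J s 1 / w" by (rule fib_punct_cases[OF assms(3)])
  define C D where CD: "C = C_form J t 1" "D = D_form J t 1"
  have "D \<noteq> 0" using assms(1) p(2) by (simp add: good_base_def CD)
  have tr: "torsion_translation J p = (t, D / x, - u * (D / x))"
    using torsion_translation_slope assms(2) unfolding p(1) CD by blast
  show ?thesis
  proof
    assume "isogeny J p = isogeny J q"
    then have eq: "s = t" "v^2 = u^2" "u * (x - D / x) = v * (w - D_form J s 1 / w)"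
      using p(3) q(3) sqrt2(1) by (auto simp: p(1) q(1) isogeny_slope CD)
    then have sum: "w + D / w = x + D / x" using u v CD by simp
    have eq3: "u * (x - D / x) = v * (w - D / w)" using eq CD by simp
    have root: "w = x \<or> w = D / x"
    proof -
      have "(w - x) * (w - D / x) = 0"
        using sum p(3) q(3) by (simp add: field_simps)
      then show ?thesis by auto
    qed
    have "v = u \<or> v = - u" using eq(2) by (simp only: power2_eq_iff)
    then consider "v = u" "u \<noteq> 0" | "v = - u" "u \<noteq> 0" | "u = 0" "v = 0" by (cases "u = 0") auto
    then show "q = p \<or> q = torsion_translation J p"
    proof cases
      case 1
      then have "x - D / x = w - D / w" using eq3 by simp
      moreover have "w + w = (w + D / w) + (w - D / w)" by simp
      ultimately have "w + w = (x + D / x) + (x - D / x)" by (simp only: sum)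
      then have "2 * w = 2 * x" by simp
      then have "w = x" by (simp only: mult_cancel_left) simp
      then show ?thesis using p q eq 1 by simp
    next
      case 2
      then have "u * ((w - D / w) + (x - D / x)) = 0" using eq3 by (simp add: distrib_left)
      then have "w - D / w = - (x - D / x)"
        using 2 unfolding mult_eq_0_iff by (simp only: eq_neg_iff_add_eq_0) simp
      moreover have "w + w = (w + D / w) + (w - D / w)" by simp
      ultimately have "w + w = (x + D / x) + - (x - D / x)" by (simp only: sum)
      then have "2 * w = 2 * (D / x)" by simp
      then have "w = D / x" by (simp only: mult_cancel_left) simp
      then show ?thesis using tr q eq 2 by simp
    next
      \<comment> \<open>Here the third coordinate carries no information, but y = 0 at both points,
        so either candidate for w is acceptable.\<close>
      case 3
      then show ?thesis using root tr p q eq by auto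
    qed
  next
    assume "q = p \<or> q = torsion_translation J p"
    then show "isogeny J p = isogeny J q"
    proof
      assume "q = torsion_translation J p"
      then have q': "q = (t, D / x, - u * (D / x))" by (simp add: tr)
      have "D / x \<noteq> 0" using \<open>D \<noteq> 0\<close> p(3) by simp
      from isogeny_slope[OF this, of J t "- u"] have "isogeny J q = (shift J - t, (- u)^2 / 2, - u * (D / x - D / (D / x)) / (2 * sqrt2))"
        by (simp only: q' CD)
      also have "\<dots> = isogeny J p"
        using p(3) \<open>D \<noteq> 0\<close> unfolding p(1) isogeny_slope[OF p(3)] CD[symmetric] by (simp add: algebra_simps)
      finally show ?thesis ..
    qed simp
  qed
qed

text \<open>x and D / x are the roots of Z^2 - (u^2 - C) Z + D, so (x - D / x)^2 is the discriminant
  (u^2 - C)^2 - 4 D. Dividing the standard coordinates of the isogenous curve by 2 and 2 sqrt 2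
  changes the coefficients - 2 C and C^2 - 4 D into - C and C^2 / 4 - D.\<close>

lemma isogeny_weierstrass:
  fixes X u x C D :: complex
  assumes "x \<noteq> 0" "u^2 = x + C + D / x"
  shows "(u * (x - D / x) / (2 * sqrt2))^2 =
    (u^2 / 2)^3 + (- C) * (u^2 / 2)^2 + (C^2 / 4 - D) * (u^2 / 2)"
proof -
  have "(x - D / x)^2 = (x + D / x)^2 - 4 * D"
    using assms(1) by (simp add: field_simps power2_eq_square)
  moreover have "x + D / x = u^2 - C" using assms(2) by simp
  ultimately have *: "(x - D / x)^2 = (u^2 - C)^2 - 4 * D" by simp
  have "(2 * sqrt2)^2 = 8" by (simp add: power_mult_distrib sqrt2)
  then have "(u * (x - D / x) / (2 * sqrt2))^2 = u^2 * ((u^2 - C)^2 - 4 * D) / 8"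
    by (simp only: power_divide power_mult_distrib *)
  also have "\<dots> = (u^2 / 2)^3 + (- C) * (u^2 / 2)^2 + (C^2 / 4 - D) * (u^2 / 2)"
    by (simp add: field_simps power2_eq_square power3_eq_cube)
  finally show ?thesis .
qed

lemma isogeny_image:
  assumes "good_base J F"
  shows "isogeny J ` fib_punct J F = fib_aff (dual_coords J) ((\<lambda>t. shift J - t) ` F)"
proof (intro equalityI subsetI)
  fix q assume "q \<in> isogeny J ` fib_punct J F"
  then obtain p where p: "p \<in> fib_punct J F" "q = isogeny J p" by blast
  obtain t x u where *: "p = (t, x, u * x)" "t \<notin> F" "x \<noteq> 0"
    "u^2 = x + C_form J t 1 + D_form J t 1 / x" by (rule fib_punct_cases[OF p(1)])
  then show "q \<in> fib_aff (dual_coords J) ((\<lambda>t. shift J - t) ` F)"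
    using isogeny_weierstrass[OF *(3,4)]
    by (auto simp: p(2) isogeny_slope fib_aff_def weierstrass_affine C_form_dual D_form_dual
       )
next
  fix q assume q: "q \<in> fib_aff (dual_coords J) ((\<lambda>t. shift J - t) ` F)"
  obtain t X Y where q': "q = (shift J - t, X, Y)"
    by (metis prod_cases3 diff_diff_eq2 add_diff_cancel_left')
  define C D where CD: "C = C_form J t 1" "D = D_form J t 1"
  have "t \<notin> F" using q by (auto simp: q' fib_aff_def)
  have Y: "Y^2 = X^3 - C * X^2 + (C^2 / 4 - D) * X"
    using q by (simp add: q' fib_aff_def weierstrass_affine C_form_dual D_form_dual CD)
  have "D \<noteq> 0" using assms \<open>t \<notin> F\<close> by (simp add: good_base_def CD)
  have "\<exists>u x. x \<noteq> 0 \<and> u^2 = x + C + D / x \<and> X = u^2 / 2 \<and> Y = u * (x - D / x) / (2 * sqrt2)"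
  proof (cases "X = 0")
    case True
    \<comment> \<open>The point (0, 0) of the target comes from the 2-torsion points with x nonzero,
      the roots of x^2 + C x + D.\<close>
    define x where "x = (- C + csqrt (C^2 - 4 * D)) / 2"
    have "2 * x + C = csqrt (C^2 - 4 * D)" by (simp add: x_def field_simps)
    then have "(2 * x + C)^2 = C^2 - 4 * D" by (simp only: power2_csqrt)
    then have "4 * (x^2 + C * x + D) = 0" by (simp add: power2_eq_square algebra_simps)
    then have x: "x^2 + C * x + D = 0" by (simp only: mult_eq_0_iff) simp
    then have "x \<noteq> 0" using \<open>D \<noteq> 0\<close> by auto
    moreover have "x + C + D / x = (x^2 + C * x + D) / x"
      using \<open>x \<noteq> 0\<close> by (simp add: field_simps power2_eq_square)
    moreover have "Y = 0" using Y True by simp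
    ultimately show ?thesis using True x by (intro exI[of _ 0] exI[of _ x]) simp
  next
    case False
    define u where "u = csqrt (2 * X)"
    have u: "u^2 = 2 * X" by (simp add: u_def)
    then have "u \<noteq> 0" using False by auto
    \<comment> \<open>g and h are the required values of x - D / x and x + D / x. The target
      equation says h^2 - g^2 = 4 D, so (h + g) / 2 and (h - g) / 2 have product D.\<close>
    define g where "g = 2 * sqrt2 * Y / u"
    define h where "h = u^2 - C"
    define x where "x = (h + g) / 2"
    have "g^2 = 8 * Y^2 / (2 * X)" by (simp add: g_def power_divide power_mult_distrib sqrt2 u)
    also have "\<dots> = 4 * (X^2 - C * X + (C^2 / 4 - D))"
      using False unfolding Y by (simp add: field_simps power2_eq_square power3_eq_cube)
    also have "\<dots> = h^2 - 4 * D" unfolding h_def u by (simp add: field_simps power2_eq_square)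
    finally have prod: "x * ((h - g) / 2) = D" by (simp add: x_def field_simps power2_eq_square)
    then have "x \<noteq> 0" using \<open>D \<noteq> 0\<close> by auto
    with prod have "D / x = (h - g) / 2" by (simp add: field_simps)
    then have "x + D / x = h" "x - D / x = g" by (simp_all add: x_def field_simps)
    moreover have "Y = u * g / (2 * sqrt2)" using \<open>u \<noteq> 0\<close> sqrt2(1) by (simp add: g_def)
    ultimately have "u^2 = x + C + D / x" "Y = u * (x - D / x) / (2 * sqrt2)"
      by (simp_all only:) (simp add: h_def algebra_simps)
    with \<open>x \<noteq> 0\<close> u show ?thesis by (intro exI[of _ u] exI[of _ x]) simp
  qed
  then obtain u x where ux: "x \<noteq> 0" "u^2 = x + C + D / x" "X = u^2 / 2"
    "Y = u * (x - D / x) / (2 * sqrt2)" by blast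
  then have "(t, x, u * x) \<in> fib_punct J F" "isogeny J (t, x, u * x) = q"
    using \<open>t \<notin> F\<close> by (auto simp: fib_punct_iff isogeny_slope q' CD)
  then show "q \<in> isogeny J ` fib_punct J F" by blast
qed

lemma isogeny_pullback:
  assumes "f \<in> fun_aff ((\<lambda>t. shift J - t) ` F)"
  shows "(\<lambda>p. f (isogeny J p)) \<in> fun_punct F"
  using assms unfolding fun_aff_def fun_punct_def
proof (rule generated_algebra_compose, fold fun_punct_def)
  have t: "(\<lambda>p. fst (isogeny J p)) \<in> fun_punct F"
    unfolding isogeny_def fst_conv by (intro fun_punct_closed fun_punct_gens)
  have slope: "(\<lambda>p. snd (snd p) * (1 / fst (snd p))) \<in> fun_punct F"
    by (intro fun_punct_closed fun_punct_gens)
  have "(\<lambda>p. (snd (snd p) * (1 / fst (snd p)))^2 * (1 / 2)) \<in> fun_punct F"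
    by (intro fun_punct_closed slope)
  then have x: "(\<lambda>p. fst (snd (isogeny J p))) \<in> fun_punct F"
    unfolding isogeny_def fst_conv snd_conv by simp
  have "(\<lambda>p. snd (snd p) * (1 / fst (snd p)) *
      (fst (snd p) - poly (D_poly J) (fst p) * (1 / fst (snd p))) * (1 / (2 * sqrt2))) \<in> fun_punct F"
    by (intro fun_punct_closed fun_punct_gens)
  then have y: "(\<lambda>p. snd (snd (isogeny J p))) \<in> fun_punct F"
    unfolding isogeny_def fst_conv snd_conv poly_D_poly by simp
  fix g assume g: "g \<in> {\<lambda>(t, x, y). t, \<lambda>(t, x, y). x, \<lambda>(t, x, y). y} \<union>
      {\<lambda>(t, x, y). 1 / (t - c) |c. c \<in> (\<lambda>t. shift J - t) ` F}"
  then consider "g = (\<lambda>(t, x, y). t)" | "g = (\<lambda>(t, x, y). x)" | "g = (\<lambda>(t, x, y). y)"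
    | c where "c \<in> F" "g = (\<lambda>(t, x, y). 1 / (t - (shift J - c)))" by blast
  then show "(\<lambda>p. g (isogeny J p)) \<in> fun_punct F"
  proof cases
    case 4
    have "(\<lambda>p. (-1) * (1 / (fst p - c))) \<in> fun_punct F"
      by (intro fun_punct_closed fun_punct_gens 4)
    moreover have "(-1) * (1 / (fst p - c)) = g (isogeny J p)" for p
    proof -
      have "shift J - fst p - (shift J - c) = - (fst p - c)" by simp
      then have "g (isogeny J p) = 1 / - (fst p - c)"
        by (simp only: 4 isogeny_def prod.case)
      then show ?thesis by (simp only: divide_minus_right mult_minus1)
    qed
    ultimately show ?thesis by simp
  qed (use t x y in \<open>simp_all add: case_prod_beta'\<close>)
qed

text \<open>\<open>fun_punct F\<close> is spanned over the pullback of \<open>fun_aff\<close> by \<open>1, u, z, u z\<close>, where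
  \<open>u = y / x\<close> and \<open>z = x - D / x\<close> are anti-invariant; hence averaging a function over the
  involution leaves only the coefficients of \<open>1\<close> and \<open>u z\<close>.\<close>

definition slope_expansion ::
  "coords \<Rightarrow> complex set \<Rightarrow> (complex \<times> complex \<times> complex \<Rightarrow> complex) \<Rightarrow>
    (complex \<times> complex \<times> complex \<Rightarrow> complex) \<Rightarrow> (complex \<times> complex \<times> complex \<Rightarrow> complex) \<Rightarrow>
    (complex \<times> complex \<times> complex \<Rightarrow> complex) \<Rightarrow> (complex \<times> complex \<times> complex \<Rightarrow> complex) \<Rightarrow> bool" where
  "slope_expansion J F f a0 a1 b0 b1 \<longleftrightarrow>
     {a0, a1, b0, b1} \<subseteq> fun_aff ((\<lambda>t. shift J - t) ` F) \<and>
     (\<forall>t x u. (t, x, u * x) \<in> fib_punct J F \<longrightarrow>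
       f (t, x, u * x) = a0 (isogeny J (t, x, u * x)) + u * a1 (isogeny J (t, x, u * x)) +
         (x - D_form J t 1 / x) * b0 (isogeny J (t, x, u * x)) +
         u * (x - D_form J t 1 / x) * b1 (isogeny J (t, x, u * x)))"

lemma slope_expansionD:
  assumes "slope_expansion J F f a0 a1 b0 b1"
  shows "{a0, a1, b0, b1} \<subseteq> fun_aff ((\<lambda>t. shift J - t) ` F)"
    and "(t, x, u * x) \<in> fib_punct J F \<Longrightarrow> q = isogeny J (t, x, u * x) \<Longrightarrow>
      z = x - D_form J t 1 / x \<Longrightarrow>
      f (t, x, u * x) = a0 q + u * a1 q + z * b0 q + u * z * b1 q"
  using assms unfolding slope_expansion_def by (blast, metis)

lemma slope_expansion_exists:
  assumes "good_base J F" "f \<in> fun_punct F"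
  shows "\<exists>a0 a1 b0 b1. slope_expansion J F f a0 a1 b0 b1"
  using assms(2) unfolding fun_punct_def
proof (induction rule: generated_algebra.induct)
  let ?A = "fun_aff ((\<lambda>t. shift J - t) ` F)"
  \<comment> \<open>T, U, H, Z are functions on the target whose pullbacks are t, u^2, x + D / x and
    z^2. Since u^2 and z^2 are pullbacks, the span of 1, u, z, u z is closed under
    multiplication.\<close>
  define T :: "complex \<times> complex \<times> complex \<Rightarrow> complex" where "T q = shift J - fst q" for q
  define U :: "complex \<times> complex \<times> complex \<Rightarrow> complex" where "U q = 2 * fst (snd q)" for q
  define H where "H q = U q - poly (C_poly J) (T q)" for q
  define Z where "Z q = H q ^ 2 - 4 * poly (D_poly J) (T q)" for q
  have T: "T \<in> ?A" unfolding T_def by (intro fun_aff_closed fun_aff_gens)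
  have U: "U \<in> ?A" unfolding U_def by (intro fun_aff_closed fun_aff_gens)
  have H: "H \<in> ?A" unfolding H_def by (intro fun_aff_closed T U)
  have Z: "Z \<in> ?A" unfolding Z_def by (intro fun_aff_closed T H)
  have eval: "T (isogeny J (t, x, u * x)) = t" "U (isogeny J (t, x, u * x)) = u^2"
    "H (isogeny J (t, x, u * x)) = x + D_form J t 1 / x"
    "Z (isogeny J (t, x, u * x)) = (x - D_form J t 1 / x)^2"
    if "(t, x, u * x) \<in> fib_punct J F" for t x u
  proof -
    have x: "x \<noteq> 0" and u: "u^2 = x + C_form J t 1 + D_form J t 1 / x"
      using that by (simp_all add: fib_punct_iff)
    show T': "T (isogeny J (t, x, u * x)) = t" and U': "U (isogeny J (t, x, u * x)) = u^2"
      using x by (simp_all add: T_def U_def isogeny_slope)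
    show H': "H (isogeny J (t, x, u * x)) = x + D_form J t 1 / x"
      by (simp add: H_def T' U' u poly_C_poly)
    show "Z (isogeny J (t, x, u * x)) = (x - D_form J t 1 / x)^2"
      unfolding Z_def T' H' poly_D_poly using x by (simp add: field_simps power2_eq_square)
  qed
  {
    case (const c)
    show ?case
      by (intro exI[of _ "\<lambda>_. c"] exI[of _ "\<lambda>_. 0"]) (simp add: slope_expansion_def fun_aff_closed)
  next
    case (gen g)
    then consider "g = (\<lambda>(t, x, y). t)" | "g = (\<lambda>(t, x, y). x)" | "g = (\<lambda>(t, x, y). y)"
      | "g = (\<lambda>(t, x, y). 1 / x)" | c where "c \<in> F" "g = (\<lambda>(t, x, y). 1 / (t - c))" by blast
    then show ?case
    proof cases
      case 1
      have "slope_expansion J F g T (\<lambda>_. 0) (\<lambda>_. 0) (\<lambda>_. 0)"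
        by (simp add: slope_expansion_def fun_aff_closed T eval 1)
      then show ?thesis by blast
    next
      case 2
      have "(\<lambda>q. 1 / 2 * H q) \<in> ?A" by (intro fun_aff_closed H)
      moreover have "x = 1 / 2 * (x + D) + (x - D) * (1 / 2)" for x D :: complex
        by (simp add: field_simps)
      ultimately have "slope_expansion J F g (\<lambda>q. 1 / 2 * H q) (\<lambda>_. 0) (\<lambda>_. 1 / 2) (\<lambda>_. 0)"
        by (simp add: slope_expansion_def fun_aff_closed eval 2)
      then show ?thesis by blast
    next
      case 3
      have "(\<lambda>q. 1 / 2 * H q) \<in> ?A" by (intro fun_aff_closed H)
      moreover have "u * x = u * (1 / 2 * (x + D)) + u * (x - D) * (1 / 2)" for u x D :: complex
        by (simp add: field_simps)
      ultimately have "slope_expansion J F g (\<lambda>_. 0) (\<lambda>q. 1 / 2 * H q) (\<lambda>_. 0) (\<lambda>_. 1 / 2)"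
        by (simp add: slope_expansion_def fun_aff_closed eval 3)
      then show ?thesis by blast
    next
      case 4
      \<comment> \<open>1 / x is ((x + D / x) - z) / (2 D), so 1 / D must be regular on the target.
        Its poles lie over omitted fibres, since D does not vanish off F.\<close>
      have "D_poly J \<circ>\<^sub>p [:shift J, -1:] \<noteq> 0"
      proof -
        have "degree (D_poly J \<circ>\<^sub>p [:shift J, -1:]) = 5" by (simp add: degree_D_poly degree_pcompose)
        then show ?thesis by auto
      qed
      moreover have "t \<in> (\<lambda>t. shift J - t) ` F" if "poly (D_poly J \<circ>\<^sub>p [:shift J, -1:]) t = 0" for t
      proof -
        have "D_form J (shift J - t) 1 = 0" using that by (simp add: poly_pcompose poly_D_poly)
        then have "shift J - t \<in> F" using assms(1) by (auto simp: good_base_def)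
        then show ?thesis by (intro image_eqI[of _ _ "shift J - t"]) auto
      qed
      ultimately have "\<exists>g'\<in>?A. \<forall>q. fst q \<notin> (\<lambda>t. shift J - t) ` F \<longrightarrow>
          g' q = 1 / poly (D_poly J \<circ>\<^sub>p [:shift J, -1:]) (fst q)"
        by (rule fun_aff_inverse_poly)
      then obtain g' where g': "g' \<in> ?A"
        "\<And>q. fst q \<notin> (\<lambda>t. shift J - t) ` F \<Longrightarrow> g' q = 1 / poly (D_poly J \<circ>\<^sub>p [:shift J, -1:]) (fst q)"
        by blast
      have A: "(\<lambda>q. 1 / 2 * H q * g' q) \<in> ?A" "(\<lambda>q. - 1 / 2 * g' q) \<in> ?A"
        by (intro fun_aff_closed H g')+
      have "slope_expansion J F g (\<lambda>q. 1 / 2 * H q * g' q) (\<lambda>_. 0) (\<lambda>q. - 1 / 2 * g' q) (\<lambda>_. 0)"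
        unfolding slope_expansion_def
      proof (intro conjI allI impI)
        fix t x u assume p: "(t, x, u * x) \<in> fib_punct J F"
        then have x: "t \<notin> F" "x \<noteq> 0" by (simp_all add: fib_punct_iff)
        then have D: "D_form J t 1 \<noteq> 0" using assms(1) by (simp add: good_base_def)
        have "g' (isogeny J (t, x, u * x)) = 1 / D_form J t 1"
          using x by (subst g'(2)) (auto simp: isogeny_slope poly_pcompose poly_D_poly)
        then show "g (t, x, u * x) = 1 / 2 * H (isogeny J (t, x, u * x)) * g' (isogeny J (t, x, u * x)) + u * 0 +
          (x - D_form J t 1 / x) * (- 1 / 2 * g' (isogeny J (t, x, u * x))) + u * (x - D_form J t 1 / x) * 0"
          using x D by (simp add: eval[OF p] 4 field_simps)
      qed (use A fun_aff_closed(1)[of 0] in auto)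
      then show ?thesis by blast
    next
      case (5 c)
      have "(\<lambda>q. (-1) * (1 / (fst q - (shift J - c)))) \<in> ?A"
        using 5 by (intro fun_aff_closed fun_aff_gens) simp
      moreover have "(-1) * (1 / (fst q - (shift J - c))) = 1 / (T q - c)" for q
      proof -
        have "T q - c = - (fst q - (shift J - c))" by (simp add: T_def)
        then show ?thesis by (simp only: divide_minus_right mult_minus1)
      qed
      ultimately have "(\<lambda>q. 1 / (T q - c)) \<in> ?A" by simp
      then have "slope_expansion J F g (\<lambda>q. 1 / (T q - c)) (\<lambda>_. 0) (\<lambda>_. 0) (\<lambda>_. 0)"
        by (simp add: slope_expansion_def fun_aff_closed eval 5)
      then show ?thesis by blast
    qed
  next
    case (add f g)
    then obtain a0 a1 b0 b1 c0 c1 d0 d1 where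
      fg: "slope_expansion J F f a0 a1 b0 b1" "slope_expansion J F g c0 c1 d0 d1" by blast
    have "slope_expansion J F (\<lambda>p. f p + g p) (\<lambda>q. a0 q + c0 q) (\<lambda>q. a1 q + c1 q)
        (\<lambda>q. b0 q + d0 q) (\<lambda>q. b1 q + d1 q)"
      unfolding slope_expansion_def
    proof (intro conjI allI impI)
      show "{\<lambda>q. a0 q + c0 q, \<lambda>q. a1 q + c1 q, \<lambda>q. b0 q + d0 q, \<lambda>q. b1 q + d1 q} \<subseteq> ?A"
        using fg[THEN slope_expansionD(1)] by (simp add: fun_aff_closed)
    next
      fix t x u assume p: "(t, x, u * x) \<in> fib_punct J F"
      define q z where qz: "q = isogeny J (t, x, u * x)" "z = x - D_form J t 1 / x"
      have f: "f (t, x, u * x) = a0 q + u * a1 q + z * b0 q + u * z * b1 q"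
        and g: "g (t, x, u * x) = c0 q + u * c1 q + z * d0 q + u * z * d1 q"
        using fg[THEN slope_expansionD(2)] p qz by blast+
      show "f (t, x, u * x) + g (t, x, u * x) =
        (a0 q + c0 q) + u * (a1 q + c1 q) + z * (b0 q + d0 q) + u * z * (b1 q + d1 q)"
        unfolding f g by (simp add: algebra_simps)
    qed
    then show ?case by blast
  next
    case (mult f g)
    then obtain a0 a1 b0 b1 c0 c1 d0 d1 where
      fg: "slope_expansion J F f a0 a1 b0 b1" "slope_expansion J F g c0 c1 d0 d1" by blast
    have "slope_expansion J F (\<lambda>p. f p * g p)
        (\<lambda>q. a0 q * c0 q + U q * (a1 q * c1 q) + Z q * (b0 q * d0 q) + U q * Z q * (b1 q * d1 q))
        (\<lambda>q. a0 q * c1 q + a1 q * c0 q + Z q * (b0 q * d1 q + b1 q * d0 q))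
        (\<lambda>q. a0 q * d0 q + b0 q * c0 q + U q * (a1 q * d1 q + b1 q * c1 q))
        (\<lambda>q. a0 q * d1 q + b1 q * c0 q + a1 q * d0 q + b0 q * c1 q)"
      unfolding slope_expansion_def
    proof (intro conjI allI impI)
      show "{\<lambda>q. a0 q * c0 q + U q * (a1 q * c1 q) + Z q * (b0 q * d0 q) + U q * Z q * (b1 q * d1 q),
        \<lambda>q. a0 q * c1 q + a1 q * c0 q + Z q * (b0 q * d1 q + b1 q * d0 q),
        \<lambda>q. a0 q * d0 q + b0 q * c0 q + U q * (a1 q * d1 q + b1 q * c1 q),
        \<lambda>q. a0 q * d1 q + b1 q * c0 q + a1 q * d0 q + b0 q * c1 q} \<subseteq> ?A"
        using fg[THEN slope_expansionD(1)] U Z by (simp add: fun_aff_closed)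
    next
      fix t x u assume p: "(t, x, u * x) \<in> fib_punct J F"
      define q z where qz: "q = isogeny J (t, x, u * x)" "z = x - D_form J t 1 / x"
      have f: "f (t, x, u * x) = a0 q + u * a1 q + z * b0 q + u * z * b1 q"
        and g: "g (t, x, u * x) = c0 q + u * c1 q + z * d0 q + u * z * d1 q"
        using fg[THEN slope_expansionD(2)] p qz by blast+
      have UZ: "U q = u * u" "Z q = z * z" using eval[OF p] by (simp_all add: qz power2_eq_square)
      show "f (t, x, u * x) * g (t, x, u * x) =
        (a0 q * c0 q + U q * (a1 q * c1 q) + Z q * (b0 q * d0 q) + U q * Z q * (b1 q * d1 q)) +
        u * (a0 q * c1 q + a1 q * c0 q + Z q * (b0 q * d1 q + b1 q * d0 q)) +
        z * (a0 q * d0 q + b0 q * c0 q + U q * (a1 q * d1 q + b1 q * c1 q)) +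
        u * z * (a0 q * d1 q + b1 q * c0 q + a1 q * d0 q + b0 q * c1 q)"
        unfolding f g UZ by (simp add: algebra_simps)
    qed
    then show ?case by blast
  }
qed

lemma isogeny_invariants:
  assumes "good_base J F" "f \<in> fun_punct F"
    and inv: "\<And>p. p \<in> fib_punct J F \<Longrightarrow> f (torsion_translation J p) = f p"
  obtains g where "g \<in> fun_aff ((\<lambda>t. shift J - t) ` F)"
    "\<And>p. p \<in> fib_punct J F \<Longrightarrow> g (isogeny J p) = f p"
proof -
  obtain a0 a1 b0 b1 where exp: "slope_expansion J F f a0 a1 b0 b1"
    using slope_expansion_exists[OF assms(1,2)] by blast
  \<comment> \<open>The third coordinate of the isogeny is u z / (2 sqrt 2), so the surviving u
    z-part is itself a pullback.\<close>
  define g where "g q = a0 q + 2 * sqrt2 * snd (snd q) * b1 q" for q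
  have "g \<in> fun_aff ((\<lambda>t. shift J - t) ` F)"
    using exp unfolding g_def slope_expansion_def by (intro fun_aff_closed fun_aff_gens) auto
  moreover have "g (isogeny J p) = f p" if p: "p \<in> fib_punct J F" for p
  proof -
    obtain t x u where p': "p = (t, x, u * x)" "t \<notin> F" "x \<noteq> 0"
      "u^2 = x + C_form J t 1 + D_form J t 1 / x" by (rule fib_punct_cases[OF p])
    define D x' where "D = D_form J t 1" and "x' = D / x"
    have "D \<noteq> 0" using assms(1) p'(2) by (simp add: good_base_def D_def)
    then have x': "x' \<noteq> 0" "D / x' = x" using p'(3) by (simp_all add: x'_def)
    have j: "torsion_translation J p = (t, x', - u * x')"
      using torsion_translation_slope p unfolding p'(1) x'_def D_def by blast
    have jS: "(t, x', - u * x') \<in> fib_punct J F"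
      using p' x' by (simp add: fib_punct_iff flip: D_def x'_def del: mult_minus_left)
    have iso: "isogeny J (t, x', - u * x') = isogeny J p"
      using isogeny_eq_iff[OF assms(1) p, of "torsion_translation J p"] jS by (simp add: j)
    define q where "q = isogeny J p"
    have 1: "f p = a0 q + u * a1 q + (x - x') * b0 q + u * (x - x') * b1 q"
      using exp p unfolding slope_expansion_def p'(1) q_def x'_def D_def by blast
    have "f (t, x', - u * x') = a0 q + - u * a1 q + (x' - x) * b0 q + - u * (x' - x) * b1 q"
      using exp jS iso unfolding slope_expansion_def q_def by (metis x'(2) D_def)
    then have 2: "f p = a0 q + - u * a1 q + (x' - x) * b0 q + - u * (x' - x) * b1 q"
      using inv[OF p] j by simp
    have "2 * f p = 2 * (a0 q + u * (x - x') * b1 q)"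
    proof -
      have "2 * f p = f p + f p" by simp
      also have "\<dots> = (a0 q + u * a1 q + (x - x') * b0 q + u * (x - x') * b1 q) +
          (a0 q + - u * a1 q + (x' - x) * b0 q + - u * (x' - x) * b1 q)"
        using 1 2 by (simp only:)
      also have "\<dots> = 2 * (a0 q + u * (x - x') * b1 q)" by (simp add: algebra_simps)
      finally show ?thesis .
    qed
    moreover have "2 * sqrt2 * snd (snd q) = u * (x - x')"
      using p'(3) unfolding q_def p'(1) by (simp add: isogeny_slope x'_def D_def sqrt2)
    ultimately show "g (isogeny J p) = f p"
      unfolding g_def q_def[symmetric] by (metis mult_cancel_left zero_neq_numeral)
  qed
  ultimately show ?thesis by (rule that)
qed

lemma isogeny_quotient:
  assumes "good_base J F"
  shows "quotient_by_involution (fib_punct J F) (fun_punct F) (torsion_translation J)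
    (fib_aff (dual_coords J) ((\<lambda>t. shift J - t) ` F)) (fun_aff ((\<lambda>t. shift J - t) ` F)) (isogeny J)"
  unfolding quotient_by_involution_def
proof (intro conjI)
  show "isogeny J ` fib_punct J F = fib_aff (dual_coords J) ((\<lambda>t. shift J - t) ` F)"
    by (rule isogeny_image[OF assms])
  show "\<forall>p\<in>fib_punct J F. \<forall>q\<in>fib_punct J F.
      isogeny J p = isogeny J q \<longleftrightarrow> q = p \<or> q = torsion_translation J p"
    using isogeny_eq_iff[OF assms] by blast
  have closed: "torsion_translation J p \<in> fib_punct J F" if p: "p \<in> fib_punct J F" for p
  proof -
    obtain t x u where p': "p = (t, x, u * x)" "t \<notin> F" "x \<noteq> 0"
      "u^2 = x + C_form J t 1 + D_form J t 1 / x" by (rule fib_punct_cases[OF p])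
    have "D_form J t 1 \<noteq> 0" using assms p'(2) by (simp add: good_base_def)
    moreover have "torsion_translation J p = (t, D_form J t 1 / x, - u * (D_form J t 1 / x))"
      using torsion_translation_slope p unfolding p'(1) by blast
    ultimately show ?thesis
      using p' by (simp only: fib_punct_iff) simp
  qed
  show "{restrict (f \<circ> isogeny J) (fib_punct J F) |f. f \<in> fun_aff ((\<lambda>t. shift J - t) ` F)} =
    {restrict f (fib_punct J F) |f. f \<in> fun_punct F \<and>
      (\<forall>p\<in>fib_punct J F. f (torsion_translation J p) = f p)}" (is "?L = ?R")
  proof (intro equalityI subsetI)
    fix h assume "h \<in> ?L"
    then obtain f where f: "f \<in> fun_aff ((\<lambda>t. shift J - t) ` F)"
      "h = restrict (f \<circ> isogeny J) (fib_punct J F)" by blast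
    have "isogeny J (torsion_translation J p) = isogeny J p" if "p \<in> fib_punct J F" for p
      using isogeny_eq_iff[OF assms that closed[OF that]] by simp
    with isogeny_pullback[OF f(1)] f(2) show "h \<in> ?R"
      by (auto simp: comp_def intro!: exI[of _ "\<lambda>p. f (isogeny J p)"])
  next
    fix h assume "h \<in> ?R"
    then obtain f where f: "f \<in> fun_punct F" "h = restrict f (fib_punct J F)"
      "\<And>p. p \<in> fib_punct J F \<Longrightarrow> f (torsion_translation J p) = f p" by blast
    obtain g where "g \<in> fun_aff ((\<lambda>t. shift J - t) ` F)"
      "\<And>p. p \<in> fib_punct J F \<Longrightarrow> g (isogeny J p) = f p"
      using isogeny_invariants[OF assms f(1) f(3)] by blast
    then show "h \<in> ?L" unfolding f(2) by (auto intro!: exI[of _ g] simp: restrict_def)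
  qed
qed

text \<open>The isogeny exchanges the two smoothness conditions: C^2 / 4 - D is the new D, and (-
  C)^2 - 4 (C^2 / 4 - D) = 4 D.\<close>

lemma good_base_dual:
  assumes "good_base J F"
  shows "good_base (dual_coords J) ((\<lambda>t. shift J - t) ` F)"
  unfolding good_base_def
proof (intro conjI allI impI)
  show "finite ((\<lambda>t. shift J - t) ` F)" using assms by (simp add: good_base_def)
  fix t assume t: "t \<notin> (\<lambda>t. shift J - t) ` F"
  define s where "s = shift J - t"
  have s: "t = shift J - s" "s \<notin> F" using t by (auto simp: s_def image_iff)
  then have "D_form J s 1 \<noteq> 0" "(C_form J s 1)^2 \<noteq> 4 * D_form J s 1"
    using assms by (auto simp: good_base_def)
  then show "D_form (dual_coords J) t 1 \<noteq> 0"
    "(C_form (dual_coords J) t 1)^2 \<noteq> 4 * D_form (dual_coords J) t 1"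
    unfolding s(1) C_form_dual D_form_dual by auto
qed

definition discriminant_poly :: "coords \<Rightarrow> complex poly" where
  "discriminant_poly J = C_poly J ^ 2 - smult 4 (D_poly J)"

text \<open>D dominates, since C^2 has degree at most 4. That the degree is odd is what later
  excludes a second 2-torsion section when the transformation fixes infinity.\<close>

lemma degree_discriminant_poly: "degree (discriminant_poly J) = 5"
proof -
  have "degree (C_poly J ^ 2) \<le> 4" using degree_power_le[of "C_poly J" 2] degree_C_poly[of J] by linarith
  then have "degree (C_poly J ^ 2 + - smult 4 (D_poly J)) = degree (- smult 4 (D_poly J))"
    by (intro degree_add_eq_right) (simp add: degree_D_poly)
  then show ?thesis by (simp add: discriminant_poly_def degree_D_poly)
qed

lemma good_base_exists: "\<exists>F. good_base J F"
proof -
  define F where "F = {t. poly (D_poly J) t = 0} \<union> {t. poly (discriminant_poly J) t = 0}"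
  have "D_poly J \<noteq> 0" "discriminant_poly J \<noteq> 0"
    using degree_D_poly[of J] degree_discriminant_poly[of J] by auto
  then have "finite F" by (simp add: F_def poly_roots_finite)
  then have "good_base J F"
    by (auto simp: good_base_def F_def discriminant_poly_def poly_D_poly poly_C_poly)
  then show ?thesis ..
qed

lemma vgsn_related_dual: "vgsn_related J (dual_coords J)"
proof -
  obtain F where F: "good_base J F" using good_base_exists by blast
  have "\<forall>(t, x, y)\<in>fib_punct J F. fst (isogeny J (t, x, y)) = ((-1) * t + shift J) / (0 * t + 1)"
    by (auto simp: isogeny_def)
  with F good_base_dual[OF F] isogeny_quotient[OF F] show ?thesis
    unfolding vgsn_related_def
    by (intro exI[of _ F] exI[of _ "(\<lambda>t. shift J - t) ` F"] exI[of _ "-1"] exI[of _ "shift J"]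
        exI[of _ 0] exI[of _ 1] exI[of _ "isogeny J"]) simp
qed

section \<open>Comparison of two quotients\<close>

text \<open>Both maps have the orbits of j as fibres, so \<phi>2 factors through \<phi>1. Both rings
  pull back onto the same invariants, so the induced map \<psi> identifies them, in both
  directions.\<close>

lemma quotient_comparison:
  assumes q1: "quotient_by_involution S R j S1 R1 \<phi>1" and q2: "quotient_by_involution S R j S2 R2 \<phi>2"
  shows "\<exists>\<psi>. (\<forall>p\<in>S. \<psi> (\<phi>1 p) = \<phi>2 p) \<and>
    (\<forall>f\<in>R2. \<exists>g\<in>R1. \<forall>q\<in>S1. g q = f (\<psi> q)) \<and>
    (\<forall>g\<in>R1. \<exists>f\<in>R2. \<forall>q\<in>S1. f (\<psi> q) = g q)"
proof -
  define \<psi> where "\<psi> q = \<phi>2 (SOME p. p \<in> S \<and> \<phi>1 p = q)" for q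
  have \<psi>: "\<psi> (\<phi>1 p) = \<phi>2 p" if "p \<in> S" for p
  proof -
    define p' where "p' = (SOME p'. p' \<in> S \<and> \<phi>1 p' = \<phi>1 p)"
    have p': "p' \<in> S" "\<phi>1 p' = \<phi>1 p"
      unfolding p'_def by (rule someI2[of _ p]; use that in simp)+
    then have "p = p' \<or> p = j p'" using q1 that unfolding quotient_by_involution_def by blast
    then have "\<phi>2 p' = \<phi>2 p" using q2 that p' unfolding quotient_by_involution_def by blast
    then show ?thesis by (simp add: \<psi>_def p'_def)
  qed
  have S1: "\<exists>p\<in>S. q = \<phi>1 p" if "q \<in> S1" for q
    using q1 that unfolding quotient_by_involution_def by blast
  have eq: "{restrict (f \<circ> \<phi>1) S |f. f \<in> R1} = {restrict (f \<circ> \<phi>2) S |f. f \<in> R2}"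
    using q1 q2 unfolding quotient_by_involution_def by simp
  have agree: "g q = f (\<psi> q)" if "restrict (f \<circ> \<phi>2) S = restrict (g \<circ> \<phi>1) S" "q \<in> S1" for f g q
  proof -
    obtain p where p: "p \<in> S" "q = \<phi>1 p" using S1[OF \<open>q \<in> S1\<close>] by blast
    have "f (\<phi>2 p) = g (\<phi>1 p)" using fun_cong[OF that(1), of p] p(1) by simp
    then show ?thesis using \<psi>[OF p(1)] p(2) by simp
  qed
  show ?thesis
  proof (intro exI[of _ \<psi>] conjI ballI \<psi>)
    fix f assume "f \<in> R2"
    then have "restrict (f \<circ> \<phi>2) S \<in> {restrict (f \<circ> \<phi>1) S |f. f \<in> R1}" unfolding eq by blast
    then obtain g where "g \<in> R1" "restrict (f \<circ> \<phi>2) S = restrict (g \<circ> \<phi>1) S" by blast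
    with agree show "\<exists>g\<in>R1. \<forall>q\<in>S1. g q = f (\<psi> q)" by blast
  next
    fix g assume "g \<in> R1"
    then have "restrict (g \<circ> \<phi>1) S \<in> {restrict (f \<circ> \<phi>2) S |f. f \<in> R2}" unfolding eq[symmetric] by blast
    then obtain f where "f \<in> R2" "restrict (f \<circ> \<phi>2) S = restrict (g \<circ> \<phi>1) S" by force
    with agree[of f g] show "\<exists>f\<in>R2. \<forall>q\<in>S1. f (\<psi> q) = g q" by fastforce
  qed
qed

section \<open>Isomorphisms on single fibres and in families\<close>

lemma fib_aff_iff:
  "(t, x, y) \<in> fib_aff J F \<longleftrightarrow> t \<notin> F \<and> y^2 = x^3 + C_form J t 1 * x^2 + D_form J t 1 * x"
  by (simp add: fib_aff_def weierstrass_affine)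

text \<open>Pulling back the coordinates of the target gives X and Y as polynomials in x and y. That
  every function on the source is a pullback gives x and y in terms of X and Y, as
  \<open>curve_isomorphism_affine\<close> demands.\<close>

lemma fibre_isomorphism:
  assumes \<psi>: "\<And>t x y. (t, x, y) \<in> fib_aff J F \<Longrightarrow>
      \<psi> (t, x, y) \<in> fib_aff K F' \<and> fst (\<psi> (t, x, y)) = m t"
    and pull1: "\<And>f. f \<in> fun_aff F' \<Longrightarrow> \<exists>g\<in>fun_aff F. \<forall>q\<in>fib_aff J F. g q = f (\<psi> q)"
    and pull2: "\<And>g. g \<in> fun_aff F \<Longrightarrow> \<exists>f\<in>fun_aff F'. \<forall>q\<in>fib_aff J F. f (\<psi> q) = g q"
    and "t \<notin> F"
  shows "\<exists>\<alpha> \<beta> \<gamma>. \<alpha> \<noteq> 0 \<and>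
    (\<forall>x y. (t, x, y) \<in> fib_aff J F \<longrightarrow> \<psi> (t, x, y) = (m t, \<alpha> * x + \<beta>, \<gamma> * y)) \<and>
    \<gamma>^2 = \<alpha>^3 \<and> \<gamma>^2 * C_form J t 1 = 3 * \<alpha>^2 * \<beta> + C_form K (m t) 1 * \<alpha>^2 \<and>
    \<gamma>^2 * D_form J t 1 =
      3 * \<alpha> * \<beta>^2 + 2 * C_form K (m t) 1 * \<alpha> * \<beta> + D_form K (m t) 1 * \<alpha> \<and>
    \<beta>^3 + C_form K (m t) 1 * \<beta>^2 + D_form K (m t) 1 * \<beta> = 0"
proof -
  define A B A' B' where AB: "A = C_form J t 1" "B = D_form J t 1"
    "A' = C_form K (m t) 1" "B' = D_form K (m t) 1"
  define X Y where XY: "X x y = fst (snd (\<psi> (t, x, y)))" "Y x y = snd (snd (\<psi> (t, x, y)))" for x y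
  have on: "(t, x, y) \<in> fib_aff J F" if "y^2 = x^3 + A * x^2 + B * x" for x y
    using that \<open>t \<notin> F\<close> by (simp add: fib_aff_iff AB)
  have \<psi>_eq: "\<psi> (t, x, y) = (m t, X x y, Y x y)" if "y^2 = x^3 + A * x^2 + B * x" for x y
    using \<psi>[OF on[OF that]] by (simp add: XY prod_eq_iff)
  have curve: "Y x y ^ 2 = X x y ^ 3 + A' * X x y ^ 2 + B' * X x y"
    if "y^2 = x^3 + A * x^2 + B * x" for x y
    using \<psi>[OF on[OF that]] unfolding \<psi>_eq[OF that] fib_aff_iff AB by simp
  have forward: "\<exists>P Q. \<forall>x y. y^2 = x^3 + A * x^2 + B * x \<longrightarrow>
      f (\<psi> (t, x, y)) = poly P x + y * poly Q x" if f: "f \<in> fun_aff F'" for f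
  proof -
    obtain g where g: "g \<in> fun_aff F" "\<And>q. q \<in> fib_aff J F \<Longrightarrow> g q = f (\<psi> q)"
      using pull1[OF f] by blast
    obtain P Q where "\<And>x y. y^2 = x^3 + A * x^2 + B * x \<Longrightarrow> g (t, x, y) = poly P x + y * poly Q x"
      by (rule fun_aff_fibre[OF g(1), of A B t]) blast
    then show ?thesis using g(2)[OF on] by metis
  qed
  have backward: "\<exists>P Q. \<forall>x y. y^2 = x^3 + A * x^2 + B * x \<longrightarrow>
      g (t, x, y) = poly P (X x y) + Y x y * poly Q (X x y)" if g: "g \<in> fun_aff F" for g
  proof -
    obtain f where f: "f \<in> fun_aff F'" "\<And>q. q \<in> fib_aff J F \<Longrightarrow> f (\<psi> q) = g q"
      using pull2[OF g] by blast
    obtain P Q where PQ: "\<And>x y. y^2 = x^3 + A' * x^2 + B' * x \<Longrightarrow>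
        f (m t, x, y) = poly P x + y * poly Q x"
      by (rule fun_aff_fibre[OF f(1), of A' B' "m t"]) blast
    have "g (t, x, y) = poly P (X x y) + Y x y * poly Q (X x y)"
      if "y^2 = x^3 + A * x^2 + B * x" for x y
      using f(2)[OF on[OF that]] PQ[OF curve[OF that]] by (simp add: \<psi>_eq[OF that])
    then show ?thesis by blast
  qed
  obtain P1 Q1 where 1: "\<And>x y. y^2 = x^3 + A * x^2 + B * x \<Longrightarrow> X x y = poly P1 x + y * poly Q1 x"
    using forward[OF fun_aff_gens(2)] unfolding XY by blast
  obtain P2 Q2 where 2: "\<And>x y. y^2 = x^3 + A * x^2 + B * x \<Longrightarrow> Y x y = poly P2 x + y * poly Q2 x"
    using forward[OF fun_aff_gens(3)] unfolding XY by blast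
  obtain G1 G2 where 3: "\<And>x y. y^2 = x^3 + A * x^2 + B * x \<Longrightarrow>
      x = poly G1 (X x y) + Y x y * poly G2 (X x y)"
    using backward[OF fun_aff_gens(2)] by auto
  obtain H1 H2 where 4: "\<And>x y. y^2 = x^3 + A * x^2 + B * x \<Longrightarrow>
      y = poly H1 (X x y) + Y x y * poly H2 (X x y)"
    using backward[OF fun_aff_gens(3)] by auto
  show ?thesis
  proof (rule curve_isomorphism_affine[of A B X P1 Q1 Y P2 Q2 A' B' G1 G2 H1 H2, OF 1 2 curve 3 4])
    fix \<alpha> \<beta> \<gamma>
    assume iso: "\<alpha> \<noteq> 0"
      "\<And>x y. y^2 = x^3 + A * x^2 + B * x \<Longrightarrow> X x y = \<alpha> * x + \<beta>"
      "\<And>x y. y^2 = x^3 + A * x^2 + B * x \<Longrightarrow> Y x y = \<gamma> * y"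
      "\<gamma>^2 = \<alpha>^3" "\<gamma>^2 * A = 3 * \<alpha>^2 * \<beta> + A' * \<alpha>^2"
      "\<gamma>^2 * B = 3 * \<alpha> * \<beta>^2 + 2 * A' * \<alpha> * \<beta> + B' * \<alpha>"
      "\<beta>^3 + A' * \<beta>^2 + B' * \<beta> = 0"
    have "\<psi> (t, x, y) = (m t, \<alpha> * x + \<beta>, \<gamma> * y)" if "(t, x, y) \<in> fib_aff J F" for x y
    proof -
      have c: "y^2 = x^3 + A * x^2 + B * x" using that by (simp add: fib_aff_iff AB)
      show ?thesis by (simp only: \<psi>_eq[OF c] iso(2,3)[OF c])
    qed
    with iso(1,4-7) show ?thesis unfolding AB by blast
  qed
qed

lemma rational_fun_cong:
  assumes "rational_fun f" "\<forall>\<^sub>F t in cofinite. f t = g t"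
  shows "rational_fun g"
proof -
  obtain p q where f: "q \<noteq> 0" "\<forall>\<^sub>F t in cofinite. poly q t * f t = poly p t"
    using assms(1) unfolding rational_fun_def by blast
  have "\<forall>\<^sub>F t in cofinite. poly q t * g t = poly p t"
    using f(2) assms(2) by eventually_elim simp
  with f(1) show ?thesis unfolding rational_fun_def by blast
qed

lemma eventually_notin: "finite F \<Longrightarrow> \<forall>\<^sub>F t in cofinite. t \<notin> F"
  by (simp add: eventually_cofinite)

text \<open>The pulled-back target coordinates are global functions g1 and g2 that interpolate all
  fibres at once. On x = 0 the first equals \<beta>; on x = 1 the two equal \<alpha> + \<beta> and
  \<gamma> y.\<close>

lemma isomorphism_coefficients_rational:
  assumes "finite F"
    and \<psi>: "\<And>t x y. (t, x, y) \<in> fib_aff J F \<Longrightarrow> \<psi> (t, x, y) = (m t, \<alpha> t * x + \<beta> t, \<gamma> t * y)"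
    and pull1: "\<And>f. f \<in> fun_aff F' \<Longrightarrow> \<exists>g\<in>fun_aff F. \<forall>q\<in>fib_aff J F. g q = f (\<psi> q)"
  shows "rational_fun \<alpha>" "rational_fun \<beta>" "rational_fun \<gamma>"
proof -
  obtain g1 where g1: "g1 \<in> fun_aff F" "\<And>q. q \<in> fib_aff J F \<Longrightarrow> g1 q = fst (snd (\<psi> q))"
    using pull1[OF fun_aff_gens(2)] by auto
  obtain g2 where g2: "g2 \<in> fun_aff F" "\<And>q. q \<in> fib_aff J F \<Longrightarrow> g2 q = snd (snd (\<psi> q))"
    using pull1[OF fun_aff_gens(3)] by auto
  \<comment> \<open>The value of x^3 + C x^2 + D x at x = 1. Its degree 5 ensures that y is nonzero
    on this slice for almost all t.\<close>
  define w where "w = 1 + C_poly J + D_poly J"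
  have "degree w = 5"
  proof -
    have "degree (1 + C_poly J) \<le> 2" by (intro degree_add_le) (auto simp: degree_C_poly)
    then show ?thesis unfolding w_def by (subst degree_add_eq_right) (auto simp: degree_D_poly)
  qed
  then have "w \<noteq> 0" by auto
  have w: "y^2 = poly w t \<longleftrightarrow> y^2 = 1^3 + C_form J t 1 * 1^2 + D_form J t 1 * 1" for t y
    by (simp add: w_def poly_C_poly poly_D_poly)
  note fin = eventually_notin[OF assms(1)]
  obtain p0 q0 where p0: "rational_fun p0"
      "\<And>t y. y^2 = 0 \<Longrightarrow> g1 (t, 0, y) = p0 t + y * q0 t"
    by (rule fun_aff_slice[OF g1(1) rational_fun_const[of 0], of 0]) blast
  obtain p1 q1 where p1: "rational_fun p1"
      "\<And>t y. y^2 = poly w t \<Longrightarrow> g1 (t, 1, y) = p1 t + y * q1 t"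
    by (rule fun_aff_slice[OF g1(1) rational_fun_poly[of w], of 1]) blast
  obtain p2 q2 where p2: "rational_fun q2"
      "\<And>t y. y^2 = poly w t \<Longrightarrow> g2 (t, 1, y) = p2 t + y * q2 t"
    by (rule fun_aff_slice[OF g2(1) rational_fun_poly[of w], of 1]) blast
  have "p0 t = \<beta> t" if "t \<notin> F" for t
  proof -
    have "(t, 0, 0) \<in> fib_aff J F" using that by (simp add: fib_aff_iff)
    then show ?thesis using g1(2)[of "(t, 0, 0)"] \<psi>[of t 0 0] p0(2)[of 0 t] by simp
  qed
  with fin have "\<forall>\<^sub>F t in cofinite. p0 t = \<beta> t" by (rule eventually_mono)
  with p0(1) show \<beta>: "rational_fun \<beta>" by (rule rational_fun_cong)
  have val: "p1 t + y * q1 t = \<alpha> t + \<beta> t" "p2 t + y * q2 t = \<gamma> t * y"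
    if "t \<notin> F" "y^2 = poly w t" for t y
  proof -
    have on: "(t, 1, y) \<in> fib_aff J F" using that unfolding w fib_aff_iff by simp
    show "p1 t + y * q1 t = \<alpha> t + \<beta> t" "p2 t + y * q2 t = \<gamma> t * y"
      using g1(2)[OF on] g2(2)[OF on] unfolding \<psi>[OF on] p1(2)[OF that(2)] p2(2)[OF that(2)]
      by simp_all
  qed
  \<comment> \<open>The sum over y and - y isolates the part without y, the difference isolates the
    coefficient of y.\<close>
  have key: "p1 t - \<beta> t = \<alpha> t \<and> q2 t = \<gamma> t" if "t \<notin> F" "poly w t \<noteq> 0" for t
  proof -
    define y where "y = csqrt (poly w t)"
    have y: "y^2 = poly w t" "(- y)^2 = poly w t" by (simp_all add: y_def)
    then have "y \<noteq> 0" using that(2) by auto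
    have "2 * p1 t = (p1 t + y * q1 t) + (p1 t + - y * q1 t)" by simp
    also have "\<dots> = 2 * (\<alpha> t + \<beta> t)" by (simp only: val(1)[OF that(1) y(1)] val(1)[OF that(1) y(2)]) simp
    finally have "2 * p1 t = 2 * (\<alpha> t + \<beta> t)" .
    then have 1: "p1 t = \<alpha> t + \<beta> t" by (simp only: mult_cancel_left) simp
    have "(2 * y) * q2 t = (p2 t + y * q2 t) - (p2 t + - y * q2 t)" by simp
    also have "\<dots> = (2 * y) * \<gamma> t" by (simp only: val(2)[OF that(1) y(1)] val(2)[OF that(1) y(2)]) simp
    finally have "(2 * y) * q2 t = (2 * y) * \<gamma> t" .
    then have "q2 t = \<gamma> t" using \<open>y \<noteq> 0\<close> by simp
    with 1 show ?thesis by simp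
  qed
  have *: "\<forall>\<^sub>F t in cofinite. p1 t - \<beta> t = \<alpha> t \<and> q2 t = \<gamma> t"
    using fin eventually_poly_nonzero[OF \<open>w \<noteq> 0\<close>]
  proof eventually_elim
    case (elim t)
    then show ?case by (rule key)
  qed
  show "rational_fun \<alpha>"
    using rational_fun_diff[OF p1(1) \<beta>] eventually_conj_iff[THEN iffD1, OF *, THEN conjunct1]
    by (rule rational_fun_cong)
  show "rational_fun \<gamma>"
    using p2(1) eventually_conj_iff[THEN iffD1, OF *, THEN conjunct2] by (rule rational_fun_cong)
qed

section \<open>Isomorphisms covering a Moebius transformation\<close>

text \<open>Keeping numerator U and denominator V of the transformation apart gives polynomials in t
  that make sense at the pole as well; there the companion \<open>D_hom\<close> reduces to
  U^5.\<close>

definition C_hom :: "coords \<Rightarrow> complex poly \<Rightarrow> complex poly \<Rightarrow> complex poly" where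
  "C_hom J U V = (case J of (j2, j6, j8, j10, j12, j16, j20) \<Rightarrow>
     smult j2 (U^2) + smult j6 (U * V) + smult j10 (V^2))"

definition D_hom :: "coords \<Rightarrow> complex poly \<Rightarrow> complex poly \<Rightarrow> complex poly" where
  "D_hom J U V = (case J of (j2, j6, j8, j10, j12, j16, j20) \<Rightarrow>
     U^5 + smult j8 (U^3 * V^2) + smult j12 (U^2 * V^3) + smult j16 (U * V^4) + smult j20 (V^5))"

lemma poly_C_hom: "poly (C_hom J U V) t = C_form J (poly U t) (poly V t)"
  by (cases J) (simp add: C_hom_def mult.assoc)

lemma poly_D_hom: "poly (D_hom J U V) t = D_form J (poly U t) (poly V t)"
  by (cases J) (simp add: D_hom_def mult.assoc)

lemma C_form_homogeneous: "C_form J (k * u) (k * v) = k^2 * C_form J u v"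
  by (cases J) (simp add: power_mult_distrib power2_eq_square algebra_simps)

lemma D_form_homogeneous: "D_form J (k * u) (k * v) = k^5 * D_form J u v"
  by (cases J) (simp add: power_mult_distrib eval_nat_numeral algebra_simps)

lemma C_form_dehomogenize: "v \<noteq> 0 \<Longrightarrow> C_form J u v = v^2 * C_form J (u / v) 1"
  using C_form_homogeneous[of J v "u / v" 1] by simp

lemma D_form_dehomogenize: "v \<noteq> 0 \<Longrightarrow> D_form J u v = v^5 * D_form J (u / v) 1"
  using D_form_homogeneous[of J v "u / v" 1] by simp

lemma D_form_at_infinity: "D_form J u 0 = u^5"
  by (cases J) simp

lemma degree_C_hom: "degree (C_hom J [:b, a:] [:d, c:]) \<le> 2"
proof (cases J)
  case (fields j2 j6 j8 j10 j12 j16 j20)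
  have UV: "degree [:b, a:] \<le> 1" "degree [:d, c:] \<le> 1" by auto
  have "degree ([:b, a:]^2) \<le> 2" "degree ([:d, c:]^2) \<le> 2"
    using degree_power_le[of "[:b, a:]" 2] degree_power_le[of "[:d, c:]" 2] UV by linarith+
  moreover have "degree ([:b, a:] * [:d, c:]) \<le> 2"
    using degree_mult_le[of "[:b, a:]" "[:d, c:]"] UV by linarith
  ultimately show ?thesis unfolding C_hom_def fields prod.case
    by (intro degree_add_le) (meson degree_smult_le le_trans)+
qed

lemma degree_D_hom: "degree (D_hom J [:b, a:] [:d, c:]) \<le> 5"
proof (cases J)
  case (fields j2 j6 j8 j10 j12 j16 j20)
  have UV: "degree [:b, a:] \<le> 1" "degree [:d, c:] \<le> 1" by auto
  have pow: "degree ([:b, a:]^n) \<le> n" "degree ([:d, c:]^n) \<le> n" for n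
    using degree_power_le[of "[:b, a:]" n] degree_power_le[of "[:d, c:]" n] UV
    by (metis le_trans mult.commute mult_le_mono2 mult.right_neutral)+
  have prod: "degree ([:b, a:]^i * [:d, c:]^k) \<le> 5" if "i + k = 5" for i k
    using degree_mult_le[of "[:b, a:]^i" "[:d, c:]^k"] pow(1)[of i] pow(2)[of k] that by linarith
  have "degree ([:b, a:] * [:d, c:]^4) \<le> 5" using prod[of 1 4] by simp
  with prod[of 3 2] prod[of 2 3] pow(1)[of 5] pow(2)[of 5] show ?thesis
    unfolding D_hom_def fields prod.case
    by (intro degree_add_le) (simp_all add: order_trans[OF degree_smult_le])
qed

text \<open>The degrees 2 and 5 leave only a constant and a linear cofactor, which is the shape
  handled by \<open>excludedI\<close>.\<close>

lemma excluded_dvd: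
  assumes "[:-e, 1:]^2 dvd C_poly J" "[:-e, 1:]^4 dvd D_poly J"
  shows "excluded J"
proof -
  obtain k where k: "C_poly J = [:-e, 1:]^2 * k" using assms(1) by (rule dvdE)
  obtain g where g: "D_poly J = [:-e, 1:]^4 * g" using assms(2) by (rule dvdE)
  have "degree k = 0"
  proof (cases "k = 0")
    case False
    then have "degree (C_poly J) = 2 + degree k"
      unfolding k by (subst degree_mult_eq) (auto simp: degree_linear_power)
    then show ?thesis using degree_C_poly[of J] by simp
  qed simp
  then obtain k0 where k0: "k = [:k0:]" by (metis degree_eq_zeroE)
  have "g \<noteq> 0" using g degree_D_poly[of J] by auto
  then have "degree (D_poly J) = 4 + degree g"
    unfolding g by (subst degree_mult_eq) (auto simp: degree_linear_power)
  then have "degree g \<le> 1" using degree_D_poly[of J] by simp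
  then obtain g0 g1 where g1: "g = [:g0, g1:]" using degree_le_1_eq by metis
  have "C_form J t 1 = k0 * (t - e)^2" for t
    unfolding poly_C_poly[symmetric] k k0 by (simp add: poly_power)
  moreover have "D_form J t 1 = (t - e)^4 * (g1 * t + g0)" for t
    unfolding poly_D_poly[symmetric] g g1 by (simp add: poly_power algebra_simps)
  ultimately show ?thesis by (intro excludedI[of J k0 e g1 g0] eventuallyI)
qed

text \<open>Nonminimality over e is carried by the Moebius transformation to its value e' = (b + a
  e) / (d + c e), which is finite because e is not the pole.\<close>

lemma excluded_dvd_hom:
  assumes "[:-e, 1:]^2 dvd C_hom K [:b, a:] [:d, c:]" "[:-e, 1:]^4 dvd D_hom K [:b, a:] [:d, c:]"
    and det: "a * d - b * c \<noteq> 0" and v: "d + c * e \<noteq> 0"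
  shows "excluded K"
proof -
  define Ch Dh where Ch: "Ch = C_hom K [:b, a:] [:d, c:]" and Dh: "Dh = D_hom K [:b, a:] [:d, c:]"
  obtain k where k: "Ch = [:-e, 1:]^2 * k" using assms(1) unfolding Ch by (rule dvdE)
  obtain g where g: "Dh = [:-e, 1:]^4 * g" using assms(2) unfolding Dh by (rule dvdE)
  have "degree k = 0"
  proof (cases "k = 0")
    case False
    then have "degree Ch = 2 + degree k"
      unfolding k by (subst degree_mult_eq) (auto simp: degree_linear_power)
    then show ?thesis using degree_C_hom[of K b a d c] by (simp add: Ch)
  qed simp
  then obtain k0 where k0: "k = [:k0:]" by (metis degree_eq_zeroE)
  have "degree g \<le> 1"
  proof (cases "g = 0")
    case False
    then have "degree Dh = 4 + degree g"
      unfolding g by (subst degree_mult_eq) (auto simp: degree_linear_power)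
    then show ?thesis using degree_D_hom[of K b a d c] by (simp add: Dh)
  qed simp
  then obtain g0 g1 where g1: "g = [:g0, g1:]" using degree_le_1_eq by metis
  define \<delta> v where dv: "\<delta> = b * c - a * d" "v = d + c * e"
  have \<delta>: "\<delta> \<noteq> 0" and v: "v \<noteq> 0" using det v by (auto simp: dv)
  define e' where "e' = (b + e * a) / v"
  have C: "C_form K s 1 = (k0 * v^2 / \<delta>^2) * (s - e')^2"
    and D: "D_form K s 1 = (s - e')^4 * ((v^4 / \<delta>^5 * (g0 * c - g1 * d)) * s + v^4 / \<delta>^5 * (g1 * b - g0 * a))"
    if "c * s - a \<noteq> 0" for s
  proof -
    \<comment> \<open>t is the preimage of s. Multiplication by h clears its denominator, and h
      times (U, V) at t becomes \<delta> times (s, 1), so homogeneity of the forms applies.\<close>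
    define h t where ht: "h = c * s - a" "t = (b - d * s) / h"
    have h: "h \<noteq> 0" using that by (simp add: ht)
    have th: "h * t = b - d * s" using h by (simp add: ht)
    have U: "h * (b + a * t) = \<delta> * s" and V: "h * (d + c * t) = \<delta> * 1"
      using th unfolding dv ht(1) by algebra+
    have et: "h * (t - e) = - v * (s - e')"
    proof -
      have "v * e' = b + e * a" using v by (simp add: e'_def)
      then show ?thesis using th unfolding dv(2) ht(1) by algebra
    qed
    have "\<delta>^2 * C_form K s 1 = h^2 * poly Ch t"
      unfolding Ch poly_C_hom C_form_homogeneous[symmetric] U[symmetric] V[symmetric]
      by (simp add: mult.commute)
    also have "\<dots> = (h * (t - e))^2 * k0" unfolding k k0 by (simp add: poly_power power_mult_distrib)
    also have "\<dots> = k0 * v^2 * (s - e')^2" unfolding et by (simp add: power_mult_distrib)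
    finally show "C_form K s 1 = (k0 * v^2 / \<delta>^2) * (s - e')^2" using \<delta> by (simp add: field_simps)
    have "\<delta>^5 * D_form K s 1 = h^5 * poly Dh t"
      unfolding Dh poly_D_hom D_form_homogeneous[symmetric] U[symmetric] V[symmetric]
      by (simp add: mult.commute)
    also have "\<dots> = (h * (t - e))^4 * (g0 * h + g1 * (h * t))"
      unfolding g g1 by (simp add: poly_power power_mult_distrib eval_nat_numeral algebra_simps)
    also have "\<dots> = v^4 * (s - e')^4 * (g0 * h + g1 * (h * t))"
      unfolding et by (simp add: power_mult_distrib)
    also have "\<dots> = v^4 * (s - e')^4 * ((g0 * c - g1 * d) * s + (g1 * b - g0 * a))"
      unfolding th unfolding ht(1) by (simp add: algebra_simps)
    finally have "D_form K s 1 = v^4 * (s - e')^4 * ((g0 * c - g1 * d) * s + (g1 * b - g0 * a)) / \<delta>^5"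
      using \<delta> by (simp add: eq_divide_eq mult.commute)
    also have "\<dots> = (s - e')^4 * ((v^4 / \<delta>^5 * (g0 * c - g1 * d)) * s + v^4 / \<delta>^5 * (g1 * b - g0 * a))"
      by (simp add: add_divide_distrib distrib_left mult_ac)
    finally show "D_form K s 1 = \<dots>" .
  qed
  have "[:-a, c:] \<noteq> 0" using det by auto
  then have ev: "\<forall>\<^sub>F s in cofinite. c * s - a \<noteq> 0"
    using eventually_poly_nonzero[of "[:-a, c:]"] by (simp add: mult.commute)
  show ?thesis
    by (rule excludedI) (rule eventually_mono[OF ev C] eventually_mono[OF ev D]; assumption)+
qed

text \<open>The equation \<open>N^2 = q^2 V W\<close> is impossible because \<open>V W\<close> has odd order at the pole of the
  Moebius transformation.\<close>

lemma discriminant_not_square: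
  fixes K :: coords
  assumes det: "a * d - b * c \<noteq> 0" and "q \<noteq> 0"
  defines "V \<equiv> [:d, c:]"
  defines "W \<equiv> V * C_hom K [:b, a:] V ^ 2 - smult 4 (D_hom K [:b, a:] V)"
  shows "N^2 \<noteq> q^2 * (V * W)"
proof
  assume eq: "N^2 = q^2 * (V * W)"
  show False
  proof (cases "c = 0")
    case True
    then have "a \<noteq> 0" "d \<noteq> 0" using det by auto
    \<comment> \<open>For c = 0 the pole is infinity, and the odd order shows as the odd degree of
      W.\<close>
    have "W = smult (d^5) (discriminant_poly K \<circ>\<^sub>p [:b / d, a / d:])"
    proof (intro poly_eq_cofinite eventuallyI)
      fix t
      have "C_form K (b + a * t) d = d^2 * C_form K (b / d + a / d * t) 1"
        "D_form K (b + a * t) d = d^5 * D_form K (b / d + a / d * t) 1"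
        using C_form_dehomogenize[OF \<open>d \<noteq> 0\<close>] D_form_dehomogenize[OF \<open>d \<noteq> 0\<close>]
        by (simp_all add: add_divide_distrib)
      then show "poly W t = poly (smult (d^5) (discriminant_poly K \<circ>\<^sub>p [:b / d, a / d:])) t"
        unfolding W_def V_def discriminant_poly_def
        by (simp add: True poly_C_hom poly_D_hom poly_pcompose poly_C_poly poly_D_poly mult.commute[of t])
          (simp add: algebra_simps eval_nat_numeral)
    qed
    then have "degree W = 5"
      using \<open>a \<noteq> 0\<close> \<open>d \<noteq> 0\<close> by (simp add: degree_pcompose degree_discriminant_poly)
    then have "W \<noteq> 0" by auto
    moreover have "degree V = 0" "V \<noteq> 0" using True \<open>d \<noteq> 0\<close> by (simp_all add: V_def)
    ultimately have "degree (q^2 * (V * W)) = 2 * degree q + 5"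
      using \<open>q \<noteq> 0\<close> \<open>degree W = 5\<close> by (simp add: degree_mult_eq degree_power_eq)
    moreover have "even (degree (N^2))"
      by (cases "N = 0") (auto simp: degree_power_eq)
    ultimately show False using eq by simp
  next
    case False
    define e where "e = - d / c"
    have V: "V = smult c [:-e, 1:]" using False by (simp add: V_def e_def)
    have "poly V e = 0" by (simp add: V)
    moreover have "b + a * e \<noteq> 0" using det False by (simp add: e_def field_simps)
    \<comment> \<open>At the zero e of V only - 4 D(U, 0) = - 4 U^5 remains of W, and U(e) is
      nonzero. So e is a simple zero of V W.\<close>
    ultimately have "poly W e \<noteq> 0"
      by (simp add: W_def poly_D_hom D_form_at_infinity mult.commute)
    then have "W \<noteq> 0" "order e W = 0" by (auto simp: order_0I)
    have "V \<noteq> 0" using False by (simp add: V_def)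
    have "order e [:-e, 1:] = 1" using order_power_n_n[of e 1] by simp
    then have "order e V = 1" unfolding V order_smult[OF False] .
    have nz: "q * q * (V * W) \<noteq> 0" using \<open>q \<noteq> 0\<close> \<open>V \<noteq> 0\<close> \<open>W \<noteq> 0\<close> by simp
    then have "N * N \<noteq> 0" using eq by (simp add: power2_eq_square)
    then have "order e (N * N) = 2 * order e N" by (simp add: order_mult)
    moreover have "order e (q * q * (V * W)) = 2 * order e q + 1"
      using nz \<open>order e V = 1\<close> \<open>order e W = 0\<close> by (simp add: order_mult)
    ultimately have "2 * order e N = 2 * order e q + 1" using eq by (simp add: power2_eq_square)
    then show False by presburger
  qed
qed

section \<open>Constancy of the scaling factor\<close>

lemma linear_power_dvd_cancel:
  fixes y z :: "complex poly"
  assumes "poly y e \<noteq> 0" "[:-e, 1:]^n dvd y * z"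
  shows "[:-e, 1:]^n dvd z"
proof (cases "z = 0")
  case False
  moreover have "y \<noteq> 0" using assms(1) by auto
  ultimately have "order e (y * z) = order e z"
    using assms(1) by (simp add: order_mult order_0I)
  then show ?thesis
    using assms(2) False \<open>y \<noteq> 0\<close> unfolding order_divides by simp
qed simp

lemma cancel_common_roots:
  fixes p q :: "complex poly"
  assumes "q \<noteq> 0"
  shows "\<exists>g P Q. p = g * P \<and> q = g * Q \<and> (\<forall>e. poly P e \<noteq> 0 \<or> poly Q e \<noteq> 0)"
  using assms
proof (induction "degree q" arbitrary: p q rule: less_induct)
  case less
  show ?case
  proof (cases "\<exists>e. poly p e = 0 \<and> poly q e = 0")
    case True
    then obtain e p' q' where pq: "p = [:-e, 1:] * p'" "q = [:-e, 1:] * q'"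
      by (metis dvdE poly_eq_0_iff_dvd)
    have "q' \<noteq> 0" using pq(2) less.prems by auto
    then have "degree q = Suc (degree q')" unfolding pq(2) by (subst degree_mult_eq) auto
    then obtain g P Q where "p' = g * P" "q' = g * Q" "\<forall>e. poly P e \<noteq> 0 \<or> poly Q e \<noteq> 0"
      using less.hyps[of q' p'] \<open>q' \<noteq> 0\<close> by auto
    then show ?thesis
      unfolding pq using mult.assoc[of "[:-e, 1:]" g] by metis
  next
    case False
    moreover have "p = 1 * p" "q = 1 * q" by simp_all
    ultimately show ?thesis by blast
  qed
qed

text \<open>Minimality at every finite place forces the rational scaling factor \<open>P / Q\<close> to be constant.\<close>

lemma scaling_factor_constant:
  assumes det: "a * d - b * c \<noteq> 0" and "\<not> excluded J" "\<not> excluded K" and cop: "\<And>e. poly P e \<noteq> 0 \<or> poly Q e \<noteq> 0"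
    and C: "Q^2 * ([:d, c:]^2 * C_hom K [:b, a:] [:d, c:]) = P^2 * C_poly J"
    and D: "Q^4 * ([:d, c:]^3 * D_hom K [:b, a:] [:d, c:]) = P^4 * D_poly J"
  shows "degree P = 0" "degree Q = 0"
proof -
  \<comment> \<open>At a zero e of Q the value of P is nonzero, so the powers of t - e in Q^2 and
    Q^4 pass to C and D of J, which would make J nonminimal.\<close>
  show "degree Q = 0"
  proof (rule ccontr)
    assume "degree Q \<noteq> 0"
    then obtain e where Qe: "poly Q e = 0"
      using fundamental_theorem_of_algebra[of Q] by (auto simp: constant_degree)
    then have e: "[:-e, 1:] dvd Q" by (simp add: poly_eq_0_iff_dvd)
    have Pe: "poly (P^n) e \<noteq> 0" for n using cop[of e] Qe by (simp add: poly_power)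
    have "[:-e, 1:]^2 dvd P^2 * C_poly J" "[:-e, 1:]^4 dvd P^4 * D_poly J"
      unfolding C[symmetric] D[symmetric] by (intro dvd_mult2 dvd_power_same e)+
    then have "[:-e, 1:]^2 dvd C_poly J" "[:-e, 1:]^4 dvd D_poly J"
      by (auto intro: linear_power_dvd_cancel[OF Pe])
    with \<open>\<not> excluded J\<close> excluded_dvd show False by blast
  qed
  show "degree P = 0"
  proof (rule ccontr)
    assume "degree P \<noteq> 0"
    then obtain e where Pe: "poly P e = 0"
      using fundamental_theorem_of_algebra[of P] by (auto simp: constant_degree)
    then have e: "[:-e, 1:] dvd P" by (simp add: poly_eq_0_iff_dvd)
    have Qe: "poly (Q^n) e \<noteq> 0" for n using cop[of e] Pe by (simp add: poly_power)
    have "[:-e, 1:]^2 dvd Q^2 * ([:d, c:]^2 * C_hom K [:b, a:] [:d, c:])"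
      "[:-e, 1:]^4 dvd Q^4 * ([:d, c:]^3 * D_hom K [:b, a:] [:d, c:])"
      unfolding C D by (intro dvd_mult2 dvd_power_same e)+
    then have dvd: "[:-e, 1:]^2 dvd [:d, c:]^2 * C_hom K [:b, a:] [:d, c:]"
      "[:-e, 1:]^4 dvd [:d, c:]^3 * D_hom K [:b, a:] [:d, c:]"
      by (auto intro: linear_power_dvd_cancel[OF Qe])
    show False
    proof (cases "d + c * e = 0")
      \<comment> \<open>At the pole, V^3 contributes exactly three of the four factors t - e. The
        fourth would have to divide D(U, V), whose value there is the nonzero U(e)^5.\<close>
      case True
      then have "c \<noteq> 0" using det by (metis add.right_neutral diff_zero mult_zero_left mult_zero_right)
      have de: "d = - c * e" using True by (simp add: eq_neg_iff_add_eq_0)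
      define x Dh where "x = [:-e, 1:]" and "Dh = D_hom K [:b, a:] [:d, c:]"
      have V: "[:d, c:] = smult c x" by (simp add: de x_def)
      have "x^4 dvd smult c x ^ 3 * Dh" using dvd(2) unfolding Dh_def[symmetric] unfolding x_def[symmetric] V .
      moreover have "smult c x ^ 3 * Dh = x^3 * smult (c^3) Dh" by (simp add: smult_power)
      moreover have "x^4 = x^3 * x" by (simp add: eval_nat_numeral)
      ultimately have "x^3 * x dvd x^3 * smult (c^3) Dh" by (simp only:)
      moreover have "x^3 \<noteq> 0" by (simp add: x_def)
      ultimately have "x dvd smult (c^3) Dh" by (simp only: dvd_mult_cancel_left) simp
      then have "[:-e, 1:] dvd D_hom K [:b, a:] [:d, c:]"
        using \<open>c \<noteq> 0\<close> by (simp add: dvd_smult_iff x_def Dh_def)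
      then have "poly (D_hom K [:b, a:] [:d, c:]) e = 0" by (simp add: poly_eq_0_iff_dvd)
      then have "b + a * e = 0"
        using True by (simp add: poly_D_hom D_form_at_infinity mult.commute)
      then have "b = - a * e" by (simp add: eq_neg_iff_add_eq_0)
      then show False using det de by simp
    next
      case False
      then have Ve: "poly ([:d, c:]^n) e \<noteq> 0" for n by (simp add: poly_power mult.commute)
      have "[:-e, 1:]^2 dvd C_hom K [:b, a:] [:d, c:]" "[:-e, 1:]^4 dvd D_hom K [:b, a:] [:d, c:]"
        using dvd by (auto intro: linear_power_dvd_cancel[OF Ve])
      from excluded_dvd_hom[OF this det False] \<open>\<not> excluded K\<close> show False by blast
    qed
  qed
qed

text \<open>Since neither D has a t^4-term, the translation part b vanishes. The leading
  coefficients then give \<mu>^4 = d^3 a^5, which links the scaling of the fibre to that of the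
  base.\<close>

lemma affine_isomorphism_scaling:
  assumes "a \<noteq> 0" "d \<noteq> 0"
    and C: "\<And>t. d^2 * C_form K (b + a * t) d = \<mu>^2 * C_form J t 1"
    and D: "\<And>t. d^3 * D_form K (b + a * t) d = \<mu>^4 * D_form J t 1"
  shows "K \<in> wpoint J"
proof -
  obtain k2 k6 k8 k10 k12 k16 k20 where K: "K = (k2, k6, k8, k10, k12, k16, k20)" by (cases K)
  obtain j2 j6 j8 j10 j12 j16 j20 where J: "J = (j2, j6, j8, j10, j12, j16, j20)" by (cases J)
  have "smult (d^3) [:b^5 + k8 * b^3 * d^2 + k12 * b^2 * d^3 + k16 * b * d^4 + k20 * d^5,
      5 * a * b^4 + 3 * k8 * a * b^2 * d^2 + 2 * k12 * a * b * d^3 + k16 * a * d^4,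
      10 * a^2 * b^3 + 3 * k8 * a^2 * b * d^2 + k12 * a^2 * d^3,
      10 * a^3 * b^2 + k8 * a^3 * d^2, 5 * a^4 * b, a^5:] = smult (\<mu>^4) (D_poly J)" (is "?l = ?r")
  proof (intro poly_eq_cofinite eventuallyI)
    fix t
    have "poly ?l t = d^3 * D_form K (b + a * t) d"
      unfolding K by (simp add: eval_nat_numeral algebra_simps)
    then show "poly ?l t = poly ?r t" using D by (simp only: poly_smult poly_D_poly)
  qed
  then have b: "d^3 * (5 * a^4 * b) = 0" and \<mu>: "d^3 * a^5 = \<mu>^4"
    unfolding J D_poly_def by simp_all
  then have "b = 0" using assms(1,2) by simp
  \<comment> \<open>These play the roles of l^4 and l^2; \<rho>^2 = w is the relation \<mu>^4 = d^3
    a^5.\<close>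
  define w \<rho> where w: "w = a / d" and \<rho>: "\<rho> = \<mu>^2 / (a^2 * d^2)"
  have "w \<noteq> 0" using assms(1,2) by (simp add: w)
  moreover have "\<rho>^2 = w"
  proof -
    have "\<rho>^2 = \<mu>^4 / (a^4 * d^4)" by (simp add: \<rho> power_divide power_mult_distrib flip: power_mult)
    also have "\<dots> = w" unfolding \<mu>[symmetric] w using assms(1,2) by (simp add: field_simps eval_nat_numeral)
    finally show ?thesis .
  qed
  moreover have "C_form K (w * t) 1 = \<rho> * w^2 * C_form J t 1" for t
  proof -
    have "\<mu>^2 * C_form J t 1 = d^4 * C_form K (w * t) 1"
      unfolding C[symmetric] C_form_dehomogenize[OF assms(2)] w \<open>b = 0\<close>
      by (simp add: eval_nat_numeral)
    then show ?thesis unfolding \<rho> w using assms(1,2) by (simp add: field_simps eval_nat_numeral)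
  qed
  moreover have "D_form K (w * t) 1 = w^5 * D_form J t 1" for t
  proof -
    have "d^3 * a^5 * D_form J t 1 = d^8 * D_form K (w * t) 1"
      unfolding \<mu> D[symmetric] D_form_dehomogenize[OF assms(2)] w \<open>b = 0\<close>
      by (simp add: eval_nat_numeral)
    then show ?thesis unfolding w using assms(1,2) by (simp add: field_simps eval_nat_numeral)
  qed
  ultimately show ?thesis by (rule mem_wpointI)
qed

text \<open>If the pole of the Moebius transformation is finite, both surfaces have a second fibre of
  type III* besides the one at infinity, and there are normal forms
  \<open>C = k \<tau>^2\<close>, \<open>D = \<tau>^3 (\<tau>^2 + 5 r \<tau> + q)\<close> with \<open>\<tau> = t - r\<close>; swapping the two fibres amounts
  to a mere rescaling.\<close>

lemma swap_isomorphism_scaling: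
  assumes "c \<noteq> 0" and det: "a * d - b * c \<noteq> 0" and "\<mu> \<noteq> 0"
    and C: "\<And>t. (d + c * t)^2 * C_form K (b + a * t) (d + c * t) = \<mu>^2 * C_form J t 1"
    and D: "\<And>t. (d + c * t)^3 * D_form K (b + a * t) (d + c * t) = \<mu>^4 * D_form J t 1"
  shows "K \<in> wpoint J"
proof -
  \<comment> \<open>r is the pole, where K has its fibre at infinity. With t = \<tau> + r the
    transformation is (h + a \<tau>) / (c \<tau>), and c h is minus the determinant.\<close>
  define r where "r = - d / c"
  define h where "h = b + a * r"
  have ct: "d + c * (\<tau> + r) = c * \<tau>" and at: "b + a * (\<tau> + r) = h + a * \<tau>" for \<tau>
    using \<open>c \<noteq> 0\<close> by (simp_all add: r_def h_def algebra_simps)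
  have "h \<noteq> 0" using det \<open>c \<noteq> 0\<close> by (simp add: h_def r_def field_simps)
  define Ch Dh where Ch: "Ch = C_hom K [:b, a:] [:d, c:]" and Dh: "Dh = D_hom K [:b, a:] [:d, c:]"
  have V: "d + c * t = c * (t - r)" for t using \<open>c \<noteq> 0\<close> by (simp add: r_def algebra_simps)
  \<comment> \<open>The powers of the denominator in \<open>C\<close> and \<open>D\<close> force (t
    - r)^2 and (t - r)^3 into the forms of J: this is the second III* fibre.\<close>
  have "C_poly J = [:-r, 1:]^2 * smult (c^2 / \<mu>^2) Ch"
  proof (intro poly_eq_cofinite eventuallyI)
    fix t
    show "poly (C_poly J) t = poly ([:-r, 1:]^2 * smult (c^2 / \<mu>^2) Ch) t"
    proof -
      define X where "X = C_form K (b + a * t) (d + c * t)"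
      have "(d + c * t)^2 * X = \<mu>^2 * C_form J t 1" using C[of t] by (simp only: X_def)
      then have "c^2 * ((t - r)^2 * X) = \<mu>^2 * C_form J t 1"
        by (simp add: V power_mult_distrib mult.assoc)
      moreover have "poly Ch t = X" by (simp add: Ch poly_C_hom X_def mult.commute)
      ultimately show ?thesis
        using \<open>\<mu> \<noteq> 0\<close> by (simp add: poly_power poly_C_poly field_simps)
    qed
  qed
  then obtain k where k: "C_poly J = [:-r, 1:]^2 * k" by blast
  have "degree k = 0"
  proof (cases "k = 0")
    case False
    then have "degree (C_poly J) = 2 + degree k"
      unfolding k by (subst degree_mult_eq) (auto simp: degree_linear_power)
    then show ?thesis using degree_C_poly[of J] by simp
  qed simp
  then obtain k0 where "k = [:k0:]" by (metis degree_eq_zeroE)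
  then have CJ: "C_form J (\<tau> + r) 1 = k0 * \<tau>^2" for \<tau>
    unfolding poly_C_poly[symmetric] k by (simp add: poly_power)
  have "D_poly J = [:-r, 1:]^3 * smult (c^3 / \<mu>^4) Dh"
  proof (intro poly_eq_cofinite eventuallyI)
    fix t
    show "poly (D_poly J) t = poly ([:-r, 1:]^3 * smult (c^3 / \<mu>^4) Dh) t"
    proof -
      define X where "X = D_form K (b + a * t) (d + c * t)"
      have "(d + c * t)^3 * X = \<mu>^4 * D_form J t 1" using D[of t] by (simp only: X_def)
      then have "c^3 * ((t - r)^3 * X) = \<mu>^4 * D_form J t 1"
        by (simp add: V power_mult_distrib mult.assoc)
      moreover have "poly Dh t = X" by (simp add: Dh poly_D_hom X_def mult.commute)
      ultimately show ?thesis
        using \<open>\<mu> \<noteq> 0\<close> by (simp add: poly_power poly_D_poly field_simps)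
    qed
  qed
  then obtain g where g: "D_poly J = [:-r, 1:]^3 * g" by blast
  have "g \<noteq> 0" using g degree_D_poly[of J] by auto
  then have "degree (D_poly J) = 3 + degree g"
    unfolding g by (subst degree_mult_eq) (auto simp: degree_linear_power)
  then have "degree g = 2" using degree_D_poly[of J] by simp
  then obtain g0 g1 g2 where g': "g = [:g0, g1, g2:]"
    by (intro that[of "coeff g 0" "coeff g 1" "coeff g 2"] poly_eqI)
      (auto simp: coeff_pCons coeff_eq_0 numeral_2_eq_2 split: nat.split)
  \<comment> \<open>The normalization of D again: leading coefficient 1 and t^4-coefficient g1 - 3 r
    = 0. Rewriting t^2 + 3 r t + g0 in \<tau> gives \<tau>^2 + 5 r \<tau> + q.\<close>
  have "g2 = 1" "g1 = 3 * r"
    using g unfolding g' by (cases J; simp add: D_poly_def eval_nat_numeral; fail)+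
  define q where "q = 4 * r^2 + g0"
  have DJ: "D_form J (\<tau> + r) 1 = \<tau>^3 * (\<tau>^2 + 5 * r * \<tau> + q)" for \<tau>
    unfolding poly_D_poly[symmetric] g g' \<open>g2 = 1\<close> \<open>g1 = 3 * r\<close> q_def
    by (simp add: poly_power algebra_simps power2_eq_square)
  have CK: "C_form K s 1 = (\<mu>^2 / (c^2 * h^2)) * k0 * (s - a / c)^2"
    and DK: "D_form K s 1 = \<mu>^4 / (c^3 * h^5) * (s - a / c)^3 *
      (h^2 / c^2 + 5 * r * (h / c) * (s - a / c) + q * (s - a / c)^2)"
    if "s \<noteq> a / c" for s
  proof -
    define \<sigma> where "\<sigma> = s - a / c"
    have \<sigma>: "\<sigma> \<noteq> 0" using that by (simp add: \<sigma>_def)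
    \<comment> \<open>In coordinates centred at r and at a / c, the image of infinity, the
      transformation is the inversion \<sigma> \<tau> = h / c.\<close>
    define \<tau> where "\<tau> = h / (c * \<sigma>)"
    have \<tau>: "\<tau> \<noteq> 0" "c * \<tau> \<noteq> 0" using \<open>h \<noteq> 0\<close> \<open>c \<noteq> 0\<close> \<sigma> by (simp_all add: \<tau>_def)
    have "(h + a * \<tau>) / (c * \<tau>) = s"
    proof -
      have "h = c * \<sigma> * \<tau>" using \<open>c \<noteq> 0\<close> \<sigma> by (simp add: \<tau>_def)
      moreover have "c * s = c * \<sigma> + a" using \<open>c \<noteq> 0\<close> by (simp add: \<sigma>_def right_diff_distrib)
      ultimately have "h + a * \<tau> = s * (c * \<tau>)" by algebra
      then show ?thesis using \<tau> by (simp add: eq_divide_eq)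
    qed
    then have "(c * \<tau>)^4 * C_form K s 1 = \<mu>^2 * (k0 * \<tau>^2)"
      "(c * \<tau>)^8 * D_form K s 1 = \<mu>^4 * (\<tau>^3 * (\<tau>^2 + 5 * r * \<tau> + q))"
      using C[of "\<tau> + r"] D[of "\<tau> + r"]
      unfolding ct at CJ DJ C_form_dehomogenize[OF \<tau>(2)] D_form_dehomogenize[OF \<tau>(2)]
      by (simp_all flip: power_add mult.assoc)
    then have 1: "C_form K s 1 = \<mu>^2 * (k0 * \<tau>^2) / (c * \<tau>)^4"
      and 2: "D_form K s 1 = \<mu>^4 * (\<tau>^3 * (\<tau>^2 + 5 * r * \<tau> + q)) / (c * \<tau>)^8"
      using \<tau> by (simp_all add: eq_divide_eq mult.commute)
    show "C_form K s 1 = (\<mu>^2 / (c^2 * h^2)) * k0 * (s - a / c)^2"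
      unfolding 1 \<sigma>_def[symmetric] unfolding \<tau>_def using \<open>h \<noteq> 0\<close> \<open>c \<noteq> 0\<close> \<sigma>
      by (simp add: field_simps eval_nat_numeral)
    show "D_form K s 1 = \<mu>^4 / (c^3 * h^5) * (s - a / c)^3 *
      (h^2 / c^2 + 5 * r * (h / c) * (s - a / c) + q * (s - a / c)^2)"
      unfolding 2 \<sigma>_def[symmetric] unfolding \<tau>_def using \<open>h \<noteq> 0\<close> \<open>c \<noteq> 0\<close> \<sigma>
      by (simp add: field_simps eval_nat_numeral)
  qed
  define \<kappa> where "\<kappa> = \<mu>^4 / (c^3 * h^5)"
  define r' h' where "r' = a / c" and "h' = h / c"
  have ev: "\<forall>\<^sub>F s in cofinite. s \<noteq> a / c" by (simp add: eventually_cofinite)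
  have CK_poly: "C_poly K = smult ((\<mu>^2 / (c^2 * h^2)) * k0) ([:-r', 1:]^2)"
  proof (rule poly_eq_cofinite, rule eventually_mono[OF ev])
    fix s assume "s \<noteq> a / c"
    then show "poly (C_poly K) s = poly (smult ((\<mu>^2 / (c^2 * h^2)) * k0) ([:-r', 1:]^2)) s"
      by (simp add: poly_C_poly CK poly_power r'_def)
  qed
  have DK_poly: "D_poly K = smult \<kappa> ([:-r', 1:]^3 *
      ([:h'^2:] + smult (5 * r * h') [:-r', 1:] + smult q ([:-r', 1:]^2)))"
  proof (rule poly_eq_cofinite, rule eventually_mono[OF ev])
    fix s assume s: "s \<noteq> a / c"
    have "poly (D_poly K) s = \<kappa> * (s - r')^3 * (h'^2 + 5 * r * h' * (s - r') + q * (s - r')^2)"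
      unfolding poly_D_poly DK[OF s] \<kappa>_def r'_def h'_def by (simp add: power_divide)
    then show "poly (D_poly K) s = poly (smult \<kappa> ([:-r', 1:]^3 *
      ([:h'^2:] + smult (5 * r * h') [:-r', 1:] + smult q ([:-r', 1:]^2)))) s"
      by (simp only: poly_smult poly_mult poly_power poly_add poly_pCons poly_0)
        (simp add: algebra_simps)
  qed
  \<comment> \<open>The inversion exchanges leading and constant coefficients, so monicity of the D
    of K says \<kappa> q = 1. Its missing t^4-term then relates r to r'.\<close>
  have "\<kappa> * q = 1"
    using DK_poly by (cases K) (simp add: D_poly_def eval_nat_numeral algebra_simps)
  have "coeff (D_poly K) 4 = \<kappa> * (5 * r * h') - 5 * r' * (\<kappa> * q)"
    unfolding DK_poly by (simp add: eval_nat_numeral algebra_simps)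
  moreover have "coeff (D_poly K) 4 = 0" by (cases K) (simp add: D_poly_def eval_nat_numeral)
  ultimately have 4: "\<kappa> * (5 * r * h') = 5 * r' * (\<kappa> * q)" by simp
  have "q \<noteq> 0" "\<kappa> \<noteq> 0" using \<open>\<kappa> * q = 1\<close> by auto
  have "\<kappa> * (5 * (r * h')) = \<kappa> * (5 * (r' * q))" using 4 by (simp add: mult_ac)
  then have rh: "r * h' = r' * q" using \<open>\<kappa> \<noteq> 0\<close> by simp
  \<comment> \<open>Multiplication by w fixes infinity and carries r to r'; it replaces the
    inversion as an isomorphism between the two bases.\<close>
  define w where "w = h' / q"
  have wq: "h' = w * q" using \<open>q \<noteq> 0\<close> by (simp add: w_def)
  have r': "r' = w * r" using rh \<open>q \<noteq> 0\<close> by (simp add: w_def field_simps)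
  define \<rho> where "\<rho> = \<mu>^2 / (c^2 * h^2)"
  have "w \<noteq> 0" using \<open>h \<noteq> 0\<close> \<open>c \<noteq> 0\<close> \<open>q \<noteq> 0\<close> by (simp add: w_def h'_def)
  moreover have "\<rho>^2 = w"
  proof -
    have "\<rho>^2 = \<mu>^4 / (c^4 * h^4)" by (simp add: \<rho>_def power_divide power_mult_distrib flip: power_mult)
    also have "\<dots> = \<kappa> * h'"
      using \<open>c \<noteq> 0\<close> \<open>h \<noteq> 0\<close> by (simp add: \<kappa>_def h'_def field_simps eval_nat_numeral)
    also have "\<dots> = w" using \<open>\<kappa> * q = 1\<close> by (simp add: wq)
    finally show ?thesis .
  qed
  moreover have "C_form K (w * t) 1 = \<rho> * w^2 * C_form J t 1" for t
  proof -
    have "w * t - r' = w * (t - r)" by (simp add: r' algebra_simps)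
    then have "C_form K (w * t) 1 = \<rho> * k0 * (w * (t - r))^2"
      unfolding poly_C_poly[symmetric] CK_poly by (simp add: poly_power \<rho>_def)
    then show ?thesis using CJ[of "t - r"] by (simp add: power_mult_distrib)
  qed
  moreover have "D_form K (w * t) 1 = w^5 * D_form J t 1" for t
  proof -
    have "w * t - r' = w * (t - r)" by (simp add: r' algebra_simps)
    then have "D_form K (w * t) 1 = \<kappa> * ((w * (t - r))^3 *
        (h'^2 + 5 * r * h' * (w * (t - r)) + q * (w * (t - r))^2))"
      unfolding poly_D_poly[symmetric] DK_poly
      by (simp only: poly_smult poly_mult poly_power poly_add poly_pCons poly_0) (simp add: algebra_simps)
    also have "\<dots> = (\<kappa> * q) * (w^5 * ((t - r)^3 * ((t - r)^2 + 5 * r * (t - r) + q)))"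
      unfolding wq by (simp add: eval_nat_numeral algebra_simps)
    finally show ?thesis using DJ[of "t - r"] \<open>\<kappa> * q = 1\<close> by simp
  qed
  ultimately show ?thesis by (rule mem_wpointI)
qed

text \<open>The fibrewise coefficients are reduced to a translation \<beta>, which vanishes, and a
  factor \<nu>, which becomes constant after homogenization. Only then does it matter whether the
  transformation fixes infinity.\<close>

lemma isomorphic_fibrations:
  assumes "good_base J F" and det: "a * d - b * c \<noteq> 0" and pole: "\<And>t. t \<notin> F \<Longrightarrow> c * t + d \<noteq> 0"
    and \<psi>: "\<And>t x y. (t, x, y) \<in> fib_aff J F \<Longrightarrow>
      \<psi> (t, x, y) \<in> fib_aff K F' \<and> fst (\<psi> (t, x, y)) = (a * t + b) / (c * t + d)"
    and pull1: "\<And>f. f \<in> fun_aff F' \<Longrightarrow> \<exists>g\<in>fun_aff F. \<forall>q\<in>fib_aff J F. g q = f (\<psi> q)"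
    and pull2: "\<And>g. g \<in> fun_aff F \<Longrightarrow> \<exists>f\<in>fun_aff F'. \<forall>q\<in>fib_aff J F. f (\<psi> q) = g q"
    and nex: "\<not> excluded J" "\<not> excluded K"
  shows "K \<in> wpoint J"
proof -
  define m where "m t = (a * t + b) / (c * t + d)" for t
  define A B A' B' where AB: "A t = C_form J t 1" "B t = D_form J t 1"
    "A' t = C_form K (m t) 1" "B' t = D_form K (m t) 1" for t
  have "\<forall>t. t \<notin> F \<longrightarrow> (\<exists>\<alpha> \<beta> \<gamma>. \<alpha> \<noteq> 0 \<and>
    (\<forall>x y. (t, x, y) \<in> fib_aff J F \<longrightarrow> \<psi> (t, x, y) = (m t, \<alpha> * x + \<beta>, \<gamma> * y)) \<and>
    \<gamma>^2 = \<alpha>^3 \<and> \<gamma>^2 * A t = 3 * \<alpha>^2 * \<beta> + A' t * \<alpha>^2 \<and>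
    \<gamma>^2 * B t = 3 * \<alpha> * \<beta>^2 + 2 * A' t * \<alpha> * \<beta> + B' t * \<alpha> \<and>
    \<beta>^3 + A' t * \<beta>^2 + B' t * \<beta> = 0)"
    unfolding AB using fibre_isomorphism[OF \<psi>[folded m_def] pull1 pull2] by blast
  then obtain \<alpha> \<beta> \<gamma> where
    "\<forall>t. t \<notin> F \<longrightarrow> \<alpha> t \<noteq> 0 \<and>
    (\<forall>x y. (t, x, y) \<in> fib_aff J F \<longrightarrow> \<psi> (t, x, y) = (m t, \<alpha> t * x + \<beta> t, \<gamma> t * y)) \<and>
    (\<gamma> t)^2 = (\<alpha> t)^3 \<and> (\<gamma> t)^2 * A t = 3 * (\<alpha> t)^2 * \<beta> t + A' t * (\<alpha> t)^2 \<and>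
    (\<gamma> t)^2 * B t = 3 * \<alpha> t * (\<beta> t)^2 + 2 * A' t * \<alpha> t * \<beta> t + B' t * \<alpha> t \<and>
    (\<beta> t)^3 + A' t * (\<beta> t)^2 + B' t * \<beta> t = 0"
    by metis
  then have iso: "\<And>t. t \<notin> F \<Longrightarrow> \<alpha> t \<noteq> 0"
    "\<And>t x y. (t, x, y) \<in> fib_aff J F \<Longrightarrow> \<psi> (t, x, y) = (m t, \<alpha> t * x + \<beta> t, \<gamma> t * y)"
    "\<And>t. t \<notin> F \<Longrightarrow> (\<gamma> t)^2 = (\<alpha> t)^3"
    "\<And>t. t \<notin> F \<Longrightarrow> (\<gamma> t)^2 * A t = 3 * (\<alpha> t)^2 * \<beta> t + A' t * (\<alpha> t)^2"
    "\<And>t. t \<notin> F \<Longrightarrow> (\<gamma> t)^2 * B t = 3 * \<alpha> t * (\<beta> t)^2 + 2 * A' t * \<alpha> t * \<beta> t + B' t * \<alpha> t"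
    "\<And>t. t \<notin> F \<Longrightarrow> (\<beta> t)^3 + A' t * (\<beta> t)^2 + B' t * \<beta> t = 0"
    by (auto simp: fib_aff_iff)
  have "finite F" using assms(1) by (simp add: good_base_def)
  note fin = eventually_notin[OF this]
  note rat = isomorphism_coefficients_rational[OF \<open>finite F\<close> iso(2) pull1]
  define U V where UV: "U = [:b, a:]" "V = [:d, c:]"
  define Ch Dh where CDh: "Ch = C_hom K U V" "Dh = D_hom K U V"
  have V: "poly V t \<noteq> 0" if "t \<notin> F" for t using pole[OF that] by (simp add: UV algebra_simps)
  have hom: "poly Ch t = (poly V t)^2 * A' t" "poly Dh t = (poly V t)^5 * B' t" if "t \<notin> F" for t
  proof -
    have "poly U t / poly V t = m t" by (simp add: UV m_def algebra_simps)
    then show "poly Ch t = (poly V t)^2 * A' t" "poly Dh t = (poly V t)^5 * B' t"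
      unfolding CDh poly_C_hom poly_D_hom AB
      using C_form_dehomogenize[OF V[OF that]] D_form_dehomogenize[OF V[OF that]] by simp_all
  qed
  have \<beta>0: "\<forall>\<^sub>F t in cofinite. \<beta> t = 0"
  proof -
    obtain p q where pq: "q \<noteq> 0" "\<forall>\<^sub>F t in cofinite. poly q t * \<beta> t = poly p t"
      using rat(2) unfolding rational_fun_def by blast
    have "p = 0"
    proof (rule ccontr)
      assume "p \<noteq> 0"
      \<comment> \<open>A nonzero root \<beta> of \<beta>^2 + A' \<beta> + B' makes A'^2 - 4 B' the
        square of 2 \<beta> + A'. Multiplied by q V^3, this root of the discriminant becomes the
        polynomial N.\<close>
      define N where "N = 2 * p * V^3 + q * V * Ch"
      have "N^2 = q^2 * (V * (V * Ch^2 - smult 4 Dh))"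
      proof (rule poly_eq_cofinite)
        show "\<forall>\<^sub>F t in cofinite. poly (N^2) t = poly (q^2 * (V * (V * Ch^2 - smult 4 Dh))) t"
          using fin pq(2) eventually_poly_nonzero[OF \<open>p \<noteq> 0\<close>]
        proof eventually_elim
          case (elim t)
          then have "\<beta> t \<noteq> 0" by auto
          moreover have "\<beta> t * ((\<beta> t)^2 + A' t * \<beta> t + B' t) = 0"
            using iso(6)[OF elim(1)] by (simp add: eval_nat_numeral algebra_simps)
          ultimately have "(\<beta> t)^2 + A' t * \<beta> t + B' t = 0" by simp
          then have B't: "B' t = - ((\<beta> t)^2 + A' t * \<beta> t)" by algebra
          have "poly (N^2) t = (2 * poly p t * (poly V t)^3 + poly q t * poly V t * poly Ch t)^2"
            by (simp add: N_def poly_power)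
          also have "\<dots> = (poly q t)^2 * (poly V t * (poly V t * (poly Ch t)^2 - 4 * poly Dh t))"
            unfolding elim(2)[symmetric] hom[OF elim(1)] B't
            by (simp add: eval_nat_numeral algebra_simps)
          finally show ?case by (simp add: poly_power)
        qed
      qed
      with discriminant_not_square[OF det \<open>q \<noteq> 0\<close>, of N K] show False by (simp add: CDh UV)
    qed
    show ?thesis
      using pq(2) eventually_poly_nonzero[OF pq(1)] by eventually_elim (simp add: \<open>p = 0\<close>)
  qed
  \<comment> \<open>From \<gamma>^2 = \<alpha>^3 it follows that \<alpha> = \<nu>^2 and \<gamma> =
    \<nu>^3, the usual change of Weierstrass coordinates.\<close>
  define \<nu> where "\<nu> t = \<gamma> t / \<alpha> t" for t
  have \<nu>: "\<forall>\<^sub>F t in cofinite. \<nu> t \<noteq> 0 \<and> A' t = (\<nu> t)^2 * A t \<and> B' t = (\<nu> t)^4 * B t"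
    using fin \<beta>0
  proof eventually_elim
    case (elim t)
    note \<alpha> = iso(1)[OF elim(1)] and sq = iso(3)[OF elim(1)]
    have "\<gamma> t \<noteq> 0" using \<alpha> sq by auto
    have \<nu>2: "(\<nu> t)^2 = \<alpha> t" unfolding \<nu>_def power_divide sq using \<alpha> by (simp add: eval_nat_numeral)
    have "(\<alpha> t)^2 * (\<alpha> t * A t) = (\<alpha> t)^2 * A' t"
      using iso(4)[OF elim(1), unfolded sq] elim(2) by (simp add: eval_nat_numeral algebra_simps)
    then have 1: "A' t = (\<nu> t)^2 * A t" using \<alpha> by (simp add: \<nu>2)
    have "\<alpha> t * ((\<alpha> t)^2 * B t) = \<alpha> t * B' t"
      using iso(5)[OF elim(1), unfolded sq] elim(2) by (simp add: eval_nat_numeral algebra_simps)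
    then have "B' t = (\<alpha> t)^2 * B t" using \<alpha> by simp
    also have "(\<alpha> t)^2 = (\<nu> t)^4" by (simp flip: \<nu>2 power_mult)
    finally show ?case using 1 \<alpha> \<open>\<gamma> t \<noteq> 0\<close> by (simp add: \<nu>_def)
  qed
  obtain p q where pq: "q \<noteq> 0" "\<forall>\<^sub>F t in cofinite. poly q t * \<nu> t = poly p t"
    using rational_fun_divide[OF rat(3,1)] unfolding rational_fun_def \<nu>_def by blast
  \<comment> \<open>The factor V^2 passes from the chart v = 1 to the homogeneous models: V^2 \<nu>
    multiplies by its square and fourth power to relate them, as V^2 C(U,V) = V^4 A' and V^3 D(U,V)
    = V^8 B'.\<close>
  obtain G P Q where PQ: "V^2 * p = G * P" "q = G * Q" "\<forall>e. poly P e \<noteq> 0 \<or> poly Q e \<noteq> 0"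
    using cancel_common_roots[OF pq(1), of "V^2 * p"] by blast
  have "G \<noteq> 0" "Q \<noteq> 0" using PQ(2) pq(1) by auto
  have \<mu>: "\<forall>\<^sub>F t in cofinite. poly Q t * ((poly V t)^2 * \<nu> t) = poly P t"
    using pq(2) eventually_poly_nonzero[OF \<open>G \<noteq> 0\<close>]
  proof eventually_elim
    case (elim t)
    have "poly G t * (poly Q t * ((poly V t)^2 * \<nu> t)) = (poly V t)^2 * (poly q t * \<nu> t)"
      by (simp add: PQ(2) mult_ac)
    also have "\<dots> = poly (V^2 * p) t" by (simp add: elim(1) poly_power)
    also have "\<dots> = poly G t * poly P t" by (simp add: PQ(1))
    finally show ?case using elim(2) by simp
  qed
  have eqs: "\<forall>\<^sub>F t in cofinite. poly (Q^2 * (V^2 * Ch)) t = poly (P^2 * C_poly J) t \<and>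
      poly (Q^4 * (V^3 * Dh)) t = poly (P^4 * D_poly J) t"
    using fin \<nu> \<mu>
  proof eventually_elim
    case (elim t)
    have "poly (P^2 * C_poly J) t = (poly Q t * ((poly V t)^2 * \<nu> t))^2 * A t"
      "poly (P^4 * D_poly J) t = (poly Q t * ((poly V t)^2 * \<nu> t))^4 * B t"
      by (simp_all add: poly_power elim(3) AB poly_C_poly poly_D_poly)
    then show ?case
      using elim(2) by (simp add: poly_power hom[OF elim(1)] power_mult_distrib eval_nat_numeral)
  qed
  then have C: "Q^2 * (V^2 * Ch) = P^2 * C_poly J" and D: "Q^4 * (V^3 * Dh) = P^4 * D_poly J"
    by (auto intro!: poly_eq_cofinite simp: eventually_conj_iff simp del: poly_mult)
  note const = scaling_factor_constant[OF det nex PQ(3)[rule_format] C[unfolded CDh UV] D[unfolded CDh UV]]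
  obtain P0 Q0 where PQ0: "P = [:P0:]" "Q = [:Q0:]" using const by (metis degree_eq_zeroE)
  have "Q0 \<noteq> 0" using \<open>Q \<noteq> 0\<close> by (simp add: PQ0)
  have "P0 \<noteq> 0"
  proof
    assume P0: "P0 = 0"
    have "\<forall>\<^sub>F t :: complex in cofinite. False"
      using \<mu> \<nu> fin
    proof eventually_elim
      case (elim t)
      then show ?case using V[OF elim(3)] \<open>Q0 \<noteq> 0\<close> by (simp add: PQ0 P0)
    qed
    then show False by (simp add: eventually_cofinite infinite_UNIV_char_0)
  qed
  define \<mu> where "\<mu> = P0 / Q0"
  have "\<mu> \<noteq> 0" using \<open>P0 \<noteq> 0\<close> \<open>Q0 \<noteq> 0\<close> by (simp add: \<mu>_def)
  have C': "(d + c * t)^2 * C_form K (b + a * t) (d + c * t) = \<mu>^2 * C_form J t 1" for t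
    using arg_cong[OF C, of "\<lambda>p. poly p t"] \<open>Q0 \<noteq> 0\<close>
    by (simp add: PQ0 poly_power poly_C_poly CDh poly_C_hom UV \<mu>_def field_simps)
  have D': "(d + c * t)^3 * D_form K (b + a * t) (d + c * t) = \<mu>^4 * D_form J t 1" for t
    using arg_cong[OF D, of "\<lambda>p. poly p t"] \<open>Q0 \<noteq> 0\<close>
    by (simp add: PQ0 poly_power poly_D_poly CDh poly_D_hom UV \<mu>_def field_simps)
  show ?thesis
  proof (cases "c = 0")
    case True
    then have "a \<noteq> 0" "d \<noteq> 0" using det by auto
    then show ?thesis
      by (rule affine_isomorphism_scaling[where b = b and \<mu> = \<mu>]) (use C' D' True in auto)
  next
    case False
    from swap_isomorphism_scaling[OF this det \<open>\<mu> \<noteq> 0\<close> C' D'] show ?thesis .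
  qed
qed

text \<open>The explicit isogeny exhibits \<open>dual_coords J\<close> as one quotient of the
  surface, and K is any other one. Minimality of the dual follows from that of J because the duality
  is an involution preserving the excluded family.\<close>

lemma vgsn_related_imp_dual:
  assumes "vgsn_related J K" "\<not> excluded J" "\<not> excluded K"
  shows "K \<in> wpoint (dual_coords J)"
proof -
  show ?thesis
    using assms(1) unfolding vgsn_related_def
  proof (elim exE conjE)
    fix F F' a b c d \<phi>
    assume rel: "good_base J F" "a * d - b * c \<noteq> 0" "\<forall>t. t \<notin> F \<longrightarrow> c * t + d \<noteq> 0"
      "quotient_by_involution (fib_punct J F) (fun_punct F) (torsion_translation J)
        (fib_aff K F') (fun_aff F') \<phi>"
      "\<forall>(t, x, y)\<in>fib_punct J F. fst (\<phi> (t, x, y)) = (a * t + b) / (c * t + d)"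
    define s F0 where s: "s = shift J" and F0: "F0 = (\<lambda>t. shift J - t) ` F"
    obtain \<psi> where \<psi>: "(\<forall>p\<in>fib_punct J F. \<psi> (isogeny J p) = \<phi> p) \<and>
      (\<forall>f\<in>fun_aff F'. \<exists>g\<in>fun_aff F0. \<forall>q\<in>fib_aff (dual_coords J) F0. g q = f (\<psi> q)) \<and>
      (\<forall>g\<in>fun_aff F0. \<exists>f\<in>fun_aff F'. \<forall>q\<in>fib_aff (dual_coords J) F0. f (\<psi> q) = g q)"
      using quotient_comparison[OF isogeny_quotient[OF rel(1)] rel(4)] unfolding F0 ..
    note \<psi>1 = \<psi>[THEN conjunct1, rule_format]
      and \<psi>2 = \<psi>[THEN conjunct2, THEN conjunct1, THEN bspec]
      and \<psi>3 = \<psi>[THEN conjunct2, THEN conjunct2, THEN bspec]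
    have good: "good_base (dual_coords J) F0" unfolding F0 by (rule good_base_dual[OF rel(1)])
    \<comment> \<open>The coefficients belong to the given Moebius transformation composed with t to
      s - t, which only changes the sign of the determinant.\<close>
    have det: "(- a) * (c * s + d) - (a * s + b) * (- c) \<noteq> 0" using rel(2) by (simp add: algebra_simps)
    have pole: "(- c) * t + (c * s + d) \<noteq> 0" if "t \<notin> F0" for t
    proof -
      have "s - t \<notin> F" using that by (auto simp: F0 s image_iff)
      from rel(3)[rule_format, OF this] show ?thesis by (simp add: algebra_simps)
    qed
    have base: "\<psi> (t, x, y) \<in> fib_aff K F' \<and>
        fst (\<psi> (t, x, y)) = ((- a) * t + (a * s + b)) / ((- c) * t + (c * s + d))"
      if "(t, x, y) \<in> fib_aff (dual_coords J) F0" for t x y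
    proof -
      have "(t, x, y) \<in> isogeny J ` fib_punct J F"
        using that unfolding F0 isogeny_image[OF rel(1)] .
      then obtain p where p: "p \<in> fib_punct J F" "(t, x, y) = isogeny J p" by blast
      obtain t' x' y' where p': "p = (t', x', y')" by (cases p)
      have t': "t' = s - t" using p(2) by (simp add: p' isogeny_def s)
      have "\<psi> (t, x, y) = \<phi> p" using \<psi>1[OF p(1)] p(2) by simp
      moreover have "\<phi> p \<in> fib_aff K F'" 
        using rel(4)[unfolded quotient_by_involution_def, THEN conjunct1] p(1) by blast
      moreover have "fst (\<phi> p) = (a * (s - t) + b) / (c * (s - t) + d)"
        using bspec[OF rel(5) p(1)] by (simp add: p' t')
      ultimately show ?thesis by (simp add: algebra_simps)
    qed
    have "\<not> excluded (dual_coords J)" using assms(2) excluded_dual[of "dual_coords J"] by (auto simp: dual_dual)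
    from isomorphic_fibrations[OF good det pole base \<psi>2 \<psi>3 this assms(3)] show ?thesis .
  qed
qed

text \<open>Duality of points asks for a relation between some representatives J' and K, and J' need
  not be J; \<open>dual_scale\<close> makes the outcome independent of this choice. Membership of Q
  in the moduli space supplies the minimality of K.\<close>

lemma is_vgsn_dual_iff:
  assumes "wpoint J \<in> moduli"
  shows "is_vgsn_dual (wpoint J) Q \<longleftrightarrow> Q = wpoint (dual_coords J)"
proof
  assume "Q = wpoint (dual_coords J)"
  then show "is_vgsn_dual (wpoint J) Q"
    using dual_in_moduli[OF assms] self_in_wpoint vgsn_related_dual unfolding is_vgsn_dual_def by blast
next
  assume "is_vgsn_dual (wpoint J) Q"
  then obtain J' K where JK: "J' \<in> wpoint J" "K \<in> Q" "Q \<in> moduli" "vgsn_related J' K"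
    unfolding is_vgsn_dual_def by blast
  obtain L where "Q = wpoint L" using JK(3) unfolding moduli_def WP_def by blast
  then have Q: "Q = wpoint K" using wpoint_eq JK(2) by simp
  have "wpoint J' \<in> moduli" using wpoint_eq[OF JK(1)] assms by simp
  then have "K \<in> wpoint (dual_coords J')"
    using vgsn_related_imp_dual[OF JK(4)] JK(3) unfolding Q wpoint_in_moduli by blast
  then have "Q = wpoint (dual_coords J')" using wpoint_eq Q by simp
  also obtain l where "l \<noteq> 0" "J' = scale l J" using JK(1) unfolding wpoint_def by blast
  then have "dual_coords J' \<in> wpoint (dual_coords J)"
    using dual_scale[of l J] unfolding wpoint_def by auto
  then have "wpoint (dual_coords J') = wpoint (dual_coords J)" by (rule wpoint_eq)
  finally show "Q = wpoint (dual_coords J)" .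
qed

lemma vgsn_wpoint:
  assumes "wpoint J \<in> moduli"
  shows "vgsn (wpoint J) = wpoint (dual_coords J)"
  unfolding vgsn_def is_vgsn_dual_iff[OF assms] by simp

lemma moduliE:
  assumes "P \<in> moduli"
  obtains J where "P = wpoint J"
  using assms unfolding moduli_def WP_def by blast

theorem proposition2p16:
  shows "(\<forall>P\<in>moduli. \<exists>!Q. is_vgsn_dual P Q) \<and>
    vgsn \<in> moduli \<rightarrow> moduli \<and>
    (\<forall>P\<in>moduli. vgsn (vgsn P) = P) \<and>
    (\<forall>J2 J6 J8 J10 J12 J16 J20 :: complex.
      wpoint (J2, J6, J8, J10, J12, J16, J20) \<in> moduli \<longrightarrow>
      vgsn (wpoint (J2, J6, J8, J10, J12, J16, J20)) = wpoint
       (- J2,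
        J6 + 1/10 * J2^3,
        J8 - 1/2 * J6 * J2 - 1/40 * J2^4,
        - J10 - 1/20 * J6 * J2^2 - 1/400 * J2^5,
        - J12 + 1/2 * J10 * J2 - 3/20 * J8 * J2^2 + 1/4 * J6^2 + 3/40 * J6 * J2^3
          + 1/400 * J2^6,
        J16 + 1/10 * J12 * J2^2 - 1/2 * J10 * J6 - 1/20 * J10 * J2^3 + 3/400 * J8 * J2^4
          - 1/40 * J6^2 * J2^2 - 3/800 * J6 * J2^5 - 3/32000 * J2^8,
        - J20 - 1/20 * J16 * J2^2 - 1/400 * J12 * J2^4 + 1/4 * J10^2
          + 1/40 * J10 * J6 * J2^2 + 1/800 * J10 * J2^5 - 1/8000 * J8 * J2^6
          + 1/1600 * J6^2 * J2^4 + 1/16000 * J6 * J2^7 + 1/800000 * J2^10))"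
proof (intro conjI ballI allI impI Pi_I)
  fix P assume P: "P \<in> moduli"
  then obtain J where J: "P = wpoint J" by (rule moduliE)
  note PJ = P[unfolded J]
  show "\<exists>!Q. is_vgsn_dual P Q" unfolding J is_vgsn_dual_iff[OF PJ] by simp
  show "vgsn P \<in> moduli" unfolding J vgsn_wpoint[OF PJ] by (rule dual_in_moduli[OF PJ])
  show "vgsn (vgsn P) = P"
    unfolding J vgsn_wpoint[OF PJ] vgsn_wpoint[OF dual_in_moduli[OF PJ]] dual_dual ..
qed (simp only: vgsn_wpoint dual_coords.simps)

end
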